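(* Let $f=u\chi_\Omega$, where $\Omega\subset B=\{|\mathbf{x}|<1\}\subset\mathbb{R}^2$ is a compact domain with smooth boundary and $u\in C^\infty(\mathbb{R}^2)$ with $u>0$. Let $(s_0,\theta_0)$ be such that the line $L(s_0,\theta_0)$ is tangent to $\partial\Omega$ and the set of tangent points is either a line segment or a single point at which the curvature of $\partial\Omega$ is not zero. Suppose the smoothing kernel satisfies $\varphi\in H^{\lambda,\infty}(\mathbb{R}^2)$ with $\lambda>1$. Then the function $s\mapsto\mathcal{R}f(s,\theta_0)$ is not in $H^{1,2}$ locally near $s_0$.
   Context: Fourier transform: $\hat f(\xi)=\int e^{-i\mathbf{x}\cdot\xi}f(\mathbf{x})\,d\mathbf{x}$. For $\alpha\in\mathbb{R}$, $1\le p\le\infty$, $H^{\alpha,p}(\mathbb{R}^n)$ is the space of tempered distributions $f$ whose Fourier transform is a measurable function with $\|(1+|\xi|^2)^{\alpha/2}\hat f\|_{L^p(\mathbb{R}^n)}<\infty$. A distribution $g$ is in $H^{\alpha,p}$ locally near a point $y_0$ if there is $\eta\in C_c^\infty$ with $\eta(y_0)\ne0$ and $\eta g\in H^{\alpha,p}$. Fix $a,b>0$ and $2\psi\in(0,\pi)$. The V-line transform is $$\mathcal{V}_{a,b}f(\mathbf{x},\phi)=a\int_0^\infty f(\mathbf{x}+t\Phi)\,dt+b\int_0^\infty f(\mathbf{x}+t\Phi')\,dt,$$ with $\Phi=(\cos(\phi+2\psi-\pi/2),\sin(\phi+2\psi-\pi/2))$, $\Phi'=(\cos(\phi-\pi/2),\sin(\phi-\pi/2))$.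 Its smoothed version is $\widetilde{\mathcal{V}_{a,b}}f(\cdot,\phi)=\varphi*\mathcal{V}_{a,b}f(\cdot,\phi)$ (convolution in $\mathbf{x}$), where $\varphi\ge0$ is a smoothing kernel with bounded support and $\int_{\mathbb{R}^2}\varphi=1$. For $s\in\mathbb{R}$, $\theta\in[-\pi,\pi]$ let $\Theta=(\cos\theta,\sin\theta)$ and $L(s,\theta)=\{\mathbf{x}\in\mathbb{R}^2:\mathbf{x}\cdot\Theta=s\}$. The non-linear transform is $$\mathcal{R}f(s,\theta)=c_0\int_{L(s,\theta)}w(\mathbf{x})f(\mathbf{x})e^{-\widetilde{\mathcal{V}_{a,b}}f(\mathbf{x},\theta)}\,dl(\mathbf{x}),$$ where $c_0>0$ is a constant, $w$ is a fixed smooth weight with $w>0$ on $B$, and $dl$ is arc length. *)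

theory Defs
  imports "HOL-Analysis.Analysis"
begin

section \<open>Smooth functions, Schwartz functions, tempered distributions\<close>

fun iter_deriv :: "'a::euclidean_space list \<Rightarrow> ('a \<Rightarrow> 'b::real_normed_vector) \<Rightarrow> 'a \<Rightarrow> 'b" where
  "iter_deriv [] f = f"
| "iter_deriv (v # vs) f = (\<lambda>x. frechet_derivative (iter_deriv vs f) (at x) v)"

text \<open>Meant for open sets. All iterated partial derivatives being differentiable forces them
  to be continuous, so this is \<open>C\<^sup>\<infinity>\<close>.\<close>

definition smooth_on :: "'a::euclidean_space set \<Rightarrow> ('a \<Rightarrow> 'b::real_normed_vector) \<Rightarrow> bool" where
  "smooth_on U f \<longleftrightarrow>
     (\<forall>vs. set vs \<subseteq> Basis \<longrightarrow> (\<forall>x\<in>U. iter_deriv vs f differentiable (at x)))"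

definition test_function :: "('a::euclidean_space \<Rightarrow> complex) \<Rightarrow> bool" where
  "test_function h \<longleftrightarrow> smooth_on UNIV h \<and> compact (closure {x. h x \<noteq> 0})"

definition schwartz :: "('a::euclidean_space \<Rightarrow> complex) \<Rightarrow> bool" where
  "schwartz h \<longleftrightarrow> smooth_on UNIV h \<and>
     (\<forall>N vs. set vs \<subseteq> Basis \<longrightarrow> (\<exists>C. \<forall>x. (1 + norm x) ^ N * norm (iter_deriv vs h x) \<le> C))"

definition schwartz_norm :: "nat \<Rightarrow> ('a::euclidean_space \<Rightarrow> complex) \<Rightarrow> real" where
  "schwartz_norm N h =
     (SUP (vs, x) \<in> {vs. set vs \<subseteq> Basis \<and> length vs \<le> N} \<times> UNIV.
        (1 + norm x) ^ N * norm (iter_deriv vs h x))"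

text \<open>Distributions are functionals on functions; only the values on Schwartz functions matter.
  As the norms \<open>schwartz_norm N\<close> increase with \<open>N\<close> and generate the Schwartz topology, a linear
  functional is continuous iff it is bounded by a multiple of one of them.\<close>

definition tempered_distribution ::
    "(('a::euclidean_space \<Rightarrow> complex) \<Rightarrow> complex) \<Rightarrow> bool" where
  "tempered_distribution T \<longleftrightarrow>
     (\<forall>g h. schwartz g \<longrightarrow> schwartz h \<longrightarrow> T (\<lambda>x. g x + h x) = T g + T h) \<and>
     (\<forall>c h. schwartz h \<longrightarrow> T (\<lambda>x. c * h x) = c * T h) \<and>
     (\<exists>C N. \<forall>h. schwartz h \<longrightarrow> norm (T h) \<le> C * schwartz_norm N h)"

definition fourier :: "('a::euclidean_space \<Rightarrow> complex) \<Rightarrow> 'a \<Rightarrow> complex" where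
  "fourier f \<xi> = (\<integral>x. exp (- \<i> * complex_of_real (x \<bullet> \<xi>)) * f x \<partial>lebesgue)"

definition distribution_of :: "('a::euclidean_space \<Rightarrow> complex) \<Rightarrow> ('a \<Rightarrow> complex) \<Rightarrow> complex" where
  "distribution_of g h = (\<integral>x. g x * h x \<partial>lebesgue)"

text \<open>The Fourier transform of \<open>T\<close>, given by \<open>h \<mapsto> T (fourier h)\<close>, is the function \<open>F\<close>.\<close>

definition has_fourier_transform ::
    "(('a::euclidean_space \<Rightarrow> complex) \<Rightarrow> complex) \<Rightarrow> ('a \<Rightarrow> complex) \<Rightarrow> bool" where
  "has_fourier_transform T F \<longleftrightarrow>
     F \<in> borel_measurable lebesgue \<and>
     (\<forall>h. schwartz h \<longrightarrow>
        integrable lebesgue (\<lambda>\<xi>. F \<xi> * h \<xi>) \<and> T (fourier h) = distribution_of F h)"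


section \<open>The spaces \<open>H\<^sup>\<alpha>\<^sup>,\<^sup>p\<close>\<close>

definition finite_Lp_norm :: "ennreal \<Rightarrow> ('a::euclidean_space \<Rightarrow> complex) \<Rightarrow> bool" where
  "finite_Lp_norm p g \<longleftrightarrow> g \<in> borel_measurable lebesgue \<and>
     (if p = \<infinity> then \<exists>C. AE x in lebesgue. norm (g x) \<le> C
      else (\<integral>\<^sup>+x. ennreal (norm (g x) powr enn2real p) \<partial>lebesgue) < \<infinity>)"

text \<open>For \<open>1 \<le> p \<le> \<infinity>\<close>.\<close>

definition in_H ::
    "real \<Rightarrow> ennreal \<Rightarrow> (('a::euclidean_space \<Rightarrow> complex) \<Rightarrow> complex) \<Rightarrow> bool" where
  "in_H \<alpha> p T \<longleftrightarrow> tempered_distribution T \<and>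
     (\<exists>F. has_fourier_transform T F \<and>
        finite_Lp_norm p (\<lambda>\<xi>. complex_of_real ((1 + (norm \<xi>)\<^sup>2) powr (\<alpha> / 2)) * F \<xi>))"

text \<open>The distribution \<open>\<eta> T\<close> is \<open>h \<mapsto> T (\<eta> h)\<close>.\<close>

definition in_H_near ::
    "real \<Rightarrow> ennreal \<Rightarrow> (('a::euclidean_space \<Rightarrow> complex) \<Rightarrow> complex) \<Rightarrow> 'a \<Rightarrow> bool" where
  "in_H_near \<alpha> p T y0 \<longleftrightarrow>
     (\<exists>\<eta>. test_function \<eta> \<and> \<eta> y0 \<noteq> 0 \<and> in_H \<alpha> p (\<lambda>h. T (\<lambda>y. \<eta> y * h y)))"


section \<open>Smooth planar domains, tangency, curvature\<close>

definition direction :: "real \<Rightarrow> real^2" where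
  "direction \<theta> = vector [cos \<theta>, sin \<theta>]"

definition line :: "real \<Rightarrow> real \<Rightarrow> (real^2) set" where
  "line s \<theta> = {x. x \<bullet> direction \<theta> = s}"

text \<open>Near each boundary point, the domain is the sublevel set of a smooth function without
  critical points (in particular it lies on one side of its boundary).\<close>

definition compact_smooth_domain :: "(real^2) set \<Rightarrow> bool" where
  "compact_smooth_domain \<Omega> \<longleftrightarrow>
     \<Omega> \<noteq> {} \<and> compact \<Omega> \<and> connected (interior \<Omega>) \<and>
     (\<forall>p \<in> frontier \<Omega>. \<exists>U (\<rho> :: real^2 \<Rightarrow> real).
        open U \<and> p \<in> U \<and> smooth_on U \<rho> \<and>
        (\<forall>x\<in>U. frechet_derivative \<rho> (at x) \<noteq> (\<lambda>_. 0)) \<and>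
        \<Omega> \<inter> U = {x \<in> U. \<rho> x \<le> 0})"

definition regular_curve_at :: "(real^2) set \<Rightarrow> real^2 \<Rightarrow> (real \<Rightarrow> real^2) \<Rightarrow> bool" where
  "regular_curve_at S p \<gamma> \<longleftrightarrow> \<gamma> 0 = p \<and>
     (\<exists>e>0. smooth_on {-e<..<e} \<gamma> \<and>
        (\<forall>t\<in>{-e<..<e}. \<gamma> t \<in> S \<and> vector_derivative \<gamma> (at t) \<noteq> 0))"

text \<open>The points at which the line is tangent to the boundary of \<open>\<Omega>\<close>, i.e. common points at which
  a velocity vector of the boundary is parallel to the line.\<close>

definition tangent_points :: "(real^2) set \<Rightarrow> real \<Rightarrow> real \<Rightarrow> (real^2) set" where
  "tangent_points \<Omega> s \<theta> = {p \<in> frontier \<Omega> \<inter> line s \<theta>.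
     \<exists>\<gamma>. regular_curve_at (frontier \<Omega>) p \<gamma> \<and>
         vector_derivative \<gamma> (at 0) \<bullet> direction \<theta> = 0}"

definition curve_curvature :: "(real \<Rightarrow> real^2) \<Rightarrow> real \<Rightarrow> real" where
  "curve_curvature \<gamma> t =
     (let v = vector_derivative \<gamma> (at t);
          a = vector_derivative (\<lambda>r. vector_derivative \<gamma> (at r)) (at t)
      in \<bar>v$1 * a$2 - v$2 * a$1\<bar> / norm v ^ 3)"

text \<open>For a smooth curve \<open>S\<close> the value does not depend on the parametrization \<open>\<gamma>\<close>.\<close>

definition has_curvature_at :: "(real^2) set \<Rightarrow> real^2 \<Rightarrow> real \<Rightarrow> bool" where
  "has_curvature_at S p \<kappa> \<longleftrightarrow> (\<exists>\<gamma>. regular_curve_at S p \<gamma> \<and> \<kappa> = curve_curvature \<gamma> 0)"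


section \<open>The transforms\<close>

definition smoothing_kernel :: "(real^2 \<Rightarrow> real) \<Rightarrow> bool" where
  "smoothing_kernel k \<longleftrightarrow> (\<forall>x. k x \<ge> 0) \<and> bounded {x. k x \<noteq> 0} \<and>
     integrable lebesgue k \<and> (\<integral>x. k x \<partial>lebesgue) = 1"

definition ray_integral :: "(real^2 \<Rightarrow> real) \<Rightarrow> real^2 \<Rightarrow> real^2 \<Rightarrow> real" where
  "ray_integral f x v = (LINT t:{0..}|lebesgue. f (x + t *\<^sub>R v))"

definition vline_transform ::
    "real \<Rightarrow> real \<Rightarrow> real \<Rightarrow> (real^2 \<Rightarrow> real) \<Rightarrow> real^2 \<Rightarrow> real \<Rightarrow> real" where
  "vline_transform a b \<psi> f x \<phi> =
     a * ray_integral f x (direction (\<phi> + 2 * \<psi> - pi / 2)) +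
     b * ray_integral f x (direction (\<phi> - pi / 2))"

definition smoothed_vline_transform ::
    "(real^2 \<Rightarrow> real) \<Rightarrow> real \<Rightarrow> real \<Rightarrow> real \<Rightarrow> (real^2 \<Rightarrow> real) \<Rightarrow> real^2 \<Rightarrow> real \<Rightarrow> real" where
  "smoothed_vline_transform k a b \<psi> f x \<phi> =
     (\<integral>y. k (x - y) * vline_transform a b \<psi> f y \<phi> \<partial>lebesgue)"

text \<open>Arc length integral, via the unit speed parametrization of the line.\<close>

definition line_integral :: "real \<Rightarrow> real \<Rightarrow> (real^2 \<Rightarrow> real) \<Rightarrow> real" where
  "line_integral s \<theta> g =
     (\<integral>t. g (s *\<^sub>R direction \<theta> + t *\<^sub>R direction (\<theta> + pi / 2)) \<partial>lebesgue)"

definition nonlinear_transform ::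
    "real \<Rightarrow> (real^2 \<Rightarrow> real) \<Rightarrow> (real^2 \<Rightarrow> real) \<Rightarrow> real \<Rightarrow> real \<Rightarrow> real \<Rightarrow>
     (real^2 \<Rightarrow> real) \<Rightarrow> real \<Rightarrow> real \<Rightarrow> real" where
  "nonlinear_transform c0 w k a b \<psi> f s \<theta> =
     c0 * line_integral s \<theta>
            (\<lambda>x. w x * f x * exp (- smoothed_vline_transform k a b \<psi> f x \<theta>))"

end

theory Submission
  imports Defs "HOL-Probability.Characteristic_Functions"
begin

text \<open>For small \<open>x > 0\<close> the symmetric difference \<open>R(s\<^sub>0 + x) - R(s\<^sub>0 - x)\<close> of
  \<open>R = \<R>f(\<cdot>, \<theta>\<^sub>0)\<close> has a fixed sign \<open>\<sigma>\<close> and size at least \<open>c \<surd>x\<close>. Indeed, crossing a tangent point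
  adds a chord of length \<open>\<ge> \<kappa> \<surd>x\<close>, while by transversality and compactness the chords lost
  elsewhere have total length \<open>O(x)\<close>. The attenuation \<open>exp(-\<phi> * \<V>f)\<close> is harmless: the kernel has
  \<open>\<bar>\<phi>^(\<xi>)\<bar> \<le> C (1 + \<bar>\<xi>\<bar>)\<^bsup>-\<lambda>\<^esup>\<close> with \<open>\<lambda> > 1\<close>, and a low/high frequency splitting together with an
  \<open>L\<^sup>2\<close> bound on lines shows that its variation between the lines \<open>s\<^sub>0 \<plusminus> x\<close> is \<open>o(\<surd>x)\<close> in \<open>L\<^sup>1\<close>.

  On the other hand, if \<open>\<eta> R \<in> H\<^sup>1\<^sup>,\<^sup>2\<close>, then testing against the odd bumps
  \<open>\<gamma>((x - \<delta>)/\<delta>) - \<gamma>((x + \<delta>)/\<delta>)\<close> with \<open>\<gamma>\<close> a Gaussian gives \<open>o(\<delta>\<^bsup>3/2\<^esup>)\<close> as \<open>\<delta> \<rightarrow> 0\<close>,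
  whereas the jump gives at least a multiple of \<open>\<delta>\<^bsup>3/2\<^esup>\<close>.\<close>

section \<open>Fourier transforms of Gaussian waves\<close>

text \<open>The square root is the critical rate for \<open>H^1\<close>: local \<open>H^1\<close>
  regularity forces the bump averages to be of smaller order than those of a square-root jump, by a
  vanishing factor and not by a power. So every error has to be strictly below
  \<open>sqrt x\<close>. This is why the attenuation estimate carries an arbitrary
  \<open>\<epsilon>\<close>, and why \<open>lam > 1\<close> enters through the decay to 0 of
  frequency times transform, not through its boundedness.

  Both regularity notions concern distributions and may be tested on Schwartz functions only. All
  tests use one family, Gaussian times plane wave, whose transforms are explicit. A one-sided
  \<open>L^2\<close> bound derived from Gaussian integrals takes the place of Plancherel. The
  kernel, merely integrable, is seen through its heat mollifications, which Fatou's lemma removes at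
  the end. The ray data may jump where a ray runs along a flat piece of the boundary; boundedness
  and continuity almost everywhere suffice for that limit.

  Contributions of several tangent points could cancel. Connectedness of the tangent set excludes
  this: the side on which the domain lies is locally constant along it.\<close>

definition gaussian :: "real \<Rightarrow> 'a::euclidean_space \<Rightarrow> real" where
  "gaussian \<alpha> x = exp (- \<alpha> * (x \<bullet> x) / 2)"

lemma gaussian_nonneg [simp]: "gaussian \<alpha> x \<ge> 0"
  by (simp add: gaussian_def)

lemma borel_measurable_gaussian [measurable]: "gaussian \<alpha> \<in> borel_measurable borel"
  unfolding gaussian_def by measurable

lemma gaussian_le_1: "\<alpha> \<ge> 0 \<Longrightarrow> gaussian \<alpha> x \<le> 1"
  by (simp add: gaussian_def)

lemma gaussian_minus: "gaussian \<alpha> (x - y) = gaussian \<alpha> (y - x)"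
  by (simp add: gaussian_def inner_diff inner_commute algebra_simps)

lemma integrable_gaussian_real:
  assumes "\<alpha> > 0"
  shows "integrable lborel (gaussian \<alpha> :: real \<Rightarrow> real)"
proof -
  have "integrable lborel (std_normal_density)" by simp
  then have "integrable lborel (\<lambda>x. std_normal_density (0 + sqrt \<alpha> * x))"
    using assms by (intro lborel_integrable_real_affine) auto
  then have "integrable lborel (\<lambda>x. sqrt (2 * pi) * std_normal_density (0 + sqrt \<alpha> * x))"
    by (rule integrable_mult_right)
  moreover have "(\<lambda>x. sqrt (2 * pi) * std_normal_density (0 + sqrt \<alpha> * x)) = gaussian \<alpha>"
    using assms by (auto simp: fun_eq_iff gaussian_def std_normal_density_def power_mult_distrib power2_eq_square)
  ultimately show ?thesis by (simp only:)
qed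

text \<open>This is the characteristic function of the standard normal law, rescaled by
  \<open>sqrt \<alpha>\<close>.\<close>

lemma fourier_gaussian_real:
  fixes \<xi> :: real
  assumes "\<alpha> > 0"
  shows "(\<integral>x. exp (\<i> * complex_of_real (x * \<xi>)) * complex_of_real (gaussian \<alpha> x) \<partial>lborel) =
         complex_of_real (sqrt (2 * pi / \<alpha>) * gaussian (1 / \<alpha>) \<xi>)"
proof -
  have "complex_of_real (exp (- ((\<xi> / sqrt \<alpha>)^2) / 2)) = char std_normal_distribution (\<xi> / sqrt \<alpha>)"
    by (simp add: char_std_normal_distribution)
  also have "\<dots> = (\<integral>x. std_normal_density x *\<^sub>R exp (\<i> * complex_of_real (\<xi> / sqrt \<alpha> * x)) \<partial>lborel)"
    unfolding char_def by (subst integral_density) (auto simp: normal_density_nonneg)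
  also have "\<dots> = \<bar>sqrt \<alpha>\<bar> *\<^sub>R (\<integral>x. std_normal_density (0 + sqrt \<alpha> * x) *\<^sub>R exp (\<i> * complex_of_real (\<xi> / sqrt \<alpha> * (0 + sqrt \<alpha> * x))) \<partial>lborel)"
    using assms by (subst lborel_integral_real_affine[where c="sqrt \<alpha>" and t=0]) auto
  also have "(\<lambda>x. std_normal_density (0 + sqrt \<alpha> * x) *\<^sub>R exp (\<i> * complex_of_real (\<xi> / sqrt \<alpha> * (0 + sqrt \<alpha> * x)))) =
     (\<lambda>x. complex_of_real (1 / sqrt (2 * pi)) * (exp (\<i> * complex_of_real (x * \<xi>)) * complex_of_real (gaussian \<alpha> x)))"
    using assms by (auto simp: fun_eq_iff gaussian_def std_normal_density_def scaleR_conv_of_real power_mult_distrib power2_eq_square mult_ac)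
  also have "\<bar>sqrt \<alpha>\<bar> *\<^sub>R integral\<^sup>L lborel \<dots> = complex_of_real (sqrt \<alpha> / sqrt (2 * pi)) * (\<integral>x. exp (\<i> * complex_of_real (x * \<xi>)) * complex_of_real (gaussian \<alpha> x) \<partial>lborel)"
    using assms by (simp only: integral_mult_right_zero) (simp add: scaleR_conv_of_real)
  finally have *: "complex_of_real (exp (- ((\<xi> / sqrt \<alpha>)^2) / 2)) = complex_of_real (sqrt \<alpha> / sqrt (2 * pi)) * (\<integral>x. exp (\<i> * complex_of_real (x * \<xi>)) * complex_of_real (gaussian \<alpha> x) \<partial>lborel)" .
  have "complex_of_real (sqrt (2 * pi / \<alpha>) * gaussian (1 / \<alpha>) \<xi>) = complex_of_real (sqrt (2 * pi) / sqrt \<alpha>) * complex_of_real (exp (- ((\<xi> / sqrt \<alpha>)^2) / 2))"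
    using assms by (simp add: gaussian_def power_divide power2_eq_square real_sqrt_divide)
  also have "\<dots> = (\<integral>x. exp (\<i> * complex_of_real (x * \<xi>)) * complex_of_real (gaussian \<alpha> x) \<partial>lborel)"
    unfolding * using assms by (simp add: real_sqrt_mult)
  finally show ?thesis by simp
qed

lemma gaussian_eq_prod:
  "gaussian \<alpha> (x::'a::euclidean_space) = (\<Prod>b\<in>Basis. gaussian \<alpha> (x \<bullet> b))"
  unfolding gaussian_def by (subst euclidean_inner) (simp add: exp_sum[symmetric] sum_distrib_left sum_divide_distrib sum_negf[symmetric])

text \<open>Lebesgue measure on a Euclidean space is the image of a product of one-dimensional
  Lebesgue measures. This carries the Gaussian integrals from the line to every dimension.\<close>

lemma integrable_lborel_prod:
  fixes f :: "'a::euclidean_space \<Rightarrow> real \<Rightarrow> complex"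
  assumes "\<And>b. b \<in> Basis \<Longrightarrow> integrable lborel (f b)"
  shows "integrable lborel (\<lambda>x::'a. \<Prod>b\<in>Basis. f b (x \<bullet> b))"
    and "(\<integral>x. (\<Prod>b\<in>Basis. f b (x \<bullet> b)) \<partial>(lborel :: 'a measure)) = (\<Prod>b\<in>Basis. \<integral>x. f b x \<partial>lborel)"
proof -
  interpret product_sigma_finite "\<lambda>_::'a. lborel :: real measure"
    by standard
  have [measurable]: "f b \<in> borel_measurable borel" if "b \<in> Basis" for b
    using borel_measurable_integrable[OF assms[OF that]] by simp
  have eq: "(\<Prod>b\<in>Basis. f b ((\<Sum>b\<in>Basis. g b *\<^sub>R b) \<bullet> b)) = (\<Prod>b\<in>Basis. f b (g b))" for g
    by (intro prod.cong refl) (simp add: inner_sum_left inner_Basis if_distrib cong: if_cong)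
  show "integrable lborel (\<lambda>x::'a. \<Prod>b\<in>Basis. f b (x \<bullet> b))"
    by (subst lborel_eq, subst integrable_distr_eq)
      (auto simp: eq intro!: product_integrable_prod assms)
  show "(\<integral>x. (\<Prod>b\<in>Basis. f b (x \<bullet> b)) \<partial>(lborel :: 'a measure)) = (\<Prod>b\<in>Basis. \<integral>x. f b x \<partial>lborel)"
    by (subst lborel_eq, subst integral_distr)
      (auto simp: eq intro!: product_integral_prod assms)
qed

text \<open>The common test function. Its Fourier transform is a Gaussian centred at
  \<open>z\<close>, so pairing it with the transform of a distribution probes the distribution near
  \<open>z\<close> at scale \<open>sqrt \<alpha>\<close>.\<close>

definition gauss_wave :: "real \<Rightarrow> 'a::euclidean_space \<Rightarrow> 'a \<Rightarrow> complex" where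
  "gauss_wave \<alpha> z \<xi> = exp (\<i> * complex_of_real (z \<bullet> \<xi>)) * complex_of_real (gaussian \<alpha> \<xi>)"

lemma norm_gauss_wave [simp]: "norm (gauss_wave \<alpha> z \<xi>) = gaussian \<alpha> \<xi>"
  by (simp add: gauss_wave_def norm_mult)

lemma borel_measurable_gauss_wave [measurable]: "gauss_wave \<alpha> z \<in> borel_measurable borel"
  unfolding gauss_wave_def by measurable

lemma gauss_wave_eq_prod:
  "gauss_wave \<alpha> (z::'a::euclidean_space) x = (\<Prod>b\<in>Basis. gauss_wave \<alpha> (z \<bullet> b) (x \<bullet> b))"
  unfolding gauss_wave_def prod.distrib of_real_prod[symmetric] gaussian_eq_prod[symmetric]
  by (subst euclidean_inner) (simp add: exp_sum[symmetric] sum_distrib_left)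

lemma
  fixes z :: "'a::euclidean_space"
  assumes "\<alpha> > 0"
  shows integrable_gauss_wave: "integrable lborel (gauss_wave \<alpha> z)"
    and integral_gauss_wave: "(\<integral>x. gauss_wave \<alpha> z x \<partial>lborel) =
      complex_of_real (sqrt (2 * pi / \<alpha>) ^ DIM('a) * gaussian (1 / \<alpha>) z)"
proof -
  have int: "integrable lborel (gauss_wave \<alpha> y)" for y :: real
    using integrable_gaussian_real[OF assms] by (rule Bochner_Integration.integrable_bound) auto
  have I: "(\<integral>x. gauss_wave \<alpha> y x \<partial>lborel) = complex_of_real (sqrt (2 * pi / \<alpha>) * gaussian (1 / \<alpha>) y)" for y :: real
    using fourier_gaussian_real[OF assms, of y] by (simp add: gauss_wave_def mult.commute)
  show "integrable lborel (gauss_wave \<alpha> z)"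
    by (subst gauss_wave_eq_prod[abs_def]) (rule integrable_lborel_prod, rule int)
  show "(\<integral>x. gauss_wave \<alpha> z x \<partial>lborel) =
      complex_of_real (sqrt (2 * pi / \<alpha>) ^ DIM('a) * gaussian (1 / \<alpha>) z)"
    by (subst gauss_wave_eq_prod[abs_def], subst integrable_lborel_prod(2)[OF int])
      (simp add: I prod.distrib gaussian_eq_prod[of _ z])
qed

lemma integrable_gaussian:
  assumes "\<alpha> > 0"
  shows "integrable lborel (gaussian \<alpha> :: 'a::euclidean_space \<Rightarrow> real)"
  using integrable_norm[OF integrable_gauss_wave[OF assms, of "0::'a"]] by simp

lemma integral_gaussian:
  assumes "\<alpha> > 0"
  shows "(\<integral>x. gaussian \<alpha> x \<partial>(lborel :: 'a::euclidean_space measure)) = sqrt (2 * pi / \<alpha>) ^ DIM('a)"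
proof -
  have "complex_of_real (\<integral>x. gaussian \<alpha> x \<partial>(lborel :: 'a measure)) = (\<integral>x. gauss_wave \<alpha> (0::'a) x \<partial>lborel)"
    by (simp add: gauss_wave_def)
  also have "\<dots> = complex_of_real (sqrt (2 * pi / \<alpha>) ^ DIM('a))"
    unfolding integral_gauss_wave[OF assms] by (simp add: gaussian_def)
  finally show ?thesis by (simp only: of_real_eq_iff)
qed

text \<open>Multiplication by \<open>exp (- i y x)\<close> turns the wave with frequency
  \<open>z\<close> into the one with frequency \<open>z - x\<close>, so only the total integral of a
  wave is needed.\<close>

lemma fourier_gauss_wave:
  fixes z :: "'a::euclidean_space"
  assumes "\<alpha> > 0"
  shows "fourier (gauss_wave \<alpha> z) x = complex_of_real (sqrt (2 * pi / \<alpha>) ^ DIM('a) * gaussian (1 / \<alpha>) (x - z))"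
proof -
  have eq: "exp (- \<i> * complex_of_real (y \<bullet> x)) * gauss_wave \<alpha> z y = gauss_wave \<alpha> (z - x) y" for y
    unfolding gauss_wave_def mult.assoc[symmetric] mult_exp_exp
    by (simp add: inner_diff_left inner_commute algebra_simps)
  have "fourier (gauss_wave \<alpha> z) x = (\<integral>y. gauss_wave \<alpha> (z - x) y \<partial>lebesgue)"
    unfolding fourier_def eq ..
  also have "\<dots> = (\<integral>y. gauss_wave \<alpha> (z - x) y \<partial>lborel)"
    by (rule integral_completion) simp
  finally show ?thesis
    using integral_gauss_wave[OF assms, of "z - x"] by (simp add: gaussian_minus[of _ x z])
qed

text \<open>Complex polynomials, generated from constants and linear forms instead of given by
  coefficients: stability under directional derivatives and polynomial growth become inductions, and
  these two facts make Gaussian waves Schwartz functions.\<close>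

inductive_set cpoly :: "('a::euclidean_space \<Rightarrow> complex) set" where
  const: "(\<lambda>_. c) \<in> cpoly"
| inner: "(\<lambda>x. complex_of_real (x \<bullet> v)) \<in> cpoly"
| add: "p \<in> cpoly \<Longrightarrow> q \<in> cpoly \<Longrightarrow> (\<lambda>x. p x + q x) \<in> cpoly"
| mult: "p \<in> cpoly \<Longrightarrow> q \<in> cpoly \<Longrightarrow> (\<lambda>x. p x * q x) \<in> cpoly"

lemma cpoly_has_derivative:
  assumes "p \<in> cpoly"
  shows "\<exists>p'. (\<forall>x. (p has_derivative p' x) (at x)) \<and> (\<forall>v. (\<lambda>x. p' x v) \<in> cpoly)"
  using assms
proof induction
  case (const c)
  show ?case by (intro exI[of _ "\<lambda>x v. 0"]) (auto intro: cpoly.intros)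
next
  case (inner v)
  show ?case
    by (intro exI[of _ "\<lambda>x h. complex_of_real (h \<bullet> v)"]) (auto intro!: cpoly.intros derivative_eq_intros)
next
  case (add p q)
  then obtain p' q' where *: "\<And>x. (p has_derivative p' x) (at x)" "\<And>v. (\<lambda>x. p' x v) \<in> cpoly"
    "\<And>x. (q has_derivative q' x) (at x)" "\<And>v. (\<lambda>x. q' x v) \<in> cpoly" by blast
  show ?case
    by (intro exI[of _ "\<lambda>x h. p' x h + q' x h"]) (auto intro!: cpoly.intros has_derivative_add *)
next
  case (mult p q)
  then obtain p' q' where *: "\<And>x. (p has_derivative p' x) (at x)" "\<And>v. (\<lambda>x. p' x v) \<in> cpoly"
    "\<And>x. (q has_derivative q' x) (at x)" "\<And>v. (\<lambda>x. q' x v) \<in> cpoly" by blast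
  show ?case
    by (intro exI[of _ "\<lambda>x h. p x * q' x h + p' x h * q x"]) (auto intro!: cpoly.intros has_derivative_mult * mult.hyps)
qed

lemma cpoly_bound:
  assumes "p \<in> cpoly"
  shows "\<exists>C n. C \<ge> 0 \<and> (\<forall>x. norm (p x) \<le> C * (1 + norm x) ^ n)"
  using assms
proof induction
  case (const c)
  show ?case by (intro exI[of _ "norm c"] exI[of _ 0]) auto
next
  case (inner v)
  have "\<bar>x \<bullet> v\<bar> \<le> norm v * (1 + norm x) ^ 1" for x
    using Cauchy_Schwarz_ineq2[of x v] by (simp add: algebra_simps) (smt (verit) norm_ge_zero)
  then show ?case by (intro exI[of _ "norm v"] exI[of _ 1]) auto
next
  case (add p q)
  then obtain C D n m where *: "C \<ge> 0" "D \<ge> 0" "\<And>x. norm (p x) \<le> C * (1 + norm x) ^ n"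
    "\<And>x. norm (q x) \<le> D * (1 + norm x) ^ m" by blast
  have "norm (p x + q x) \<le> (C + D) * (1 + norm x) ^ (n + m)" for x
  proof -
    have "norm (p x + q x) \<le> C * (1 + norm x) ^ n + D * (1 + norm x) ^ m"
      using *(3)[of x] *(4)[of x] norm_triangle_ineq[of "p x" "q x"] by linarith
    also have "\<dots> \<le> C * (1 + norm x) ^ (n + m) + D * (1 + norm x) ^ (n + m)"
      using * by (intro add_mono mult_left_mono power_increasing) auto
    finally show ?thesis by (simp add: algebra_simps)
  qed
  then show ?case using * by (intro exI[of _ "C + D"] exI[of _ "n + m"]) auto
next
  case (mult p q)
  then obtain C D n m where *: "C \<ge> 0" "D \<ge> 0" "\<And>x. norm (p x) \<le> C * (1 + norm x) ^ n"
    "\<And>x. norm (q x) \<le> D * (1 + norm x) ^ m" by blast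
  have "norm (p x * q x) \<le> (C * D) * (1 + norm x) ^ (n + m)" for x
  proof -
    have "norm (p x * q x) \<le> (C * (1 + norm x) ^ n) * (D * (1 + norm x) ^ m)"
      unfolding norm_mult using * by (intro mult_mono) auto
    then show ?thesis by (simp add: power_add mult_ac)
  qed
  then show ?case using * by (intro exI[of _ "C * D"] exI[of _ "n + m"]) auto
qed

lemma gauss_wave_has_derivative:
  "(gauss_wave \<alpha> z has_derivative
    (\<lambda>h. (\<i> * complex_of_real (h \<bullet> z) + complex_of_real (- \<alpha>) * complex_of_real (x \<bullet> h)) * gauss_wave \<alpha> z x)) (at x)"
proof -
  have eq: "gauss_wave \<alpha> z = (\<lambda>\<xi>. exp (\<i> * complex_of_real (z \<bullet> \<xi>) + complex_of_real (- \<alpha> * (\<xi> \<bullet> \<xi>) / 2)))"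
    by (intro ext) (simp only: gauss_wave_def gaussian_def exp_add exp_of_real)
  show ?thesis
    unfolding eq
  proof -
    have "((\<lambda>\<xi>. - \<alpha> * (\<xi> \<bullet> \<xi>) / 2) has_derivative (\<lambda>h. - \<alpha> * (x \<bullet> h))) (at x)"
      by (auto intro!: derivative_eq_intros simp: inner_commute)
    from has_derivative_of_real[OF this, where 'a=complex]
    have *: "((\<lambda>\<xi>. complex_of_real (- \<alpha> * (\<xi> \<bullet> \<xi>) / 2)) has_derivative
        (\<lambda>h. complex_of_real (- \<alpha>) * complex_of_real (x \<bullet> h))) (at x)"
      by simp
    have "((\<lambda>\<xi>. \<i> * complex_of_real (z \<bullet> \<xi>) + complex_of_real (- \<alpha> * (\<xi> \<bullet> \<xi>) / 2)) has_derivative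
        (\<lambda>h. \<i> * complex_of_real (h \<bullet> z) + complex_of_real (- \<alpha>) * complex_of_real (x \<bullet> h))) (at x)"
      by (rule has_derivative_add[OF _ *]) (auto intro!: derivative_eq_intros simp: inner_commute)
    from has_derivative_compose[OF this DERIV_exp[unfolded has_field_derivative_def]] show "((\<lambda>\<xi>. exp (\<i> * complex_of_real (z \<bullet> \<xi>) + complex_of_real (- \<alpha> * (\<xi> \<bullet> \<xi>) / 2))) has_derivative
       (\<lambda>h. (\<i> * complex_of_real (h \<bullet> z) + complex_of_real (- \<alpha>) * complex_of_real (x \<bullet> h)) *
         exp (\<i> * complex_of_real (z \<bullet> x) + complex_of_real (- \<alpha> * (x \<bullet> x) / 2)))) (at x)"
      by (simp only: mult.commute[of "exp _"])
  qed
qed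

text \<open>A derivative of the wave is a linear polynomial times the same wave, so the product rule
  changes the polynomial factor only.\<close>

lemma iter_deriv_cpoly_gauss_wave:
  assumes "p \<in> cpoly"
  shows "\<exists>q\<in>cpoly. iter_deriv vs (\<lambda>x. p x * gauss_wave \<alpha> z x) = (\<lambda>x. q x * gauss_wave \<alpha> z x)"
proof (induction vs)
  case Nil
  then show ?case using assms by auto
next
  case (Cons v vs)
  then obtain q where q: "q \<in> cpoly" "iter_deriv vs (\<lambda>x. p x * gauss_wave \<alpha> z x) = (\<lambda>x. q x * gauss_wave \<alpha> z x)"
    by blast
  obtain q' where q': "\<And>x. (q has_derivative q' x) (at x)" "\<And>v. (\<lambda>x. q' x v) \<in> cpoly"
    using cpoly_has_derivative[OF q(1)] by blast
  have "(\<lambda>x. frechet_derivative (\<lambda>x. q x * gauss_wave \<alpha> z x) (at x) v) =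
    (\<lambda>x. (q x * (\<i> * complex_of_real (v \<bullet> z) + complex_of_real (- \<alpha>) * complex_of_real (x \<bullet> v)) + q' x v) * gauss_wave \<alpha> z x)"
    using frechet_derivative_at[OF has_derivative_mult[OF q'(1) gauss_wave_has_derivative[of \<alpha> z]], symmetric]
    by (simp add: algebra_simps)
  moreover have "(\<lambda>x. q x * (\<i> * complex_of_real (v \<bullet> z) + complex_of_real (- \<alpha>) * complex_of_real (x \<bullet> v)) + q' x v) \<in> cpoly"
    by (intro cpoly.intros q q')
  ultimately show ?case unfolding iter_deriv.simps q(2) by (intro bexI)
qed

lemma power_times_gaussian_bounded:
  assumes "\<alpha> > 0"
  shows "\<exists>C. \<forall>x::'a::euclidean_space. (1 + norm x) ^ N * gaussian \<alpha> x \<le> C"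
proof -
  have "((\<lambda>y::real. (1 + y) ^ N * exp (- \<alpha> * (y * y) / 2)) \<longlongrightarrow> 0) at_top"
  proof -
    have "((\<lambda>y::real. y ^ N / exp y) \<longlongrightarrow> 0) at_top" by (rule tendsto_power_div_exp_0)
    then have "((\<lambda>y::real. (1+y) ^ N / exp (1+y)) \<longlongrightarrow> 0) at_top"
      by (rule filterlim_compose) (rule filterlim_tendsto_add_at_top[OF tendsto_const filterlim_ident])
    then have "((\<lambda>y::real. (exp (1 + 1 / \<alpha>)) * ((1+y) ^ N / exp (1+y))) \<longlongrightarrow> (exp (1 + 1/\<alpha>)) * 0) at_top"
      by (intro tendsto_mult tendsto_const)
    then have *: "((\<lambda>y::real. (exp (1 + 1 / \<alpha>)) * ((1+y) ^ N / exp (1+y))) \<longlongrightarrow> 0) at_top" by simp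
    show ?thesis
    proof (rule tendsto_sandwich[OF _ _ tendsto_const *])
      show "\<forall>\<^sub>F y in at_top. 0 \<le> (1 + y) ^ N * exp (- \<alpha> * (y * y) / 2)"
        using eventually_ge_at_top[of 0] by eventually_elim auto
      show "\<forall>\<^sub>F y in at_top. (1 + y) ^ N * exp (- \<alpha> * (y * y) / 2) \<le> (exp (1 + 1 / \<alpha>)) * ((1+y) ^ N / exp (1+y))"
        using eventually_ge_at_top[of 0]
      proof eventually_elim
        case (elim y)
        \<comment> \<open>Completing the square gives
          \<open>- \<alpha> y^2 / 2 \<le> 1 / \<alpha> - y\<close>, which compares the Gaussian with
          \<open>exp (- (1 + y))\<close>, up to the factor
          \<open>exp (1 + 1 / \<alpha>)\<close>.\<close>
        have "0 \<le> (sqrt \<alpha> * y - 1 / sqrt \<alpha>)\<^sup>2" by simp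
        also have "\<dots> = \<alpha> * (y * y) - 2 * y + 1 / \<alpha>"
          using assms by (simp add: power2_diff power_mult_distrib power_divide) (simp add: power2_eq_square)
        finally have "- \<alpha> * (y * y) / 2 \<le> 1 / \<alpha> - y"
          using assms by (simp add: field_simps)
        then have "exp (- \<alpha> * (y * y) / 2) \<le> exp (1 / \<alpha> - y)" by simp
        then have "(1 + y) ^ N * exp (- \<alpha> * (y * y) / 2) \<le> (1 + y) ^ N * exp (1 / \<alpha> - y)"
          using elim by (intro mult_left_mono) auto
        also have "\<dots> = exp (1 + 1 / \<alpha>) * ((1+y) ^ N / exp (1+y))"
          by (simp add: exp_add exp_diff)
        finally show ?case .
      qed
    qed
  qed
  then have "\<forall>\<^sub>F y in at_top. (1 + y) ^ N * exp (- \<alpha> * (y * y) / 2) < (1::real)"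
    by (rule order_tendstoD) simp
  then obtain M where M: "\<And>y. y \<ge> M \<Longrightarrow> (1 + y) ^ N * exp (- \<alpha> * (y * y) / 2) < (1::real)"
    by (auto simp: eventually_at_top_linorder)
  have "(1 + norm x) ^ N * gaussian \<alpha> x \<le> max 1 ((1 + \<bar>M\<bar>) ^ N)" for x :: 'a
  proof (cases "norm x \<ge> M")
    case True
    then show ?thesis using M[of "norm x"]
      unfolding gaussian_def dot_square_norm power2_eq_square by linarith
  next
    case False
    then have "(1 + norm x) ^ N * gaussian \<alpha> x \<le> (1 + \<bar>M\<bar>) ^ N * 1"
      using assms by (intro mult_mono power_mono gaussian_le_1) auto
    then show ?thesis by simp
  qed
  then show ?thesis by blast
qed

lemma schwartz_gauss_wave:
  assumes "\<alpha> > 0"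
  shows "schwartz (gauss_wave \<alpha> (z::'a::euclidean_space))"
proof -
  have *: "\<exists>q\<in>cpoly. iter_deriv vs (gauss_wave \<alpha> z) = (\<lambda>x. q x * gauss_wave \<alpha> z x)" for vs
    using iter_deriv_cpoly_gauss_wave[OF cpoly.const[of 1], of vs \<alpha> z] by simp
  show ?thesis
    unfolding schwartz_def smooth_on_def
  proof (intro conjI allI impI ballI)
    fix vs :: "'a list" and x :: 'a
    obtain q where q: "q \<in> cpoly" "iter_deriv vs (gauss_wave \<alpha> z) = (\<lambda>x. q x * gauss_wave \<alpha> z x)"
      using * by blast
    show "iter_deriv vs (gauss_wave \<alpha> z) differentiable at x"
      unfolding q(2) using cpoly_has_derivative[OF q(1)] gauss_wave_has_derivative[of \<alpha> z x]
      by (intro differentiable_mult) (auto simp: differentiable_def)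
  next
    fix N and vs :: "'a list"
    obtain q where q: "q \<in> cpoly" "iter_deriv vs (gauss_wave \<alpha> z) = (\<lambda>x. q x * gauss_wave \<alpha> z x)"
      using * by blast
    obtain C n where C: "C \<ge> 0" "\<And>x. norm (q x) \<le> C * (1 + norm x) ^ n"
      using cpoly_bound[OF q(1)] by blast
    obtain D where D: "\<And>x::'a. (1 + norm x) ^ (N + n) * gaussian \<alpha> x \<le> D"
      using power_times_gaussian_bounded[OF assms] by blast
    have "(1 + norm x) ^ N * norm (iter_deriv vs (gauss_wave \<alpha> z) x) \<le> C * D" for x
    proof -
      have "(1 + norm x) ^ N * norm (iter_deriv vs (gauss_wave \<alpha> z) x) = (1 + norm x) ^ N * (norm (q x) * gaussian \<alpha> x)"
        by (simp add: q(2) norm_mult)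
      also have "\<dots> \<le> (1 + norm x) ^ N * ((C * (1 + norm x) ^ n) * gaussian \<alpha> x)"
        using C by (intro mult_left_mono mult_right_mono) auto
      also have "\<dots> = C * ((1 + norm x) ^ (N + n) * gaussian \<alpha> x)"
        by (simp add: power_add mult_ac)
      also have "\<dots> \<le> C * D" using C D by (intro mult_left_mono) auto
      finally show ?thesis .
    qed
    then show "\<exists>C. \<forall>x. (1 + norm x) ^ N * norm (iter_deriv vs (gauss_wave \<alpha> z) x) \<le> C" by blast
  qed
qed

section \<open>An \<open>L\<^sup>2\<close> bound for Fourier integrals\<close>

lemma integrable_pair_mult:
  fixes g :: "'a::euclidean_space \<Rightarrow> real" and h :: "'b::euclidean_space \<Rightarrow> real"
  assumes "integrable lborel g" "integrable lborel h"
  shows "integrable (lborel \<Otimes>\<^sub>M lborel) (\<lambda>(x, y). g x * h y)"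
proof -
  have [measurable]: "g \<in> borel_measurable borel" "h \<in> borel_measurable borel"
    using assms by (auto dest: borel_measurable_integrable)
  show ?thesis
  proof (rule lborel_pair.Fubini_integrable)
    show "(\<lambda>(x, y). g x * h y) \<in> borel_measurable (lborel \<Otimes>\<^sub>M lborel)" by measurable
    show "integrable lborel (\<lambda>x. \<integral>y. norm (case (x, y) of (x, y) \<Rightarrow> g x * h y) \<partial>lborel)"
      using assms by (simp add: abs_mult)
    show "AE x in lborel. integrable lborel (\<lambda>y. case (x, y) of (x, y) \<Rightarrow> g x * h y)"
      using assms by simp
  qed
qed

lemma integrable_pair_bound:
  fixes F :: "'a::euclidean_space \<Rightarrow> 'b::euclidean_space \<Rightarrow> 'c::{banach,second_countable_topology}"
  assumes "case_prod F \<in> borel_measurable (lborel \<Otimes>\<^sub>M lborel)"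
    and "integrable lborel g" "integrable lborel h"
    and bound: "\<And>x y. norm (F x y) \<le> g x * h y"
  shows "integrable (lborel \<Otimes>\<^sub>M lborel) (case_prod F)"
  using integrable_pair_mult[OF assms(2,3)] assms(1)
  by (rule Bochner_Integration.integrable_bound) (auto intro!: AE_I2 order_trans[OF bound])

text \<open>Each exchange of Bochner integrals below has an integrand dominated by a product of one
  integrable function per variable; the integrability check is made here once.\<close>

lemma Fubini_bound:
  fixes F :: "'a::euclidean_space \<Rightarrow> 'b::euclidean_space \<Rightarrow> 'c::{banach,second_countable_topology}"
  assumes "case_prod F \<in> borel_measurable (lborel \<Otimes>\<^sub>M lborel)"
    and "integrable lborel g" "integrable lborel h"
    and "\<And>x y. norm (F x y) \<le> g x * h y"
  shows "(\<integral>x. \<integral>y. F x y \<partial>lborel \<partial>lborel) = (\<integral>y. \<integral>x. F x y \<partial>lborel \<partial>lborel)"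
proof -
  show ?thesis
    using lborel_pair.Fubini_integral[of F] integrable_pair_bound[OF assms] by simp
qed

lemma nn_integral_lborel_shift:
  fixes f :: "'a::euclidean_space \<Rightarrow> ennreal"
  assumes [measurable]: "f \<in> borel_measurable borel"
  shows "(\<integral>\<^sup>+x. f (x + c) \<partial>lborel) = (\<integral>\<^sup>+x. f x \<partial>lborel)"
    and "(\<integral>\<^sup>+x. f (c - x) \<partial>lborel) = (\<integral>\<^sup>+x. f x \<partial>lborel)"
proof -
  show "(\<integral>\<^sup>+x. f (x + c) \<partial>lborel) = (\<integral>\<^sup>+x. f x \<partial>lborel)"
    by (subst (2) lborel_distr_plus[of c, symmetric]) (simp add: nn_integral_distr add.commute)
  show "(\<integral>\<^sup>+x. f (c - x) \<partial>lborel) = (\<integral>\<^sup>+x. f x \<partial>lborel)"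
    by (subst (2) lborel_affine[of "-1" c]) (simp_all add: nn_integral_density nn_integral_distr)
qed

text \<open>Integrability is not assumed: a function that is not integrable has Bochner integral
  0.\<close>

lemma norm_integral_le_nn_integral:
  fixes f :: "'a \<Rightarrow> 'b::{banach,second_countable_topology}"
  shows "ennreal (norm (\<integral>x. f x \<partial>M)) \<le> (\<integral>\<^sup>+x. ennreal (norm (f x)) \<partial>M)"
  by (cases "integrable M f") (auto simp: integral_norm_bound_ennreal not_integrable_integral_eq)

lemma borel_measurable_cnj [measurable]: "cnj \<in> borel_measurable borel"
  by (intro borel_measurable_continuous_onI continuous_intros)

text \<open>Expand the square and integrate out the Gaussian first: the resulting kernel is a Gaussian in
  \<open>\<xi> - \<zeta>\<close>, and \<open>2\<bar>f \<xi>\<bar>\<bar>f \<zeta>\<bar> \<le> \<bar>f \<xi>\<bar>\<^sup>2 + \<bar>f \<zeta>\<bar>\<^sup>2\<close>.\<close>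

lemma fourier_L2_bound_gaussian:
  fixes f :: "'b::euclidean_space \<Rightarrow> complex" and L :: "'a::euclidean_space \<Rightarrow> 'b" and M :: "'b \<Rightarrow> 'a"
  assumes adj: "\<And>z \<xi>. L z \<bullet> \<xi> = M \<xi> \<bullet> z" and M: "\<And>\<xi> \<zeta>. M (\<xi> - \<zeta>) = M \<xi> - M \<zeta>"
    "\<And>\<xi>. norm (M \<xi>) = norm \<xi>"
    and dim: "DIM('a) = DIM('b)"
    and L [measurable]: "L \<in> borel_measurable borel"
    and f: "integrable lborel f" and f2: "integrable lborel (\<lambda>\<xi>. (norm (f \<xi>))\<^sup>2)"
    and "\<alpha> > 0"
  defines "\<Phi> \<equiv> \<lambda>z. \<integral>\<xi>. exp (\<i> * complex_of_real (L z \<bullet> \<xi>)) * f \<xi> \<partial>lborel"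
  shows "(\<integral>\<^sup>+z. ennreal (gaussian \<alpha> z * (norm (\<Phi> z))\<^sup>2) \<partial>lborel)
    \<le> ennreal ((2 * pi) ^ DIM('b) * (\<integral>\<xi>. (norm (f \<xi>))\<^sup>2 \<partial>lborel))"
proof -
  note [measurable] = borel_measurable_integrable[OF f]
  define \<Gamma> :: "'b \<Rightarrow> real" where "\<Gamma> v = sqrt (2 * pi / \<alpha>) ^ DIM('b) * gaussian (1 / \<alpha>) v" for v
  have [measurable]: "\<Gamma> \<in> borel_measurable borel" unfolding \<Gamma>_def by measurable
  have \<Gamma>_nonneg: "\<Gamma> v \<ge> 0" for v using \<open>\<alpha> > 0\<close> by (simp add: \<Gamma>_def)
  have [measurable]: "\<Phi> \<in> borel_measurable borel"
    unfolding \<Phi>_def by measurable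
  \<comment> \<open>A crude uniform bound for \<open>\<Phi>\<close>. It justifies the exchanges of
    integrals and the integrability of the weighted square; the final estimate does not contain
    it.\<close>
  define K where "K = (\<integral>\<xi>. norm (f \<xi>) \<partial>lborel)"
  have \<Phi>_le: "norm (\<Phi> z) \<le> K" for z
    unfolding \<Phi>_def K_def by (rule order_trans[OF integral_norm_bound]) (simp add: norm_mult)
  have "K \<ge> 0" using \<Phi>_le[of 0] norm_ge_zero order_trans by blast
  define e where "e z \<xi> = exp (\<i> * complex_of_real (L z \<bullet> \<xi>))" for z \<xi>
  have [measurable]: "case_prod e \<in> borel_measurable (borel \<Otimes>\<^sub>M borel)"
    unfolding e_def by measurable
  have [measurable]: "case_prod e \<in> borel_measurable (lborel \<Otimes>\<^sub>M lborel)"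
    unfolding e_def by measurable
  have norm_e [simp]: "norm (e z \<xi>) = 1" for z \<xi> by (simp add: e_def)
  \<comment> \<open>Two opposite plane waves combine to one wave of frequency
    \<open>M (\<xi> - \<zeta>)\<close>. As \<open>M\<close> preserves norms and the dimensions
    agree, the integral over \<open>z\<close> depends on \<open>\<xi> - \<zeta>\<close>
    alone.\<close>
  have gauss_int: "(\<integral>z. complex_of_real (gaussian \<alpha> z) * e z \<xi> * cnj (e z \<zeta>) \<partial>lborel) = complex_of_real (\<Gamma> (\<xi> - \<zeta>))" for \<xi> \<zeta>
  proof -
    have "complex_of_real (gaussian \<alpha> z) * e z \<xi> * cnj (e z \<zeta>) = gauss_wave \<alpha> (M (\<xi> - \<zeta>)) z" for z
      by (simp add: e_def gauss_wave_def exp_cnj adj M inner_diff_left algebra_simps exp_diff exp_minus divide_inverse)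
    then show ?thesis
      using integral_gauss_wave[OF \<open>\<alpha> > 0\<close>, of "M (\<xi> - \<zeta>)"] M(2)[of "\<xi> - \<zeta>"]
      by (simp add: \<Gamma>_def dim gaussian_def dot_square_norm)
  qed
  have inner: "(\<integral>z. complex_of_real (gaussian \<alpha> z) * \<Phi> z * cnj (e z \<zeta>) \<partial>lborel) = (\<integral>\<xi>. f \<xi> * complex_of_real (\<Gamma> (\<xi> - \<zeta>)) \<partial>lborel)" for \<zeta>
  proof -
    have "(\<integral>z. complex_of_real (gaussian \<alpha> z) * \<Phi> z * cnj (e z \<zeta>) \<partial>lborel)
      = (\<integral>z. (\<integral>\<xi>. f \<xi> * (complex_of_real (gaussian \<alpha> z) * e z \<xi> * cnj (e z \<zeta>)) \<partial>lborel) \<partial>lborel)"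
      unfolding \<Phi>_def e_def[symmetric] 
      by (simp only: integral_mult_left_zero[symmetric] integral_mult_right_zero[symmetric] mult_ac)
    also have "\<dots> = (\<integral>\<xi>. (\<integral>z. f \<xi> * (complex_of_real (gaussian \<alpha> z) * e z \<xi> * cnj (e z \<zeta>)) \<partial>lborel) \<partial>lborel)"
      by (rule Fubini_bound[where g="gaussian \<alpha>" and h="\<lambda>\<xi>. norm (f \<xi>)"])
        (use f integrable_gaussian[OF \<open>\<alpha> > 0\<close>] in \<open>auto simp: norm_mult e_def\<close>)
    finally show ?thesis by (simp add: gauss_int)
  qed
  have "complex_of_real (\<integral>z. gaussian \<alpha> z * (norm (\<Phi> z))\<^sup>2 \<partial>lborel) =
     (\<integral>z. complex_of_real (gaussian \<alpha> z) * \<Phi> z * cnj (\<Phi> z) \<partial>lborel)"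
    by (simp only: integral_complex_of_real[symmetric] of_real_mult complex_norm_square mult.assoc)
  also have "\<dots> = (\<integral>z. (\<integral>\<zeta>. cnj (f \<zeta>) * (complex_of_real (gaussian \<alpha> z) * \<Phi> z * cnj (e z \<zeta>)) \<partial>lborel) \<partial>lborel)"
    by (subst (2) \<Phi>_def)
      (simp only: Bochner_Integration.integral_cnj[symmetric] e_def[symmetric] complex_cnj_mult integral_mult_left_zero[symmetric] integral_mult_right_zero[symmetric] mult_ac)
  also have "\<dots> = (\<integral>\<zeta>. (\<integral>z. cnj (f \<zeta>) * (complex_of_real (gaussian \<alpha> z) * \<Phi> z * cnj (e z \<zeta>)) \<partial>lborel) \<partial>lborel)"
  proof (rule Fubini_bound[where g="\<lambda>z. K * gaussian \<alpha> z" and h="\<lambda>\<xi>. norm (f \<xi>)"])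
    show "norm (cnj (f y) * (complex_of_real (gaussian \<alpha> x) * \<Phi> x * cnj (e x y))) \<le> K * gaussian \<alpha> x * norm (f y)" for x y
      using mult_right_mono[OF \<Phi>_le[of x], of "gaussian \<alpha> x * norm (f y)"] by (simp add: norm_mult mult_ac)
  qed (use f integrable_gaussian[OF \<open>\<alpha> > 0\<close>] in \<open>auto simp: e_def\<close>)
  also have "\<dots> = (\<integral>\<zeta>. cnj (f \<zeta>) * (\<integral>\<xi>. f \<xi> * complex_of_real (\<Gamma> (\<xi> - \<zeta>)) \<partial>lborel) \<partial>lborel)"
    by (simp add: inner)
  finally have eq: "complex_of_real (\<integral>z. gaussian \<alpha> z * (norm (\<Phi> z))\<^sup>2 \<partial>lborel) = \<dots>" .
  \<comment> \<open>The two square roots multiply to \<open>2 * pi\<close>, so the mass of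
    \<open>\<Gamma>\<close> is independent of \<open>\<alpha>\<close>. This allows
    \<open>\<alpha>\<close> to tend to 0 afterwards.\<close>
  have int\<Gamma>: "(\<integral>\<^sup>+v. ennreal (\<Gamma> v) \<partial>lborel) = ennreal ((2 * pi) ^ DIM('b))"
  proof -
    have "integrable lborel \<Gamma>" unfolding \<Gamma>_def using \<open>\<alpha> > 0\<close> by (intro integrable_mult_right integrable_gaussian) auto
    then have "(\<integral>\<^sup>+v. ennreal (\<Gamma> v) \<partial>lborel) = ennreal (\<integral>v. \<Gamma> v \<partial>lborel)"
      by (intro nn_integral_eq_integral) (auto simp: \<Gamma>_nonneg)
    also have "(\<integral>v. \<Gamma> v \<partial>lborel) = (sqrt (2 * pi / \<alpha>) * sqrt (2 * pi / (1 / \<alpha>))) ^ DIM('b)"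
      unfolding \<Gamma>_def using \<open>\<alpha> > 0\<close> by (simp add: integral_gaussian power_mult_distrib)
    also have "sqrt (2 * pi / \<alpha>) * sqrt (2 * pi / (1 / \<alpha>)) = 2 * pi"
    proof -
      have "2 * pi / \<alpha> * (2 * pi / (1 / \<alpha>)) = (2 * pi)\<^sup>2"
        using \<open>\<alpha> > 0\<close> by (simp add: power2_eq_square)
      then show ?thesis by (simp only: real_sqrt_mult[symmetric] real_sqrt_abs) simp
    qed
    finally show ?thesis .
  qed
  have int: "integrable lborel (\<lambda>z. gaussian \<alpha> z * (norm (\<Phi> z))\<^sup>2)"
  proof (rule Bochner_Integration.integrable_bound)
    show "integrable lborel (\<lambda>z::'a. K\<^sup>2 * gaussian \<alpha> z)"
      by (intro integrable_mult_right integrable_gaussian \<open>\<alpha> > 0\<close>)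
    show "AE z in lborel. norm (gaussian \<alpha> z * (norm (\<Phi> z))\<^sup>2) \<le> norm (K\<^sup>2 * gaussian \<alpha> z)"
      by (intro AE_I2) (simp add: mult.commute mult_left_mono power_mono \<Phi>_le \<open>K \<ge> 0\<close>)
  qed simp
  have "(\<integral>\<^sup>+z. ennreal (gaussian \<alpha> z * (norm (\<Phi> z))\<^sup>2) \<partial>lborel) = ennreal (\<integral>z. gaussian \<alpha> z * (norm (\<Phi> z))\<^sup>2 \<partial>lborel)"
    using int by (intro nn_integral_eq_integral) auto
  also have "(\<integral>z. gaussian \<alpha> z * (norm (\<Phi> z))\<^sup>2 \<partial>lborel) = norm (complex_of_real (\<integral>z. gaussian \<alpha> z * (norm (\<Phi> z))\<^sup>2 \<partial>lborel))"
    by (simp only: norm_of_real) (simp add: integral_nonneg_AE)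
  also have "ennreal (norm (complex_of_real (\<integral>z. gaussian \<alpha> z * (norm (\<Phi> z))\<^sup>2 \<partial>lborel))) \<le> (\<integral>\<^sup>+\<zeta>. ennreal (norm (cnj (f \<zeta>) * (\<integral>\<xi>. f \<xi> * complex_of_real (\<Gamma> (\<xi> - \<zeta>)) \<partial>lborel))) \<partial>lborel)"
    unfolding eq by (rule norm_integral_le_nn_integral)
  also have "\<dots> \<le> (\<integral>\<^sup>+\<zeta>. ennreal (norm (f \<zeta>)) * (\<integral>\<^sup>+\<xi>. ennreal (norm (f \<xi>) * \<Gamma> (\<xi> - \<zeta>)) \<partial>lborel) \<partial>lborel)"
  proof (rule nn_integral_mono)
    fix \<zeta> :: 'b
    have "ennreal (norm (\<integral>\<xi>. f \<xi> * complex_of_real (\<Gamma> (\<xi> - \<zeta>)) \<partial>lborel)) \<le> (\<integral>\<^sup>+\<xi>. ennreal (norm (f \<xi> * complex_of_real (\<Gamma> (\<xi> - \<zeta>)))) \<partial>lborel)"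
      by (rule norm_integral_le_nn_integral)
    then show "ennreal (norm (cnj (f \<zeta>) * (\<integral>\<xi>. f \<xi> * complex_of_real (\<Gamma> (\<xi> - \<zeta>)) \<partial>lborel))) \<le> ennreal (norm (f \<zeta>)) * (\<integral>\<^sup>+\<xi>. ennreal (norm (f \<xi>) * \<Gamma> (\<xi> - \<zeta>)) \<partial>lborel)"
      by (simp add: norm_mult ennreal_mult \<Gamma>_nonneg mult_left_mono)
  qed
  also have "\<dots> = (\<integral>\<^sup>+\<zeta>. (\<integral>\<^sup>+\<xi>. ennreal (norm (f \<zeta>) * norm (f \<xi>) * \<Gamma> (\<xi> - \<zeta>)) \<partial>lborel) \<partial>lborel)"
    by (subst nn_integral_cmult[symmetric]) (auto simp: ennreal_mult \<Gamma>_nonneg mult_ac)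
  also have "\<dots> \<le> (\<integral>\<^sup>+\<zeta>. (\<integral>\<^sup>+\<xi>. ennreal ((norm (f \<zeta>))\<^sup>2 / 2) * ennreal (\<Gamma> (\<xi> - \<zeta>)) + ennreal ((norm (f \<xi>))\<^sup>2 / 2) * ennreal (\<Gamma> (\<xi> - \<zeta>)) \<partial>lborel) \<partial>lborel)"
  proof (intro nn_integral_mono)
    fix \<xi> \<zeta>
    have "norm (f \<zeta>) * norm (f \<xi>) \<le> (norm (f \<zeta>))\<^sup>2 / 2 + (norm (f \<xi>))\<^sup>2 / 2"
      using sum_squares_bound[of "norm (f \<zeta>)" "norm (f \<xi>)"] by simp
    then have "norm (f \<zeta>) * norm (f \<xi>) * \<Gamma> (\<xi> - \<zeta>) \<le> ((norm (f \<zeta>))\<^sup>2 / 2 + (norm (f \<xi>))\<^sup>2 / 2) * \<Gamma> (\<xi> - \<zeta>)"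
      by (rule mult_right_mono) (rule \<Gamma>_nonneg)
    then show "ennreal (norm (f \<zeta>) * norm (f \<xi>) * \<Gamma> (\<xi> - \<zeta>)) \<le> ennreal ((norm (f \<zeta>))\<^sup>2 / 2) * ennreal (\<Gamma> (\<xi> - \<zeta>)) + ennreal ((norm (f \<xi>))\<^sup>2 / 2) * ennreal (\<Gamma> (\<xi> - \<zeta>))"
      by (subst (asm) ennreal_le_iff[symmetric])
        (auto simp: \<Gamma>_nonneg ennreal_mult'[symmetric] ennreal_plus[symmetric] distrib_right simp del: ennreal_plus ennreal_le_iff)
  qed
  also have "\<dots> = (\<integral>\<^sup>+\<zeta>. (\<integral>\<^sup>+\<xi>. ennreal ((norm (f \<zeta>))\<^sup>2 / 2) * ennreal (\<Gamma> (\<xi> - \<zeta>)) \<partial>lborel) \<partial>lborel)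
     + (\<integral>\<^sup>+\<zeta>. (\<integral>\<^sup>+\<xi>. ennreal ((norm (f \<xi>))\<^sup>2 / 2) * ennreal (\<Gamma> (\<xi> - \<zeta>)) \<partial>lborel) \<partial>lborel)"
    by (simp add: nn_integral_add)
  also have "(\<integral>\<^sup>+\<zeta>. (\<integral>\<^sup>+\<xi>. ennreal ((norm (f \<xi>))\<^sup>2 / 2) * ennreal (\<Gamma> (\<xi> - \<zeta>)) \<partial>lborel) \<partial>lborel)
    = (\<integral>\<^sup>+\<xi>. (\<integral>\<^sup>+\<zeta>. ennreal ((norm (f \<xi>))\<^sup>2 / 2) * ennreal (\<Gamma> (\<xi> - \<zeta>)) \<partial>lborel) \<partial>lborel)"
    by (rule lborel_pair.Fubini') measurable
  also have "\<dots> = (\<integral>\<^sup>+\<xi>. ennreal ((norm (f \<xi>))\<^sup>2 / 2) * ennreal ((2 * pi) ^ DIM('b)) \<partial>lborel)"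
    by (simp add: nn_integral_cmult nn_integral_lborel_shift(2)[of "\<lambda>v. ennreal (\<Gamma> v)"] int\<Gamma>)
  also have "(\<integral>\<^sup>+\<zeta>. (\<integral>\<^sup>+\<xi>. ennreal ((norm (f \<zeta>))\<^sup>2 / 2) * ennreal (\<Gamma> (\<xi> - \<zeta>)) \<partial>lborel) \<partial>lborel)
    = (\<integral>\<^sup>+\<xi>. ennreal ((norm (f \<xi>))\<^sup>2 / 2) * ennreal ((2 * pi) ^ DIM('b)) \<partial>lborel)"
    using nn_integral_lborel_shift(1)[of "\<lambda>v. ennreal (\<Gamma> v)" "- \<zeta>" for \<zeta>]
    by (simp add: nn_integral_cmult int\<Gamma>)
  also have "(\<integral>\<^sup>+\<xi>. ennreal ((norm (f \<xi>))\<^sup>2 / 2) * ennreal ((2 * pi) ^ DIM('b)) \<partial>lborel) = ennreal (\<integral>\<xi>. (norm (f \<xi>))\<^sup>2 / 2 \<partial>lborel) * ennreal ((2 * pi) ^ DIM('b))"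
    using f2 by (subst nn_integral_multc) (auto simp: nn_integral_eq_integral)
  also have "\<dots> + \<dots> = ennreal ((2 * pi) ^ DIM('b) * (\<integral>\<xi>. (norm (f \<xi>))\<^sup>2 \<partial>lborel))"
    by (simp add: ennreal_mult'[symmetric] ennreal_plus[symmetric] del: ennreal_plus)
  finally show ?thesis .
qed

text \<open>The inequality half of Plancherel. The bound with Gaussian weight does not depend on
  \<open>\<alpha>\<close>, so Fatou's lemma removes the weight. The pair \<open>L\<close>,
  \<open>M\<close> permits both the plain transform with a sign change and the plane in rotated
  coordinates, given as pairs of reals.\<close>

lemma fourier_L2_bound:
  fixes f :: "'b::euclidean_space \<Rightarrow> complex" and L :: "'a::euclidean_space \<Rightarrow> 'b" and M :: "'b \<Rightarrow> 'a"
  assumes "\<And>z \<xi>. L z \<bullet> \<xi> = M \<xi> \<bullet> z" and "\<And>\<xi> \<zeta>. M (\<xi> - \<zeta>) = M \<xi> - M \<zeta>"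
    "\<And>\<xi>. norm (M \<xi>) = norm \<xi>"
    and "DIM('a) = DIM('b)"
    and [measurable]: "L \<in> borel_measurable borel"
    and "integrable lborel f" and "integrable lborel (\<lambda>\<xi>. (norm (f \<xi>))\<^sup>2)"
  shows "(\<integral>\<^sup>+z. ennreal ((norm (\<integral>\<xi>. exp (\<i> * complex_of_real (L z \<bullet> \<xi>)) * f \<xi> \<partial>lborel))\<^sup>2) \<partial>lborel)
    \<le> ennreal ((2 * pi) ^ DIM('b) * (\<integral>\<xi>. (norm (f \<xi>))\<^sup>2 \<partial>lborel))"
proof -
  define \<Phi> where "\<Phi> z = (\<integral>\<xi>. exp (\<i> * complex_of_real (L z \<bullet> \<xi>)) * f \<xi> \<partial>lborel)" for z
  note [measurable] = borel_measurable_integrable[OF assms(6)]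
  have [measurable]: "\<Phi> \<in> borel_measurable borel"
    unfolding \<Phi>_def by measurable
  have lim: "(\<lambda>n. ennreal (gaussian (1 / real (Suc n)) z * (norm (\<Phi> z))\<^sup>2)) \<longlonglongrightarrow> ennreal ((norm (\<Phi> z))\<^sup>2)" for z
  proof -
    have "(\<lambda>n. - (1 / real (Suc n)) * (z \<bullet> z) / 2) \<longlonglongrightarrow> - 0 * (z \<bullet> z) / 2"
      using lim_1_over_n by (intro tendsto_divide tendsto_mult tendsto_minus tendsto_const LIMSEQ_Suc) auto
    then have "(\<lambda>n. gaussian (1 / real (Suc n)) z * (norm (\<Phi> z))\<^sup>2) \<longlonglongrightarrow> exp (- 0 * (z \<bullet> z) / 2) * (norm (\<Phi> z))\<^sup>2"
      unfolding gaussian_def by (intro tendsto_mult tendsto_exp tendsto_const)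
    then show ?thesis by (intro tendsto_ennrealI) simp
  qed
  have "(\<integral>\<^sup>+z. ennreal ((norm (\<Phi> z))\<^sup>2) \<partial>lborel) = (\<integral>\<^sup>+z. liminf (\<lambda>n. ennreal (gaussian (1 / real (Suc n)) z * (norm (\<Phi> z))\<^sup>2)) \<partial>lborel)"
    by (intro nn_integral_cong lim_imp_Liminf[OF _ lim, symmetric]) simp
  also have "\<dots> \<le> liminf (\<lambda>n. \<integral>\<^sup>+z. ennreal (gaussian (1 / real (Suc n)) z * (norm (\<Phi> z))\<^sup>2) \<partial>lborel)"
    by (rule nn_integral_liminf) measurable
  also have "\<dots> \<le> limsup (\<lambda>n. \<integral>\<^sup>+z. ennreal (gaussian (1 / real (Suc n)) z * (norm (\<Phi> z))\<^sup>2) \<partial>lborel)"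
    by (rule Liminf_le_Limsup) simp
  also have "\<dots> \<le> ennreal ((2 * pi) ^ DIM('b) * (\<integral>\<xi>. (norm (f \<xi>))\<^sup>2 \<partial>lborel))"
    unfolding \<Phi>_def
    by (intro Limsup_bounded always_eventually allI fourier_L2_bound_gaussian[where M=M] assms) auto
  finally show ?thesis unfolding \<Phi>_def .
qed

section \<open>Mollification by heat kernels\<close>

lemma integral_lborel_affine:
  fixes f :: "'a::euclidean_space \<Rightarrow> 'b::{banach,second_countable_topology}"
  assumes [measurable]: "f \<in> borel_measurable borel" and "c \<noteq> 0"
  shows "(\<integral>x. f x \<partial>lborel) = \<bar>c\<bar> ^ DIM('a) *\<^sub>R (\<integral>x. f (t + c *\<^sub>R x) \<partial>lborel)"
  by (subst lborel_affine[OF \<open>c \<noteq> 0\<close>, of t])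
    (simp add: integral_density integral_distr)

lemma integrable_lborel_shift:
  fixes f :: "'a::euclidean_space \<Rightarrow> 'b::{banach,second_countable_topology}"
  assumes "integrable lborel f"
  shows "integrable lborel (\<lambda>x. f (x - c))"
proof -
  have "integrable (distr lborel borel ((+) (- c))) f"
    using assms by (simp add: lborel_distr_plus)
  from integrable_distr[OF _ this] show ?thesis by simp
qed

text \<open>The centred Gaussian probability density whose variance in each coordinate is
  \<open>1 / m\<close>; it concentrates as \<open>m\<close> grows.\<close>

definition heat_kernel :: "real \<Rightarrow> 'a::euclidean_space \<Rightarrow> real" where
  "heat_kernel m x = sqrt (m / (2 * pi)) ^ DIM('a) * gaussian m x"

lemma borel_measurable_heat_kernel [measurable]: "heat_kernel m \<in> borel_measurable borel"
  unfolding heat_kernel_def by measurable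

lemma heat_kernel_nonneg: "m > 0 \<Longrightarrow> heat_kernel m x \<ge> 0"
  by (simp add: heat_kernel_def)

lemma heat_kernel_le: "m > 0 \<Longrightarrow> heat_kernel m (x :: 'a::euclidean_space) \<le> sqrt (m / (2 * pi)) ^ DIM('a)"
  by (simp add: heat_kernel_def mult_left_le gaussian_le_1)

lemma integrable_heat_kernel: "m > 0 \<Longrightarrow> integrable lborel (heat_kernel m)"
  unfolding heat_kernel_def by (intro integrable_mult_right integrable_gaussian)

lemma integral_heat_kernel:
  assumes "m > 0"
  shows "(\<integral>x. heat_kernel m x \<partial>(lborel :: 'a::euclidean_space measure)) = 1"
  using assms by (simp add: heat_kernel_def integral_gaussian power_mult_distrib[symmetric] real_sqrt_mult[symmetric])

text \<open>The substitution \<open>y = p + x / sqrt m\<close> moves the dependence on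
  \<open>m\<close> from the kernel into the argument of \<open>V\<close>; dominated convergence with
  the fixed density \<open>heat_kernel 1\<close> finishes.\<close>

lemma heat_kernel_convolution_tendsto:
  fixes V :: "'a::euclidean_space \<Rightarrow> real"
  assumes [measurable]: "V \<in> borel_measurable borel" and B: "\<And>x. \<bar>V x\<bar> \<le> B" and "isCont V p"
  shows "(\<lambda>n. \<integral>y. V y * heat_kernel (real (Suc n)) (y - p) \<partial>lborel) \<longlonglongrightarrow> V p"
proof -
  have eq: "(\<integral>y. V y * heat_kernel (real (Suc n)) (y - p) \<partial>lborel) =
    (\<integral>x. V (p + (1 / sqrt (real (Suc n))) *\<^sub>R x) * heat_kernel 1 x \<partial>lborel)" for n
  proof -
    define m where "m = real (Suc n)"
    have m: "m > 0" by (simp add: m_def)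
    have "(\<integral>y. V y * heat_kernel m (y - p) \<partial>lborel) =
      \<bar>1 / sqrt m\<bar> ^ DIM('a) *\<^sub>R (\<integral>x. V (p + (1 / sqrt m) *\<^sub>R x) * heat_kernel m ((1 / sqrt m) *\<^sub>R x :: 'a) \<partial>lborel)"
      using m by (subst integral_lborel_affine[where c="1 / sqrt m" and t=p]) simp_all
    moreover have "heat_kernel m ((1 / sqrt m) *\<^sub>R x :: 'a) = sqrt m ^ DIM('a) * heat_kernel 1 x" for x
      using m by (simp add: heat_kernel_def gaussian_def power_mult_distrib[symmetric] real_sqrt_mult[symmetric])
    ultimately have "(\<integral>y. V y * heat_kernel m (y - p) \<partial>lborel) =
      (\<integral>x. V (p + (1 / sqrt m) *\<^sub>R x) * heat_kernel 1 x \<partial>lborel)"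
      using m by (simp add: power_mult_distrib[symmetric] mult.left_commute power_divide)
    then show ?thesis unfolding m_def .
  qed
  have "(\<lambda>n. \<integral>x. V (p + (1 / sqrt (real (Suc n))) *\<^sub>R x) * heat_kernel 1 x \<partial>lborel) \<longlonglongrightarrow> (\<integral>x. V p * heat_kernel 1 x \<partial>(lborel :: 'a measure))"
  proof (rule integral_dominated_convergence[where w="\<lambda>x::'a. B * heat_kernel 1 x"])
    show "integrable lborel (\<lambda>x::'a. B * heat_kernel 1 x)"
      by (intro integrable_mult_right integrable_heat_kernel) simp
    show "AE x in lborel. (\<lambda>n. V (p + (1 / sqrt (real (Suc n))) *\<^sub>R x) * heat_kernel 1 x) \<longlonglongrightarrow> V p * heat_kernel 1 x"
    proof (intro AE_I2 tendsto_mult tendsto_const)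
      fix x :: 'a
      have "(\<lambda>n. 1 / real (Suc n)) \<longlonglongrightarrow> 0"
        by (rule LIMSEQ_Suc[OF lim_1_over_n])
      then have "(\<lambda>n. sqrt (1 / real (Suc n))) \<longlonglongrightarrow> sqrt 0" by (rule tendsto_real_sqrt)
      then have "(\<lambda>n. 1 / sqrt (real (Suc n))) \<longlonglongrightarrow> 0" by (simp add: real_sqrt_divide)
      then have "(\<lambda>n. p + (1 / sqrt (real (Suc n))) *\<^sub>R x) \<longlonglongrightarrow> p + 0 *\<^sub>R x"
        by (intro tendsto_add tendsto_scaleR tendsto_const)
      then have "(\<lambda>n. p + (1 / sqrt (real (Suc n))) *\<^sub>R x) \<longlonglongrightarrow> p" by simp
      with \<open>isCont V p\<close> show "(\<lambda>n. V (p + (1 / sqrt (real (Suc n))) *\<^sub>R x)) \<longlonglongrightarrow> V p"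
        by (rule isCont_tendsto_compose)
    qed
    show "AE x in lborel. norm (V (p + (1 / sqrt (real (Suc n))) *\<^sub>R x) * heat_kernel 1 x) \<le> B * heat_kernel 1 x" for n
      by (intro AE_I2) (simp add: abs_mult heat_kernel_nonneg mult_right_mono B)
  qed measurable
  then show ?thesis unfolding eq by (simp add: integral_heat_kernel)
qed

lemma AE_lborel_shift:
  fixes P :: "'a::euclidean_space \<Rightarrow> bool"
  assumes "AE y in lborel. P y"
  shows "AE x in lborel. P (z - x)"
proof -
  have "AE x in distr lborel borel (\<lambda>x. z + (-1) *\<^sub>R x). P x"
    using assms by (subst (asm) lborel_affine[of "-1" z]) (simp_all add: AE_density)
  from AE_distrD[OF _ this] show ?thesis by simp
qed

text \<open>Fubini moves the mollifier from \<open>k\<close> to \<open>V\<close>. An integrable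
  \<open>k\<close> offers no pointwise limits, whereas \<open>V\<close> is bounded and continuous
  almost everywhere, so the limit exists at every single \<open>z\<close>. That matters because
  \<open>z\<close> will be restricted to lines, which are null sets of the plane.\<close>

lemma mollified_convolution_tendsto:
  fixes k V :: "'a::euclidean_space \<Rightarrow> real"
  assumes k: "integrable lborel k"
    and V: "integrable lborel V" "\<And>x. \<bar>V x\<bar> \<le> B" "AE y in lborel. isCont V y"
  shows "(\<lambda>n. \<integral>y. V y * (\<integral>x. k x * heat_kernel (real (Suc n)) (x - (z - y)) \<partial>lborel) \<partial>lborel) \<longlonglongrightarrow>
    (\<integral>x. k x * V (z - x) \<partial>lborel)"
proof -
  note [measurable] = borel_measurable_integrable[OF k] borel_measurable_integrable[OF V(1)]
  have eq: "(\<integral>y. V y * (\<integral>x. k x * heat_kernel (real (Suc n)) (x - (z - y)) \<partial>lborel) \<partial>lborel) =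
    (\<integral>x. k x * (\<integral>y. V y * heat_kernel (real (Suc n)) (y - (z - x)) \<partial>lborel) \<partial>lborel)" for n
  proof -
    have "(\<integral>y. V y * (\<integral>x. k x * heat_kernel (real (Suc n)) (x - (z - y)) \<partial>lborel) \<partial>lborel)
      = (\<integral>y. (\<integral>x. V y * (k x * heat_kernel (real (Suc n)) (x - (z - y))) \<partial>lborel) \<partial>lborel)"
      by simp
    also have "\<dots> = (\<integral>x. (\<integral>y. V y * (k x * heat_kernel (real (Suc n)) (x - (z - y))) \<partial>lborel) \<partial>lborel)"
    proof (rule Fubini_bound[where g="\<lambda>y. \<bar>V y\<bar>" and h="\<lambda>x. \<bar>k x\<bar> * sqrt (real (Suc n) / (2 * pi)) ^ DIM('a)"])
      show "norm (V y * (k x * heat_kernel (real (Suc n)) (x - (z - y)))) \<le> \<bar>V y\<bar> * (\<bar>k x\<bar> * sqrt (real (Suc n) / (2 * pi)) ^ DIM('a))" for x y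
        using heat_kernel_le[of "real (Suc n)" "x - (z - y)"] heat_kernel_nonneg[of "real (Suc n)" "x - (z - y)"]
        by (auto simp: abs_mult intro!: mult_left_mono)
    qed (use k V in auto)
    also have "\<dots> = (\<integral>x. (\<integral>y. k x * (V y * heat_kernel (real (Suc n)) (y - (z - x))) \<partial>lborel) \<partial>lborel)"
      by (intro Bochner_Integration.integral_cong refl) (simp add: algebra_simps)
    finally show ?thesis by simp
  qed
  have "0 \<le> B" using V(2)[of 0] by linarith
  have "(\<lambda>n. \<integral>x. k x * (\<integral>y. V y * heat_kernel (real (Suc n)) (y - (z - x)) \<partial>lborel) \<partial>lborel) \<longlonglongrightarrow> (\<integral>x. k x * V (z - x) \<partial>lborel)"
  proof (rule integral_dominated_convergence[where w="\<lambda>x. \<bar>k x\<bar> * B"])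
    show "AE x in lborel. (\<lambda>n. k x * (\<integral>y. V y * heat_kernel (real (Suc n)) (y - (z - x)) \<partial>lborel)) \<longlonglongrightarrow> k x * V (z - x)"
      using AE_lborel_shift[OF V(3), of z]
      by eventually_elim (intro tendsto_mult tendsto_const heat_kernel_convolution_tendsto[where B=B] V(2), simp_all)
    show "AE x in lborel. norm (k x * (\<integral>y. V y * heat_kernel (real (Suc n)) (y - (z - x)) \<partial>lborel)) \<le> \<bar>k x\<bar> * B" for n
    proof (intro AE_I2)
      fix x
      have "norm (\<integral>y. V y * heat_kernel (real (Suc n)) (y - (z - x)) \<partial>lborel) \<le> (\<integral>y. B * heat_kernel (real (Suc n)) (y - (z - x)) \<partial>lborel)"
      proof (rule Bochner_Integration.integral_norm_bound_integral)
        have int: "integrable lborel (\<lambda>y. heat_kernel (real (Suc n)) (y - (z - x)))"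
          by (intro integrable_lborel_shift integrable_heat_kernel) simp
        then show "integrable lborel (\<lambda>y. B * heat_kernel (real (Suc n)) (y - (z - x)))" by simp
        show *: "norm (V y * heat_kernel (real (Suc n)) (y - (z - x))) \<le> B * heat_kernel (real (Suc n)) (y - (z - x))" for y
          by (simp add: abs_mult heat_kernel_nonneg mult_right_mono V)
        show "integrable lborel (\<lambda>y. V y * heat_kernel (real (Suc n)) (y - (z - x)))"
          by (rule Bochner_Integration.integrable_bound[OF integrable_mult_right[OF int, of B]])
            (use V(2) \<open>B \<ge> 0\<close> in \<open>auto intro!: AE_I2 mult_right_mono simp: abs_mult\<close>)
      qed
      also have "\<dots> = B * (\<integral>y. heat_kernel (real (Suc n)) y \<partial>(lborel :: 'a measure))"
        by (subst (2) lborel_distr_plus[of "- (z - x)", symmetric]) (simp add: integral_distr algebra_simps)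
      also have "\<dots> = B" by (simp add: integral_heat_kernel)
      finally show "norm (k x * (\<integral>y. V y * heat_kernel (real (Suc n)) (y - (z - x)) \<partial>lborel)) \<le> \<bar>k x\<bar> * B"
        by (simp add: abs_mult mult_left_mono)
    qed
  qed (use k in auto)
  then show ?thesis by (simp only: eq)
qed

section \<open>Functions in weighted \<open>L\<^sup>\<infinity>\<close> spaces on the Fourier side\<close>

lemma completion_ex_borel_measurable_complex:
  fixes g :: "'a \<Rightarrow> complex"
  assumes [measurable]: "g \<in> borel_measurable (completion M)"
  shows "\<exists>g'\<in>borel_measurable M. (AE x in M. g x = g' x)"
proof -
  obtain gr where gr [measurable]: "gr \<in> borel_measurable M" "AE x in M. Re (g x) = gr x"
    using completion_ex_borel_measurable_real[of "\<lambda>x. Re (g x)" M] by auto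
  obtain gi where gi [measurable]: "gi \<in> borel_measurable M" "AE x in M. Im (g x) = gi x"
    using completion_ex_borel_measurable_real[of "\<lambda>x. Im (g x)" M] by auto
  show ?thesis
  proof (intro bexI[of _ "\<lambda>x. Complex (gr x) (gi x)"])
    show "AE x in M. g x = Complex (gr x) (gi x)"
      using gr(2) gi(2) by eventually_elim (auto simp: complex_eq_iff)
    show "(\<lambda>x. Complex (gr x) (gi x)) \<in> borel_measurable M"
      unfolding Complex_eq by measurable
  qed
qed

text \<open>The definitions integrate over the completed measure, the estimates run with Borel
  functions over \<open>lborel\<close>; this is the passage between them.\<close>

lemma integral_lebesgue_AE_borel:
  fixes f g :: "'a::euclidean_space \<Rightarrow> 'b::euclidean_space"
  assumes [measurable]: "g \<in> borel_measurable borel" and "AE x in lborel. f x = g x"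
  shows "(\<integral>x. f x \<partial>lebesgue) = (\<integral>x. g x \<partial>lborel)"
proof -
  have ae: "AE x in lebesgue. f x = g x" using assms(2) by (rule AE_completion)
  have g: "g \<in> borel_measurable lebesgue" by (rule measurable_completion) simp
  have "f \<in> borel_measurable lebesgue"
    using ae by (intro borel_measurable_AE[OF g]) (simp add: eq_commute)
  then have "(\<integral>x. f x \<partial>lebesgue) = (\<integral>x. g x \<partial>lebesgue)"
    using g ae by (rule integral_cong_AE)
  also have "\<dots> = (\<integral>x. g x \<partial>lborel)" by (rule integral_completion) simp
  finally show ?thesis .
qed

text \<open>The hypothesis is tested on Gaussian waves only. Their transforms are multiples of heat
  kernels, so it becomes a pointwise formula: the mollified kernel is an absolutely convergent
  Fourier integral of \<open>F\<close> damped by a Gaussian.\<close>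

lemma in_H_infinity_representation:
  fixes k0 k :: "'a::euclidean_space \<Rightarrow> real"
  assumes H: "in_H lam \<infinity> (distribution_of (\<lambda>x. complex_of_real (k0 x)))"
    and k: "integrable lborel k" "AE x in lborel. k0 x = k x"
  obtains F :: "'a \<Rightarrow> complex" and C where "F \<in> borel_measurable borel" "C \<ge> 0"
    "\<And>\<xi>. norm (F \<xi>) * (1 + (norm \<xi>)\<^sup>2) powr (lam / 2) \<le> C"
    "\<And>m z. m > 0 \<Longrightarrow> complex_of_real ((2 * pi) ^ DIM('a) * (\<integral>x. k x * heat_kernel m (x - z) \<partial>lborel)) =
      (\<integral>\<xi>. F \<xi> * gauss_wave (1 / m) z \<xi> \<partial>lborel)"
proof -
  note [measurable] = borel_measurable_integrable[OF k(1)]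
  obtain F0 where F0: "F0 \<in> borel_measurable lebesgue"
    "\<And>h. schwartz h \<Longrightarrow> distribution_of (\<lambda>x. complex_of_real (k0 x)) (fourier h) = distribution_of F0 h"
    "finite_Lp_norm \<infinity> (\<lambda>\<xi>. complex_of_real ((1 + (norm \<xi>)\<^sup>2) powr (lam / 2)) * F0 \<xi>)"
    using H unfolding in_H_def has_fourier_transform_def by blast
  obtain C where "AE \<xi> in lebesgue. norm (complex_of_real ((1 + (norm \<xi>)\<^sup>2) powr (lam / 2)) * F0 \<xi>) \<le> C"
    using F0(3) unfolding finite_Lp_norm_def by auto
  then have C: "AE \<xi> in lborel. (1 + (norm \<xi>)\<^sup>2) powr (lam / 2) * norm (F0 \<xi>) \<le> C"
    by (simp add: norm_mult AE_completion_iff)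
  obtain F1 where F1 [measurable]: "F1 \<in> borel_measurable borel" "AE x in lborel. F0 x = F1 x"
    using completion_ex_borel_measurable_complex[OF F0(1)] by auto
  \<comment> \<open>Putting 0 on the null set where the weighted bound fails makes the bound hold
    everywhere without changing any integral.\<close>
  define F where "F \<xi> = (if norm (F1 \<xi>) * (1 + (norm \<xi>)\<^sup>2) powr (lam / 2) \<le> max C 0 then F1 \<xi> else 0)" for \<xi>
  have [measurable]: "F \<in> borel_measurable borel" unfolding F_def by measurable
  have ae: "AE x in lborel. F0 x = F x"
    using C F1(2) by eventually_elim (auto simp: F_def mult.commute)
  show ?thesis
  proof (rule that[of F "max C 0"])
    show "norm (F \<xi>) * (1 + (norm \<xi>)\<^sup>2) powr (lam / 2) \<le> max C 0" for \<xi> by (simp add: F_def)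
    fix m :: real and z :: 'a assume m: "m > 0"
    have s: "sqrt (2 * pi / (1 / m)) = 2 * pi * sqrt (m / (2 * pi))"
    proof -
      have "2 * pi / (1 / m) = (2 * pi)\<^sup>2 * (m / (2 * pi))" using m by (simp add: power2_eq_square)
      then show ?thesis by (simp only: real_sqrt_mult real_sqrt_abs) simp
    qed
    have fw: "fourier (gauss_wave (1 / m) z) x = complex_of_real ((2 * pi) ^ DIM('a) * heat_kernel m (x - z))" for x
      using m by (subst fourier_gauss_wave) (simp_all only: s heat_kernel_def power_mult_distrib, simp_all)
    have "complex_of_real ((2 * pi) ^ DIM('a) * (\<integral>x. k x * heat_kernel m (x - z) \<partial>lborel))
       = (\<integral>x. complex_of_real (k x) * fourier (gauss_wave (1 / m) z) x \<partial>lborel)"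
      unfolding fw by (simp only: of_real_mult[symmetric] integral_complex_of_real mult.left_commute[of "k _"] integral_mult_right_zero)
    also have "\<dots> = distribution_of (\<lambda>x. complex_of_real (k0 x)) (fourier (gauss_wave (1 / m) z))"
      unfolding distribution_of_def
      by (rule integral_lebesgue_AE_borel[symmetric]) (use k(2) in \<open>auto simp: fw\<close>)
    also have "\<dots> = distribution_of F0 (gauss_wave (1 / m) z)"
      using m by (intro F0(2) schwartz_gauss_wave) auto
    also have "\<dots> = (\<integral>\<xi>. F \<xi> * gauss_wave (1 / m) z \<xi> \<partial>lborel)"
      unfolding distribution_of_def
      by (rule integral_lebesgue_AE_borel) (use ae in auto)
    finally show "complex_of_real ((2 * pi) ^ DIM('a) * (\<integral>x. k x * heat_kernel m (x - z) \<partial>lborel)) =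
      (\<integral>\<xi>. F \<xi> * gauss_wave (1 / m) z \<xi> \<partial>lborel)" .
  qed auto
qed

text \<open>The usual power of \<open>2 * pi\<close> is left out; where needed it is part of the
  integrand \<open>Q\<close>.\<close>

definition inv_ft :: "('a::euclidean_space \<Rightarrow> complex) \<Rightarrow> 'a \<Rightarrow> complex" where
  "inv_ft Q z = (\<integral>\<xi>. exp (\<i> * complex_of_real (z \<bullet> \<xi>)) * Q \<xi> \<partial>lborel)"

lemma borel_measurable_inv_ft [measurable]:
  assumes [measurable]: "Q \<in> borel_measurable borel"
  shows "inv_ft Q \<in> borel_measurable borel"
  unfolding inv_ft_def by measurable

lemma integrable_inv_ft:
  assumes "integrable lborel Q"
  shows "integrable lborel (\<lambda>\<xi>. exp (\<i> * complex_of_real (z \<bullet> \<xi>)) * Q \<xi>)"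
proof -
  note [measurable] = borel_measurable_integrable[OF assms]
  show ?thesis
    by (rule Bochner_Integration.integrable_bound[OF integrable_norm[OF assms]]) (auto simp: norm_mult)
qed

lemma norm_inv_ft_le: "norm (inv_ft Q z) \<le> (\<integral>\<xi>. norm (Q \<xi>) \<partial>lborel)"
  unfolding inv_ft_def by (rule order_trans[OF integral_norm_bound]) (simp add: norm_mult)

text \<open>The fundamental theorem of calculus for each plane wave along the segment, followed by
  an exchange of integrals. The factor \<open>\<xi> \<bullet> e\<close> is the directional
  derivative on the Fourier side.\<close>

lemma inv_ft_increment:
  fixes Q :: "'a::euclidean_space \<Rightarrow> complex"
  assumes Q: "integrable lborel Q" and Q1: "integrable lborel (\<lambda>\<xi>. complex_of_real (\<xi> \<bullet> e) * Q \<xi>)" and "x \<ge> 0"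
  shows "inv_ft Q (z + x *\<^sub>R e) - inv_ft Q (z - x *\<^sub>R e) =
    (\<integral>r. indicator {-x..x} r *\<^sub>R inv_ft (\<lambda>\<xi>. \<i> * complex_of_real (\<xi> \<bullet> e) * Q \<xi>) (z + r *\<^sub>R e) \<partial>lborel)"
proof -
  note [measurable] = borel_measurable_integrable[OF Q]
  have pt: "exp (\<i> * complex_of_real ((z + x *\<^sub>R e) \<bullet> \<xi>)) - exp (\<i> * complex_of_real ((z - x *\<^sub>R e) \<bullet> \<xi>)) =
    (\<integral>r. indicator {-x..x} r *\<^sub>R (exp (\<i> * complex_of_real ((z + r *\<^sub>R e) \<bullet> \<xi>)) * (\<i> * complex_of_real (\<xi> \<bullet> e))) \<partial>lborel)" for \<xi>
  proof -
    have "((\<lambda>r. exp (\<i> * complex_of_real ((z + r *\<^sub>R e) \<bullet> \<xi>))) has_vector_derivative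
        (exp (\<i> * complex_of_real ((z + r *\<^sub>R e) \<bullet> \<xi>)) * (\<i> * complex_of_real (\<xi> \<bullet> e)))) (at r within {-x..x})" for r
    proof -
      have "((\<lambda>r. (z + r *\<^sub>R e) \<bullet> \<xi>) has_vector_derivative (\<xi> \<bullet> e)) (at r within {-x..x})"
        unfolding has_vector_derivative_def by (auto intro!: derivative_eq_intros simp: inner_commute)
      then have "((\<lambda>r. complex_of_real ((z + r *\<^sub>R e) \<bullet> \<xi>)) has_vector_derivative complex_of_real (\<xi> \<bullet> e)) (at r within {-x..x})"
        by (rule bounded_linear.has_vector_derivative[OF bounded_linear_of_real])
      then have "((\<lambda>r. \<i> * complex_of_real ((z + r *\<^sub>R e) \<bullet> \<xi>)) has_vector_derivative \<i> * complex_of_real (\<xi> \<bullet> e)) (at r within {-x..x})"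
        by (rule has_vector_derivative_mult_right)
      from field_vector_diff_chain_within[OF this DERIV_subset[OF DERIV_exp]]
      show ?thesis by (simp add: o_def mult.commute)
    qed
    then show ?thesis
      using \<open>x \<ge> 0\<close>
      by (subst integral_FTC_atLeastAtMost[where F="\<lambda>r. exp (\<i> * complex_of_real ((z + r *\<^sub>R e) \<bullet> \<xi>))"])
        (auto intro!: continuous_intros)
  qed
  have "inv_ft Q (z + x *\<^sub>R e) - inv_ft Q (z - x *\<^sub>R e) =
    (\<integral>\<xi>. (exp (\<i> * complex_of_real ((z + x *\<^sub>R e) \<bullet> \<xi>)) - exp (\<i> * complex_of_real ((z - x *\<^sub>R e) \<bullet> \<xi>))) * Q \<xi> \<partial>lborel)"
    unfolding inv_ft_def left_diff_distrib
    by (intro Bochner_Integration.integral_diff[symmetric] integrable_inv_ft Q)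
  also have "\<dots> = (\<integral>\<xi>. (\<integral>r. indicator {-x..x} r *\<^sub>R (exp (\<i> * complex_of_real ((z + r *\<^sub>R e) \<bullet> \<xi>)) * (\<i> * complex_of_real (\<xi> \<bullet> e) * Q \<xi>)) \<partial>lborel) \<partial>lborel)"
    unfolding pt integral_mult_left_zero[symmetric] by (simp add: mult.assoc)
  also have "\<dots> = (\<integral>r. (\<integral>\<xi>. indicator {-x..x} r *\<^sub>R (exp (\<i> * complex_of_real ((z + r *\<^sub>R e) \<bullet> \<xi>)) * (\<i> * complex_of_real (\<xi> \<bullet> e) * Q \<xi>)) \<partial>lborel) \<partial>lborel)"
  proof (rule Fubini_bound[where g="\<lambda>\<xi>. norm (complex_of_real (\<xi> \<bullet> e) * Q \<xi>)" and h="indicator {-x..x}"])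
    show "integrable lborel (\<lambda>\<xi>. norm (complex_of_real (\<xi> \<bullet> e) * Q \<xi>))"
      using Q1 by (rule integrable_norm)
    show "integrable lborel (indicat_real {-x..x})"
      by (rule integrable_real_indicator) (use \<open>x \<ge> 0\<close> in auto)
  qed (auto simp: norm_mult split: split_indicator)
  finally show ?thesis by (simp add: inv_ft_def)
qed

text \<open>Low frequencies of the derivative are estimated uniformly, high frequencies in \<open>L\<^sup>2\<close>.\<close>

lemma inv_ft_strip_bound:
  fixes Q :: "real^2 \<Rightarrow> complex"
  assumes e: "\<And>v. (v \<bullet> e1)\<^sup>2 + (v \<bullet> e2)\<^sup>2 = (norm v)\<^sup>2"
    and Q: "integrable lborel Q"
    and Q1: "integrable lborel (\<lambda>\<xi>. norm \<xi> * norm (Q \<xi>))"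
    and Q2: "integrable lborel (\<lambda>\<xi>. (norm \<xi> * norm (Q \<xi>))\<^sup>2)"
    and low: "(\<integral>\<xi>. indicator (cball 0 N) \<xi> * (norm \<xi> * norm (Q \<xi>)) \<partial>lborel) \<le> A"
    and high: "(\<integral>\<xi>. indicator (- cball 0 N) \<xi> * (norm \<xi> * norm (Q \<xi>))\<^sup>2 \<partial>lborel) \<le> E"
    and "x \<ge> 0" "\<beta> > 0"
  shows "(\<integral>\<^sup>+t. ennreal (indicator {-1..1} t * norm (inv_ft Q ((s + x) *\<^sub>R e1 + t *\<^sub>R e2) - inv_ft Q ((s - x) *\<^sub>R e1 + t *\<^sub>R e2))) \<partial>lborel)
    \<le> ennreal (4 * x * A + 2 * x / \<beta> + \<beta> / 2 * ((2 * pi)\<^sup>2 * E))"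
proof -
  note [measurable] = borel_measurable_integrable[OF Q]
  define Ql where "Ql \<xi> = indicator (cball 0 N) \<xi> *\<^sub>R (\<i> * complex_of_real (\<xi> \<bullet> e1) * Q \<xi>)" for \<xi>
  define Qh where "Qh \<xi> = indicator (- cball 0 N) \<xi> *\<^sub>R (\<i> * complex_of_real (\<xi> \<bullet> e1) * Q \<xi>)" for \<xi>
  define P where "P = (\<lambda>(s, t). s *\<^sub>R e1 + t *\<^sub>R e2)"
  have [measurable]: "P \<in> borel_measurable borel"
    unfolding P_def case_prod_beta by (intro borel_measurable_continuous_onI continuous_intros)
  have [measurable]: "Ql \<in> borel_measurable borel" "Qh \<in> borel_measurable borel"
    unfolding Ql_def Qh_def
    by (auto intro!: borel_measurable_scaleR borel_measurable_indicator borel_measurable_times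
        borel_measurable_of_real borel_measurable_inner borel_closed)
  have e1: "\<bar>\<xi> \<bullet> e1\<bar> \<le> norm \<xi>" for \<xi>
  proof -
    have "(\<xi> \<bullet> e1)\<^sup>2 \<le> (norm \<xi>)\<^sup>2" using e[of \<xi>] zero_le_power2[of "\<xi> \<bullet> e2"] by linarith
    then show ?thesis using abs_le_square_iff[of "\<xi> \<bullet> e1" "norm \<xi>"] by simp
  qed
  have bQ: "norm (\<i> * complex_of_real (\<xi> \<bullet> e1) * Q \<xi>) \<le> norm \<xi> * norm (Q \<xi>)" for \<xi>
    by (simp add: norm_mult mult_right_mono e1)
  have iQ: "integrable lborel (\<lambda>\<xi>. \<i> * complex_of_real (\<xi> \<bullet> e1) * Q \<xi>)"
    by (rule Bochner_Integration.integrable_bound[OF Q1]) (use bQ in auto)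
  have iQ': "integrable lborel (\<lambda>\<xi>. complex_of_real (\<xi> \<bullet> e1) * Q \<xi>)"
    using integrable_mult_right[OF iQ, of "- \<i>"] by (simp add: mult.assoc[symmetric])
  have iQl: "integrable lborel Ql" unfolding Ql_def by (rule integrable_mult_indicator[OF _ iQ]) simp
  have iQh: "integrable lborel Qh" unfolding Qh_def by (rule integrable_mult_indicator[OF _ iQ]) simp
  have split: "inv_ft (\<lambda>\<xi>. \<i> * complex_of_real (\<xi> \<bullet> e1) * Q \<xi>) z = inv_ft Ql z + inv_ft Qh z" for z
    unfolding inv_ft_def
    by (subst Bochner_Integration.integral_add[OF integrable_inv_ft[OF iQl] integrable_inv_ft[OF iQh], symmetric])
      (auto intro!: Bochner_Integration.integral_cong simp: Ql_def Qh_def split: split_indicator)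
  have ql: "norm (inv_ft Ql z) \<le> A" for z
  proof -
    have "norm (inv_ft Ql z) \<le> (\<integral>\<xi>. norm (Ql \<xi>) \<partial>lborel)" by (rule norm_inv_ft_le)
    also have "\<dots> \<le> (\<integral>\<xi>. indicator (cball 0 N) \<xi> * (norm \<xi> * norm (Q \<xi>)) \<partial>lborel)"
    proof (rule integral_mono[OF integrable_norm[OF iQl]])
      show "integrable lborel (\<lambda>\<xi>. indicator (cball 0 N) \<xi> * (norm \<xi> * norm (Q \<xi>)))"
        using integrable_mult_indicator[OF _ Q1, of "cball 0 N"] by simp
    qed (use bQ in \<open>auto simp: Ql_def split: split_indicator\<close>)
    finally show ?thesis using low by linarith
  qed
  then have "A \<ge> 0" using norm_ge_zero order_trans by blast
  \<comment> \<open>The coordinates \<open>(s, t)\<close> of the frame \<open>e1\<close>,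
    \<open>e2\<close> are isometric, so the one-sided Plancherel bound holds for the integral over
    pairs, which is what the strip requires.\<close>
  have qh: "(\<integral>\<^sup>+p. ennreal ((norm (inv_ft Qh (P p)))\<^sup>2) \<partial>lborel) \<le> ennreal ((2 * pi)\<^sup>2 * E)"
  proof -
    have le: "(norm (Qh \<xi>))\<^sup>2 \<le> indicator (- cball 0 N) \<xi> * (norm \<xi> * norm (Q \<xi>))\<^sup>2" for \<xi>
      using power_mono[OF bQ[of \<xi>], of 2] by (auto simp: Qh_def split: split_indicator)
    have i: "integrable lborel (\<lambda>\<xi>. indicator (- cball 0 N) \<xi> * (norm \<xi> * norm (Q \<xi>))\<^sup>2)"
      using integrable_mult_indicator[OF _ Q2, of "- cball 0 N"] by simp
    have i2: "integrable lborel (\<lambda>\<xi>. (norm (Qh \<xi>))\<^sup>2)"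
      by (rule Bochner_Integration.integrable_bound[OF i]) (use le in \<open>auto intro!: AE_I2\<close>)
    have "(\<integral>\<^sup>+p. ennreal ((norm (inv_ft Qh (P p)))\<^sup>2) \<partial>lborel) \<le> ennreal ((2 * pi) ^ DIM(real^2) * (\<integral>\<xi>. (norm (Qh \<xi>))\<^sup>2 \<partial>lborel))"
      unfolding inv_ft_def
    proof (rule fourier_L2_bound[where M="\<lambda>\<xi>. (\<xi> \<bullet> e1, \<xi> \<bullet> e2)"])
      show "P z \<bullet> \<xi> = (\<xi> \<bullet> e1, \<xi> \<bullet> e2) \<bullet> z" for z \<xi>
        by (cases z) (simp add: P_def inner_add_left inner_add_right inner_commute)
      show "norm (\<xi> \<bullet> e1, \<xi> \<bullet> e2) = norm \<xi>" for \<xi>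
        by (simp add: norm_Pair e)
    qed (auto simp: inner_diff_left iQh i2)
    also have "(\<integral>\<xi>. (norm (Qh \<xi>))\<^sup>2 \<partial>lborel) \<le> E"
      using integral_mono[OF i2 i le] high by linarith
    finally show ?thesis
      by (simp add: ennreal_leI mult_left_mono)
  qed
  have incr: "ennreal (norm (inv_ft Q ((s + x) *\<^sub>R e1 + t *\<^sub>R e2) - inv_ft Q ((s - x) *\<^sub>R e1 + t *\<^sub>R e2)))
    \<le> (\<integral>\<^sup>+r. indicator {-x..x} r * (ennreal (A + 1 / (2 * \<beta>)) + ennreal (\<beta> / 2) * ennreal ((norm (inv_ft Qh (P (r + s, t))))\<^sup>2)) \<partial>lborel)" for t
  proof -
    have "inv_ft Q ((s + x) *\<^sub>R e1 + t *\<^sub>R e2) - inv_ft Q ((s - x) *\<^sub>R e1 + t *\<^sub>R e2) =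
      inv_ft Q ((s *\<^sub>R e1 + t *\<^sub>R e2) + x *\<^sub>R e1) - inv_ft Q ((s *\<^sub>R e1 + t *\<^sub>R e2) - x *\<^sub>R e1)"
      by (simp add: algebra_simps)
    also have "\<dots> = (\<integral>r. indicator {-x..x} r *\<^sub>R (inv_ft Ql (P (r + s, t)) + inv_ft Qh (P (r + s, t))) \<partial>lborel)"
      unfolding inv_ft_increment[OF Q iQ' \<open>x \<ge> 0\<close>] split by (simp add: P_def algebra_simps)
    finally have "ennreal (norm (inv_ft Q ((s + x) *\<^sub>R e1 + t *\<^sub>R e2) - inv_ft Q ((s - x) *\<^sub>R e1 + t *\<^sub>R e2))) \<le>
      (\<integral>\<^sup>+r. ennreal (norm (indicator {-x..x} r *\<^sub>R (inv_ft Ql (P (r + s, t)) + inv_ft Qh (P (r + s, t))))) \<partial>lborel)"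
      by (simp only: norm_integral_le_nn_integral)
    also have "\<dots> \<le> (\<integral>\<^sup>+r. indicator {-x..x} r * (ennreal (A + 1 / (2 * \<beta>)) + ennreal (\<beta> / 2) * ennreal ((norm (inv_ft Qh (P (r + s, t))))\<^sup>2)) \<partial>lborel)"
    proof (rule nn_integral_mono)
      fix r
      define y where "y = norm (inv_ft Qh (P (r + s, t)))"
      \<comment> \<open>Young's inequality replaces Cauchy-Schwarz in passing from
        \<open>L^2\<close> to \<open>L^1\<close>; the free weight \<open>\<beta>\<close> is chosen
        of size \<open>sqrt x\<close> by the caller.\<close>
      have "y \<le> 1 / (2 * \<beta>) + \<beta> / 2 * y\<^sup>2"
      proof -
        have "0 \<le> (\<beta> * y - 1)\<^sup>2" by simp
        also have "\<dots> = 2 * \<beta> * (1 / (2 * \<beta>) + \<beta> / 2 * y\<^sup>2 - y)"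
          using \<open>\<beta> > 0\<close> by (simp add: field_simps power2_eq_square)
        finally show ?thesis using \<open>\<beta> > 0\<close> by (simp add: zero_le_mult_iff)
      qed
      then have "norm (inv_ft Ql (P (r + s, t)) + inv_ft Qh (P (r + s, t))) \<le> (A + 1 / (2 * \<beta>)) + \<beta> / 2 * y\<^sup>2"
        using norm_triangle_ineq[of "inv_ft Ql (P (r + s, t))" "inv_ft Qh (P (r + s, t))"] ql[of "P (r + s, t)"]
        unfolding y_def by linarith
      then have "ennreal (norm (inv_ft Ql (P (r + s, t)) + inv_ft Qh (P (r + s, t)))) \<le> ennreal ((A + 1 / (2 * \<beta>)) + \<beta> / 2 * y\<^sup>2)"
        by (rule ennreal_leI)
      also have "\<dots> = ennreal (A + 1 / (2 * \<beta>)) + ennreal (\<beta> / 2) * ennreal (y\<^sup>2)"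
        using \<open>A \<ge> 0\<close> \<open>\<beta> > 0\<close> by (simp add: ennreal_plus[symmetric] ennreal_mult[symmetric] del: ennreal_plus)
      finally show "ennreal (norm (indicator {-x..x} r *\<^sub>R (inv_ft Ql (P (r + s, t)) + inv_ft Qh (P (r + s, t))))) \<le>
        indicator {-x..x} r * (ennreal (A + 1 / (2 * \<beta>)) + ennreal (\<beta> / 2) * ennreal ((norm (inv_ft Qh (P (r + s, t))))\<^sup>2))"
        unfolding y_def by (auto split: split_indicator)
    qed
    finally show ?thesis .
  qed
  have "(\<integral>\<^sup>+t. ennreal (indicator {-1..1} t * norm (inv_ft Q ((s + x) *\<^sub>R e1 + t *\<^sub>R e2) - inv_ft Q ((s - x) *\<^sub>R e1 + t *\<^sub>R e2))) \<partial>lborel)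
    \<le> (\<integral>\<^sup>+t. indicator {-1..1} t * (\<integral>\<^sup>+r. indicator {-x..x} r * (ennreal (A + 1 / (2 * \<beta>)) + ennreal (\<beta> / 2) * ennreal ((norm (inv_ft Qh (P (r + s, t))))\<^sup>2)) \<partial>lborel) \<partial>lborel)"
    by (intro nn_integral_mono) (use incr in \<open>auto split: split_indicator\<close>)
  \<comment> \<open>The quadratic part is integrated over all \<open>r\<close> and \<open>t\<close>,
    which removes the shift by \<open>s\<close>: the bound is the same for all lines. The constant
    part lives on a rectangle with sides 2 and \<open>2 * x\<close>, giving
    \<open>4 * x * A + 2 * x / \<beta>\<close>.\<close>
  also have "\<dots> \<le> (\<integral>\<^sup>+t. indicator {-1..1} t * (ennreal (A + 1 / (2 * \<beta>)) * ennreal (2 * x)) + ennreal (\<beta> / 2) * (\<integral>\<^sup>+r. ennreal ((norm (inv_ft Qh (P (r, t))))\<^sup>2) \<partial>lborel) \<partial>lborel)"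
  proof (intro nn_integral_mono)
    fix t
    have "(\<integral>\<^sup>+r. indicator {-x..x} r * (ennreal (A + 1 / (2 * \<beta>)) + ennreal (\<beta> / 2) * ennreal ((norm (inv_ft Qh (P (r + s, t))))\<^sup>2)) \<partial>lborel)
      \<le> (\<integral>\<^sup>+r. ennreal (A + 1 / (2 * \<beta>)) * indicator {-x..x} r + ennreal (\<beta> / 2) * ennreal ((norm (inv_ft Qh (P (r + s, t))))\<^sup>2) \<partial>lborel)"
      by (intro nn_integral_mono) (auto split: split_indicator)
    also have "\<dots> = ennreal (A + 1 / (2 * \<beta>)) * ennreal (2 * x) + ennreal (\<beta> / 2) * (\<integral>\<^sup>+r. ennreal ((norm (inv_ft Qh (P (r + s, t))))\<^sup>2) \<partial>lborel)"
      using \<open>x \<ge> 0\<close> by (subst nn_integral_add) (simp_all add: nn_integral_cmult nn_integral_cmult_indicator)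
    also have "(\<integral>\<^sup>+r. ennreal ((norm (inv_ft Qh (P (r + s, t))))\<^sup>2) \<partial>lborel) = (\<integral>\<^sup>+r. ennreal ((norm (inv_ft Qh (P (r, t))))\<^sup>2) \<partial>lborel)"
      by (rule nn_integral_lborel_shift(1)[of "\<lambda>r. ennreal ((norm (inv_ft Qh (P (r, t))))\<^sup>2)"]) measurable
    finally show "indicator {-1..1} t * (\<integral>\<^sup>+r. indicator {-x..x} r * (ennreal (A + 1 / (2 * \<beta>)) + ennreal (\<beta> / 2) * ennreal ((norm (inv_ft Qh (P (r + s, t))))\<^sup>2)) \<partial>lborel)
      \<le> indicator {-1..1} t * (ennreal (A + 1 / (2 * \<beta>)) * ennreal (2 * x)) + ennreal (\<beta> / 2) * (\<integral>\<^sup>+r. ennreal ((norm (inv_ft Qh (P (r, t))))\<^sup>2) \<partial>lborel)"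
      by (auto split: split_indicator)
  qed
  also have "\<dots> = ennreal (A + 1 / (2 * \<beta>)) * ennreal (2 * x) * 2 + ennreal (\<beta> / 2) * (\<integral>\<^sup>+t. (\<integral>\<^sup>+r. ennreal ((norm (inv_ft Qh (P (r, t))))\<^sup>2) \<partial>lborel) \<partial>lborel)"
    by (subst nn_integral_add) (simp_all add: nn_integral_cmult nn_integral_multc mult.commute)
  also have "(\<integral>\<^sup>+t. (\<integral>\<^sup>+r. ennreal ((norm (inv_ft Qh (P (r, t))))\<^sup>2) \<partial>lborel) \<partial>lborel) = (\<integral>\<^sup>+p. ennreal ((norm (inv_ft Qh (P p)))\<^sup>2) \<partial>lborel)"
    by (subst lborel_pair.nn_integral_snd) (simp_all add: lborel_prod)
  also have "ennreal (A + 1 / (2 * \<beta>)) * ennreal (2 * x) * 2 + ennreal (\<beta> / 2) * (\<integral>\<^sup>+p. ennreal ((norm (inv_ft Qh (P p)))\<^sup>2) \<partial>lborel)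
    \<le> ennreal (A + 1 / (2 * \<beta>)) * ennreal (2 * x) * ennreal 2 + ennreal (\<beta> / 2) * ennreal ((2 * pi)\<^sup>2 * E)"
    using qh by (intro add_mono mult_left_mono) auto
  also have "\<dots> = ennreal (4 * x * A + 2 * x / \<beta>) + ennreal (\<beta> / 2 * ((2 * pi)\<^sup>2 * E))"
  proof -
    have "4 * x * A + 2 * x / \<beta> = (A + 1 / (2 * \<beta>)) * (2 * x) * 2"
      using \<open>\<beta> > 0\<close> by (simp add: field_simps)
    moreover have "0 \<le> A + 1 / (2 * \<beta>)" "0 \<le> (A + 1 / (2 * \<beta>)) * (2 * x)"
      using \<open>A \<ge> 0\<close> \<open>\<beta> > 0\<close> \<open>x \<ge> 0\<close> by auto
    moreover have "ennreal (\<beta> / 2 * ((2 * pi)\<^sup>2 * E)) = ennreal (\<beta> / 2) * ennreal ((2 * pi)\<^sup>2 * E)"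
      using \<open>\<beta> > 0\<close> by (intro ennreal_mult') auto
    ultimately show ?thesis
      using \<open>x \<ge> 0\<close> by (simp only: ennreal_mult)
  qed
  also have "\<dots> = ennreal (4 * x * A + 2 * x / \<beta> + \<beta> / 2 * ((2 * pi)\<^sup>2 * E))"
  proof -
    have "0 \<le> (\<integral>\<xi>. indicator (- cball 0 N) \<xi> * (norm \<xi> * norm (Q \<xi>))\<^sup>2 \<partial>lborel)"
      by (intro integral_nonneg_AE) auto
    then have "E \<ge> 0" using high by linarith
    then show ?thesis
      using \<open>A \<ge> 0\<close> \<open>\<beta> > 0\<close> \<open>x \<ge> 0\<close> by (subst ennreal_plus) auto
  qed
  finally show ?thesis .
qed

section \<open>Convolution with the kernel along parallel lines\<close>

text \<open>On the Fourier side the normal derivative of \<open>k * V\<close> is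
  \<open>\<xi>\<close> times the transforms of \<open>k\<close> and \<open>V\<close>. The transform
  of \<open>V\<close> is in \<open>L^2\<close>, and \<open>\<xi> F \<xi>\<close> tends to 0 because
  \<open>lam > 1\<close>. Frequencies up to \<open>N\<close> contribute \<open>O(x)\<close> to the
  increment; those beyond contribute \<open>sqrt x\<close> times a factor made small by the choice
  of \<open>N\<close>. The threshold is uniform in \<open>s\<close>.\<close>

lemma smoothing_gain:
  fixes k0 k V :: "real^2 \<Rightarrow> real"
  assumes H: "in_H lam \<infinity> (distribution_of (\<lambda>x. complex_of_real (k0 x)))" and lam: "lam > 1"
    and k: "integrable lborel k" "AE x in lborel. k0 x = k x"
    and e: "\<And>v. (v \<bullet> e1)\<^sup>2 + (v \<bullet> e2)\<^sup>2 = (norm v)\<^sup>2"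
    and V: "integrable lborel V" "\<And>x. \<bar>V x\<bar> \<le> B" "AE y in lborel. isCont V y"
    and \<epsilon>: "\<epsilon> > 0"
  defines "g \<equiv> \<lambda>z. \<integral>x. k x * V (z - x) \<partial>lborel"
  shows "\<exists>x1>0. \<forall>x s. 0 < x \<and> x < x1 \<longrightarrow>
    (\<integral>\<^sup>+t. ennreal (indicator {-1..1} t * \<bar>g ((s + x) *\<^sub>R e1 + t *\<^sub>R e2) - g ((s - x) *\<^sub>R e1 + t *\<^sub>R e2)\<bar>) \<partial>lborel)
    \<le> ennreal (\<epsilon> * sqrt x)"
proof -
  note [measurable] = borel_measurable_integrable[OF k(1)] borel_measurable_integrable[OF V(1)]
  obtain F C where F [measurable]: "F \<in> borel_measurable borel" and "C \<ge> 0"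
    and FC: "\<And>\<xi>. norm (F \<xi>) * (1 + (norm \<xi>)\<^sup>2) powr (lam / 2) \<le> C"
    and FT: "\<And>m z. m > 0 \<Longrightarrow> complex_of_real ((2 * pi) ^ DIM(real^2) * (\<integral>x. k x * heat_kernel m (x - z) \<partial>lborel)) =
      (\<integral>\<xi>. F \<xi> * gauss_wave (1 / m) z \<xi> \<partial>lborel)"
    using in_H_infinity_representation[OF H k] by blast
  have F1: "norm (F \<xi>) * sqrt (1 + (norm \<xi>)\<^sup>2) \<le> C" for \<xi>
  proof -
    have "(1 + (norm \<xi>)\<^sup>2) powr (1 / 2) \<le> (1 + (norm \<xi>)\<^sup>2) powr (lam / 2)"
      using lam by (intro powr_mono) auto
    then have "norm (F \<xi>) * sqrt (1 + (norm \<xi>)\<^sup>2) \<le> norm (F \<xi>) * (1 + (norm \<xi>)\<^sup>2) powr (lam / 2)"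
      by (intro mult_left_mono) (auto simp: powr_half_sqrt)
    then show ?thesis using FC[of \<xi>] by linarith
  qed
  have F2: "norm (F \<xi>) \<le> C" for \<xi>
    using F1[of \<xi>] mult_left_mono[of 1 "sqrt (1 + (norm \<xi>)\<^sup>2)" "norm (F \<xi>)"] by simp
  have F3: "norm \<xi> * norm (F \<xi>) \<le> C" for \<xi>
    using F1[of \<xi>] mult_left_mono[of "norm \<xi>" "sqrt (1 + (norm \<xi>)\<^sup>2)" "norm (F \<xi>)"]
    by (simp add: real_le_rsqrt mult.commute)
  have F4: "(norm \<xi> * norm (F \<xi>))\<^sup>2 \<le> C\<^sup>2 * (1 + N\<^sup>2) powr (1 - lam)" if "norm \<xi> > N" "N \<ge> 0" for N \<xi>
  proof -
    define y where "y = 1 + (norm \<xi>)\<^sup>2"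
    have y: "y \<ge> 1 + N\<^sup>2" "(norm \<xi>)\<^sup>2 \<le> y" "y \<ge> 1" using that by (auto simp: y_def)
    then have "y > 0" by linarith
    have "(norm (F \<xi>))\<^sup>2 * y powr lam = (norm (F \<xi>) * y powr (lam / 2))\<^sup>2"
      by (simp add: power_mult_distrib power2_eq_square powr_add[symmetric])
    also have "\<dots> \<le> C\<^sup>2" unfolding y_def by (intro power_mono FC) simp
    finally have *: "(norm (F \<xi>))\<^sup>2 * y powr lam \<le> C\<^sup>2" .
    have "(norm \<xi> * norm (F \<xi>))\<^sup>2 \<le> y * (norm (F \<xi>))\<^sup>2"
      unfolding power_mult_distrib using y by (intro mult_right_mono) auto
    also have "\<dots> = (norm (F \<xi>))\<^sup>2 * y powr lam * y powr (1 - lam)"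
      using \<open>y > 0\<close> by (simp add: powr_diff)
    also have "\<dots> \<le> C\<^sup>2 * y powr (1 - lam)"
      by (intro mult_right_mono *) auto
    also have "\<dots> \<le> C\<^sup>2 * (1 + N\<^sup>2) powr (1 - lam)"
      using y lam by (intro mult_left_mono powr_mono2') (auto simp: add_pos_nonneg)
    finally show ?thesis .
  qed
  \<comment> \<open>The sign of the argument makes this the forward transform of
    \<open>V\<close>.\<close>
  define Vh where "Vh \<xi> = inv_ft (\<lambda>y. complex_of_real (V y)) (- \<xi>)" for \<xi>
  define V1 where "V1 = (\<integral>y. \<bar>V y\<bar> \<partial>lborel)"
  have [measurable]: "Vh \<in> borel_measurable borel"
    unfolding Vh_def by measurable
  have Vh: "norm (Vh \<xi>) \<le> V1" for \<xi>
    unfolding Vh_def V1_def by (rule order_trans[OF norm_inv_ft_le]) simp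
  then have "V1 \<ge> 0" using norm_ge_zero order_trans by blast
  have "B \<ge> 0" using V(2)[of 0] by linarith
  have V2: "integrable lborel (\<lambda>y. (norm (complex_of_real (V y)))\<^sup>2)"
  proof (rule Bochner_Integration.integrable_bound)
    show "integrable lborel (\<lambda>y. B * \<bar>V y\<bar>)" using V(1) by simp
    have "(norm (complex_of_real (V y)))\<^sup>2 \<le> B * \<bar>V y\<bar>" for y
      unfolding norm_of_real power2_eq_square by (intro mult_right_mono V(2)) simp
    then show "AE y in lborel. norm ((norm (complex_of_real (V y)))\<^sup>2) \<le> norm (B * \<bar>V y\<bar>)"
      using \<open>B \<ge> 0\<close> by (intro AE_I2) simp
  qed simp
  have Vh2: "integrable lborel (\<lambda>\<xi>. (norm (Vh \<xi>))\<^sup>2)"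
  proof (rule integrableI_bounded)
    have "(\<integral>\<^sup>+\<xi>. ennreal ((norm (Vh \<xi>))\<^sup>2) \<partial>lborel) \<le> ennreal ((2 * pi) ^ DIM(real^2) * (\<integral>y. (norm (complex_of_real (V y)))\<^sup>2 \<partial>lborel))"
      unfolding Vh_def inv_ft_def
      by (rule fourier_L2_bound[where L=uminus and M=uminus]) (use V(1) V2 in \<open>auto simp: inner_commute\<close>)
    also have "\<dots> < \<infinity>" by simp
    finally show "(\<integral>\<^sup>+\<xi>. ennreal (norm ((norm (Vh \<xi>))\<^sup>2)) \<partial>lborel) < \<infinity>" by simp
  qed measurable
  \<comment> \<open>The Gaussian damping makes \<open>Q m\<close> integrable. The bounds that enter
    the estimate must not depend on \<open>m\<close>, hence the separate bounds \<open>nQ1\<close>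
    and \<open>nQ2\<close>, where the damping is estimated by 1.\<close>
  define Q where "Q m \<xi> = F \<xi> * Vh \<xi> * complex_of_real (gaussian (1 / m) \<xi>) / complex_of_real ((2 * pi)\<^sup>2)" for m \<xi>
  have [measurable]: "Q m \<in> borel_measurable borel" for m unfolding Q_def by measurable
  define gm where "gm m z = (\<integral>y. V y * (\<integral>x. k x * heat_kernel m (x - (z - y)) \<partial>lborel) \<partial>lborel)" for m z
  have pi1: "1 \<le> (2 * pi)\<^sup>2"
    using pi_gt3 by (intro one_le_power) linarith
  have nQ: "norm (Q m \<xi>) \<le> norm (F \<xi>) * norm (Vh \<xi>) * gaussian (1 / m) \<xi>" if "m > 0" for m \<xi>
  proof -
    have "norm (Q m \<xi>) = norm (F \<xi>) * norm (Vh \<xi>) * gaussian (1 / m) \<xi> / (2 * pi)\<^sup>2"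
      by (simp add: Q_def norm_mult norm_divide norm_power)
    also have "\<dots> \<le> norm (F \<xi>) * norm (Vh \<xi>) * gaussian (1 / m) \<xi> / 1"
      by (intro divide_left_mono pi1) auto
    finally show ?thesis by simp
  qed
  have nQ1: "norm \<xi> * norm (Q m \<xi>) \<le> (norm \<xi> * norm (F \<xi>)) * norm (Vh \<xi>)" if "m > 0" for m \<xi>
  proof -
    have "norm \<xi> * norm (Q m \<xi>) \<le> norm \<xi> * (norm (F \<xi>) * norm (Vh \<xi>) * gaussian (1 / m) \<xi>)"
      using nQ[OF that] by (intro mult_left_mono) auto
    also have "\<dots> \<le> norm \<xi> * (norm (F \<xi>) * norm (Vh \<xi>) * 1)"
      using that by (intro mult_left_mono gaussian_le_1) auto
    finally show ?thesis by (simp add: mult.assoc)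
  qed
  have iQ: "integrable lborel (Q m)" if "m > 0" for m
  proof (rule Bochner_Integration.integrable_bound)
    show "integrable lborel (\<lambda>\<xi>::real^2. C * V1 * gaussian (1 / m) \<xi>)"
      using that by (intro integrable_mult_right integrable_gaussian) auto
    show "AE \<xi> in lborel. norm (Q m \<xi>) \<le> norm (C * V1 * gaussian (1 / m) \<xi>)"
    proof (intro AE_I2)
      fix \<xi> :: "real^2"
      have "norm (F \<xi>) * norm (Vh \<xi>) * gaussian (1 / m) \<xi> \<le> C * V1 * gaussian (1 / m) \<xi>"
        using F2 Vh \<open>C \<ge> 0\<close> by (intro mult_right_mono mult_mono) auto
      with nQ[OF that, of \<xi>] have "norm (Q m \<xi>) \<le> C * V1 * gaussian (1 / m) \<xi>" by (rule order_trans)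
      then show "norm (Q m \<xi>) \<le> norm (C * V1 * gaussian (1 / m) \<xi>)"
        using \<open>C \<ge> 0\<close> \<open>V1 \<ge> 0\<close> by (simp add: abs_mult)
    qed
  qed simp
  have iQ1: "integrable lborel (\<lambda>\<xi>. norm \<xi> * norm (Q m \<xi>))" if "m > 0" for m
  proof (rule Bochner_Integration.integrable_bound)
    show "integrable lborel (\<lambda>\<xi>::real^2. C * V1 * gaussian (1 / m) \<xi>)"
      using that by (intro integrable_mult_right integrable_gaussian) auto
    show "AE \<xi> in lborel. norm (norm \<xi> * norm (Q m \<xi>)) \<le> norm (C * V1 * gaussian (1 / m) \<xi>)"
    proof (intro AE_I2)
      fix \<xi> :: "real^2"
      have "norm \<xi> * norm (Q m \<xi>) \<le> norm \<xi> * (norm (F \<xi>) * norm (Vh \<xi>) * gaussian (1 / m) \<xi>)"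
        using nQ[OF that] by (intro mult_left_mono) auto
      also have "\<dots> = (norm \<xi> * norm (F \<xi>)) * norm (Vh \<xi>) * gaussian (1 / m) \<xi>" by simp
      also have "\<dots> \<le> C * V1 * gaussian (1 / m) \<xi>"
        using F3 Vh \<open>C \<ge> 0\<close> by (intro mult_right_mono mult_mono) auto
      finally show "norm (norm \<xi> * norm (Q m \<xi>)) \<le> norm (C * V1 * gaussian (1 / m) \<xi>)"
        using \<open>C \<ge> 0\<close> \<open>V1 \<ge> 0\<close> by (simp add: abs_mult)
    qed
  qed simp
  have nQ2: "(norm \<xi> * norm (Q m \<xi>))\<^sup>2 \<le> (norm \<xi> * norm (F \<xi>))\<^sup>2 * (norm (Vh \<xi>))\<^sup>2" if "m > 0" for m \<xi>
    using power_mono[OF nQ1[OF that, of \<xi>], of 2] by (simp add: power_mult_distrib)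
  have iQ2: "integrable lborel (\<lambda>\<xi>. (norm \<xi> * norm (Q m \<xi>))\<^sup>2)" if "m > 0" for m
  proof (rule Bochner_Integration.integrable_bound)
    show "integrable lborel (\<lambda>\<xi>. C\<^sup>2 * (norm (Vh \<xi>))\<^sup>2)" using Vh2 by simp
    have "(norm \<xi> * norm (F \<xi>))\<^sup>2 * (norm (Vh \<xi>))\<^sup>2 \<le> C\<^sup>2 * (norm (Vh \<xi>))\<^sup>2" for \<xi>
      using F3 by (intro mult_right_mono power_mono) auto
    then show "AE \<xi> in lborel. norm ((norm \<xi> * norm (Q m \<xi>))\<^sup>2) \<le> norm (C\<^sup>2 * (norm (Vh \<xi>))\<^sup>2)"
      using nQ2[OF that] by (intro AE_I2) (auto intro: order_trans)
  qed simp
  have gm: "complex_of_real (gm m z) = inv_ft (Q m) z" if "m > 0" for m z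
  proof -
    have w: "gauss_wave (1 / m) (z - y) \<xi> = exp (\<i> * complex_of_real (- \<xi> \<bullet> y)) * (exp (\<i> * complex_of_real (z \<bullet> \<xi>)) * complex_of_real (gaussian (1 / m) \<xi>))" for y \<xi>
      unfolding gauss_wave_def mult.assoc[symmetric] mult_exp_exp
      by (simp add: inner_diff_left inner_commute algebra_simps)
    have "complex_of_real ((2 * pi) ^ DIM(real^2) * gm m z) = (\<integral>y. complex_of_real (V y * ((2 * pi) ^ DIM(real^2) * (\<integral>x. k x * heat_kernel m (x - (z - y)) \<partial>lborel))) \<partial>lborel)"
      unfolding gm_def integral_complex_of_real by (simp add: mult.left_commute[of "V _"])
    also have "\<dots> = (\<integral>y. (\<integral>\<xi>. complex_of_real (V y) * (F \<xi> * gauss_wave (1 / m) (z - y) \<xi>) \<partial>lborel) \<partial>lborel)"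
      by (subst of_real_mult) (simp only: FT[OF that] integral_mult_right_zero)
    also have "\<dots> = (\<integral>\<xi>. (\<integral>y. complex_of_real (V y) * (F \<xi> * gauss_wave (1 / m) (z - y) \<xi>) \<partial>lborel) \<partial>lborel)"
    proof (rule Fubini_bound[where g="\<lambda>y. \<bar>V y\<bar>" and h="\<lambda>\<xi>. C * gaussian (1 / m) \<xi>"])
      show "(\<lambda>(y, \<xi>). complex_of_real (V y) * (F \<xi> * gauss_wave (1 / m) (z - y) \<xi>)) \<in> borel_measurable (lborel \<Otimes>\<^sub>M lborel)"
        unfolding gauss_wave_def by measurable
      show "norm (complex_of_real (V y) * (F \<xi> * gauss_wave (1 / m) (z - y) \<xi>)) \<le> \<bar>V y\<bar> * (C * gaussian (1 / m) \<xi>)" for y \<xi>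
        using F2 by (auto simp: norm_mult intro!: mult_left_mono mult_right_mono)
      show "integrable lborel (\<lambda>\<xi>::real^2. C * gaussian (1 / m) \<xi>)"
        using that by (intro integrable_mult_right integrable_gaussian) auto
    qed (use V in auto)
    also have "\<dots> = (\<integral>\<xi>. complex_of_real ((2 * pi)\<^sup>2) * (exp (\<i> * complex_of_real (z \<bullet> \<xi>)) * Q m \<xi>) \<partial>lborel)"
    proof (intro Bochner_Integration.integral_cong refl)
      fix \<xi> :: "real^2"
      have "(\<integral>y. complex_of_real (V y) * (F \<xi> * gauss_wave (1 / m) (z - y) \<xi>) \<partial>lborel) =
        (\<integral>y. (F \<xi> * (exp (\<i> * complex_of_real (z \<bullet> \<xi>)) * complex_of_real (gaussian (1 / m) \<xi>))) * (exp (\<i> * complex_of_real (- \<xi> \<bullet> y)) * complex_of_real (V y)) \<partial>lborel)"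
        unfolding w by (simp only: mult_ac)
      also have "\<dots> = (F \<xi> * (exp (\<i> * complex_of_real (z \<bullet> \<xi>)) * complex_of_real (gaussian (1 / m) \<xi>))) * Vh \<xi>"
        unfolding Vh_def inv_ft_def by (rule integral_mult_right_zero)
      finally show "(\<integral>y. complex_of_real (V y) * (F \<xi> * gauss_wave (1 / m) (z - y) \<xi>) \<partial>lborel) =
        complex_of_real ((2 * pi)\<^sup>2) * (exp (\<i> * complex_of_real (z \<bullet> \<xi>)) * Q m \<xi>)"
        unfolding Q_def by (simp add: mult_ac)
    qed
    finally have "complex_of_real ((2 * pi)\<^sup>2) * complex_of_real (gm m z) = complex_of_real ((2 * pi)\<^sup>2) * inv_ft (Q m) z"
      by (simp add: inv_ft_def)
    then show ?thesis by (simp only: mult_cancel_left) simp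
  qed
  define W where "W = (\<integral>\<xi>. (norm (Vh \<xi>))\<^sup>2 \<partial>lborel)"
  have "((\<lambda>N::real. C\<^sup>2 * (1 + N\<^sup>2) powr (1 - lam) * W) \<longlongrightarrow> C\<^sup>2 * 0 * W) at_top"
  proof (intro tendsto_mult tendsto_const tendsto_neg_powr)
    show "filterlim (\<lambda>N::real. 1 + N\<^sup>2) at_top at_top"
      by (intro filterlim_tendsto_add_at_top[OF tendsto_const] filterlim_pow_at_top filterlim_ident) auto
  qed (use lam in auto)
  \<comment> \<open>The threshold is what the high-frequency term with the later choice of
    \<open>\<beta>\<close> needs in order to stay below
    \<open>\<epsilon> / 4 * sqrt x\<close>.\<close>
  then have "\<forall>\<^sub>F N::real in at_top. C\<^sup>2 * (1 + N\<^sup>2) powr (1 - lam) * W < \<epsilon>\<^sup>2 / (16 * (2 * pi)\<^sup>2)"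
    by (rule order_tendstoD) (use \<epsilon> in auto)
  then obtain N :: real where "N \<ge> 0" and N: "C\<^sup>2 * (1 + N\<^sup>2) powr (1 - lam) * W < \<epsilon>\<^sup>2 / (16 * (2 * pi)\<^sup>2)"
    by (metis (mono_tags, lifting) eventually_at_top_linorder linear order_refl)
  define A where "A = C * V1 * measure lborel (cball 0 N :: (real^2) set)"
  define E where "E = C\<^sup>2 * (1 + N\<^sup>2) powr (1 - lam) * W"
  have "A \<ge> 0" using \<open>C \<ge> 0\<close> \<open>V1 \<ge> 0\<close> by (simp add: A_def)
  have low: "(\<integral>\<xi>. indicator (cball 0 N) \<xi> * (norm \<xi> * norm (Q m \<xi>)) \<partial>lborel) \<le> A" if "m > 0" for m
  proof -
    have fin: "integrable lborel (indicat_real (cball (0::real^2) N))"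
      by (rule integrable_real_indicator) (use emeasure_bounded_finite[of "cball (0::real^2) N"] in auto)
    have "(\<integral>\<xi>. indicator (cball 0 N) \<xi> * (norm \<xi> * norm (Q m \<xi>)) \<partial>lborel) \<le> (\<integral>\<xi>. C * V1 * indicator (cball 0 N) \<xi> \<partial>(lborel :: (real^2) measure))"
    proof (rule integral_mono)
      show "integrable lborel (\<lambda>\<xi>. indicator (cball 0 N) \<xi> * (norm \<xi> * norm (Q m \<xi>)))"
        using integrable_mult_indicator[OF _ iQ1[OF that], of "cball 0 N"] by simp
      show "integrable lborel (\<lambda>\<xi>::real^2. C * V1 * indicator (cball 0 N) \<xi>)"
        using fin by (rule integrable_mult_right)
      fix \<xi> :: "real^2"
      have "norm \<xi> * norm (Q m \<xi>) \<le> C * V1"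
        using nQ1[OF that, of \<xi>] mult_mono[OF F3[of \<xi>] Vh[of \<xi>] \<open>C \<ge> 0\<close> norm_ge_zero] by linarith
      then show "indicator (cball 0 N) \<xi> * (norm \<xi> * norm (Q m \<xi>)) \<le> C * V1 * indicator (cball 0 N) \<xi>"
        by (auto split: split_indicator)
    qed
    also have "\<dots> = A" by (simp add: A_def)
    finally show ?thesis .
  qed
  have high: "(\<integral>\<xi>. indicator (- cball 0 N) \<xi> * (norm \<xi> * norm (Q m \<xi>))\<^sup>2 \<partial>lborel) \<le> E" if "m > 0" for m
  proof -
    have "(\<integral>\<xi>. indicator (- cball 0 N) \<xi> * (norm \<xi> * norm (Q m \<xi>))\<^sup>2 \<partial>lborel) \<le> (\<integral>\<xi>. C\<^sup>2 * (1 + N\<^sup>2) powr (1 - lam) * (norm (Vh \<xi>))\<^sup>2 \<partial>lborel)"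
    proof (rule integral_mono)
      show "integrable lborel (\<lambda>\<xi>. indicator (- cball 0 N) \<xi> * (norm \<xi> * norm (Q m \<xi>))\<^sup>2)"
        using integrable_mult_indicator[OF _ iQ2[OF that], of "- cball 0 N"] by simp
      show "integrable lborel (\<lambda>\<xi>. C\<^sup>2 * (1 + N\<^sup>2) powr (1 - lam) * (norm (Vh \<xi>))\<^sup>2)"
        using Vh2 by simp
      fix \<xi> :: "real^2"
      have "(norm \<xi> * norm (Q m \<xi>))\<^sup>2 \<le> C\<^sup>2 * (1 + N\<^sup>2) powr (1 - lam) * (norm (Vh \<xi>))\<^sup>2" if "norm \<xi> > N"
        using nQ2[OF \<open>m > 0\<close>, of \<xi>] mult_right_mono[OF F4[OF that \<open>N \<ge> 0\<close>], of "(norm (Vh \<xi>))\<^sup>2"] by simp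
      then show "indicator (- cball 0 N) \<xi> * (norm \<xi> * norm (Q m \<xi>))\<^sup>2 \<le> C\<^sup>2 * (1 + N\<^sup>2) powr (1 - lam) * (norm (Vh \<xi>))\<^sup>2"
        by (auto split: split_indicator)
    qed
    also have "\<dots> = E" by (simp add: E_def W_def)
    finally show ?thesis .
  qed
  \<comment> \<open>Below this value the low-frequency term \<open>4 * x * A\<close> is at most
    \<open>\<epsilon> / 4 * sqrt x\<close>; the 1 added to \<open>A\<close> avoids division by
    0.\<close>
  define x1 where "x1 = (\<epsilon> / (16 * (A + 1)))\<^sup>2"
  have "x1 > 0" using \<epsilon> \<open>A \<ge> 0\<close> by (simp add: x1_def)
  moreover have "(\<integral>\<^sup>+t. ennreal (indicator {-1..1} t * \<bar>g ((s + x) *\<^sub>R e1 + t *\<^sub>R e2) - g ((s - x) *\<^sub>R e1 + t *\<^sub>R e2)\<bar>) \<partial>lborel)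
      \<le> ennreal (\<epsilon> * sqrt x)" if x: "0 < x" "x < x1" for x s
  proof -
    \<comment> \<open>Of size \<open>sqrt x\<close>, which balances \<open>2 * x / \<beta>\<close>
      against \<open>\<beta>\<close> times the high-frequency energy; each of the three terms is
      then at most \<open>\<epsilon> / 4 * sqrt x\<close>.\<close>
    define \<beta> where "\<beta> = 8 * sqrt x / \<epsilon>"
    have "\<beta> > 0" using x \<epsilon> by (simp add: \<beta>_def)
    have sx: "sqrt x * sqrt x = x" using x by simp
    have "sqrt x \<le> \<epsilon> / (16 * (A + 1))"
      using x(2) \<epsilon> \<open>A \<ge> 0\<close> unfolding x1_def by (intro real_le_lsqrt) auto
    then have "16 * (A + 1) * sqrt x \<le> \<epsilon>" using \<open>A \<ge> 0\<close> by (simp add: field_simps)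
    then have "16 * A * sqrt x \<le> \<epsilon>" using x by (simp add: algebra_simps) (smt (verit) real_sqrt_gt_zero)
    then have b1: "4 * x * A \<le> \<epsilon> / 4 * sqrt x"
    proof -
      have "16 * A * sqrt x * (sqrt x / 4) \<le> \<epsilon> * (sqrt x / 4)"
        using \<open>16 * A * sqrt x \<le> \<epsilon>\<close> x by (intro mult_right_mono) auto
      moreover have "16 * A * sqrt x * (sqrt x / 4) = 4 * (sqrt x * sqrt x) * A" by simp
      ultimately show ?thesis unfolding sx by linarith
    qed
    have b2: "2 * x / \<beta> = \<epsilon> / 4 * sqrt x"
      using x \<epsilon> sx by (simp add: \<beta>_def field_simps)
    have "\<beta> / 2 * ((2 * pi)\<^sup>2 * E) \<le> \<beta> / 2 * ((2 * pi)\<^sup>2 * (\<epsilon>\<^sup>2 / (16 * (2 * pi)\<^sup>2)))"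
      using N \<open>\<beta> > 0\<close> unfolding E_def[symmetric] by (intro mult_left_mono) auto
    also have "\<dots> = \<epsilon> / 4 * sqrt x" using \<epsilon> by (simp add: \<beta>_def power2_eq_square)
    finally have "\<beta> / 2 * ((2 * pi)\<^sup>2 * E) \<le> \<epsilon> / 4 * sqrt x" .
    then have b: "4 * x * A + 2 * x / \<beta> + \<beta> / 2 * ((2 * pi)\<^sup>2 * E) \<le> \<epsilon> * sqrt x"
    proof -
      have "0 \<le> \<epsilon> * sqrt x" using \<epsilon> x by simp
      moreover have "\<epsilon> / 4 * sqrt x = \<epsilon> * sqrt x / 4" by simp
      ultimately show ?thesis
        using b1 b2 \<open>\<beta> / 2 * ((2 * pi)\<^sup>2 * E) \<le> \<epsilon> / 4 * sqrt x\<close> by linarith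
    qed
    define m where "m n = real (Suc n)" for n
    define D where "D n t = ennreal (indicator {-1..1} t * \<bar>gm (m n) ((s + x) *\<^sub>R e1 + t *\<^sub>R e2) - gm (m n) ((s - x) *\<^sub>R e1 + t *\<^sub>R e2)\<bar>)" for n t
    have "gm m \<in> borel_measurable borel" for m
      unfolding gm_def by measurable
    then have [measurable]: "(\<lambda>t. gm m (v + t *\<^sub>R e2)) \<in> borel_measurable borel" for m v
      by (rule measurable_compose[rotated]) measurable
    have [measurable]: "D n \<in> borel_measurable borel" for n unfolding D_def by measurable
    have Dn: "(\<integral>\<^sup>+t. D n t \<partial>lborel) \<le> ennreal (\<epsilon> * sqrt x)" for n
    proof -
      have m: "m n > 0" by (simp add: m_def)
      have eq: "D n t = ennreal (indicator {-1..1} t * norm (inv_ft (Q (m n)) ((s + x) *\<^sub>R e1 + t *\<^sub>R e2) - inv_ft (Q (m n)) ((s - x) *\<^sub>R e1 + t *\<^sub>R e2)))" for t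
        unfolding D_def gm[OF m, symmetric] of_real_diff[symmetric] norm_of_real ..
      have "(\<integral>\<^sup>+t. D n t \<partial>lborel) \<le> ennreal (4 * x * A + 2 * x / \<beta> + \<beta> / 2 * ((2 * pi)\<^sup>2 * E))"
        unfolding eq using x \<open>\<beta> > 0\<close>
        by (intro inv_ft_strip_bound[where N=N] e iQ iQ1 iQ2 low high m) auto
      also have "\<dots> \<le> ennreal (\<epsilon> * sqrt x)" using b by (rule ennreal_leI)
      finally show ?thesis .
    qed
    \<comment> \<open>The mollified increments converge at every \<open>t\<close> of the line, so
      Fatou's lemma transfers their common bound to \<open>g\<close>.\<close>
    have lim: "(\<lambda>n. D n t) \<longlonglongrightarrow> ennreal (indicator {-1..1} t * \<bar>g ((s + x) *\<^sub>R e1 + t *\<^sub>R e2) - g ((s - x) *\<^sub>R e1 + t *\<^sub>R e2)\<bar>)" for t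
      unfolding D_def gm_def g_def m_def
      by (intro tendsto_ennrealI tendsto_mult tendsto_const tendsto_rabs tendsto_diff mollified_convolution_tendsto[where B=B] k V)
    have "(\<integral>\<^sup>+t. ennreal (indicator {-1..1} t * \<bar>g ((s + x) *\<^sub>R e1 + t *\<^sub>R e2) - g ((s - x) *\<^sub>R e1 + t *\<^sub>R e2)\<bar>) \<partial>lborel) =
      (\<integral>\<^sup>+t. liminf (\<lambda>n. D n t) \<partial>lborel)"
      by (intro nn_integral_cong lim_imp_Liminf[OF _ lim, symmetric]) simp
    also have "\<dots> \<le> liminf (\<lambda>n. \<integral>\<^sup>+t. D n t \<partial>lborel)"
      by (rule nn_integral_liminf) measurable
    also have "\<dots> \<le> limsup (\<lambda>n. \<integral>\<^sup>+t. D n t \<partial>lborel)"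
      by (rule Liminf_le_Limsup) simp
    also have "\<dots> \<le> ennreal (\<epsilon> * sqrt x)"
      by (intro Limsup_bounded always_eventually allI Dn)
    finally show ?thesis .
  qed
  ultimately show ?thesis by blast
qed

section \<open>An obstruction to local \<open>H\<^sup>1\<close> regularity\<close>

text \<open>Cauchy-Schwarz alone gives \<open>O(sqrt \<delta>)\<close>. The gain comes from
  splitting at a frequency \<open>n\<close> beyond which little of the \<open>L^2\<close> mass is
  left; the part below \<open>n\<close> contributes only \<open>O(\<delta>)\<close>.\<close>

lemma gaussian_L2_small_o:
  fixes \<phi> :: "real \<Rightarrow> real"
  assumes [measurable]: "\<phi> \<in> borel_measurable borel" and nn: "\<And>\<xi>. \<phi> \<xi> \<ge> 0"
    and \<phi>2: "integrable lborel (\<lambda>\<xi>. (\<phi> \<xi>)\<^sup>2)" and \<epsilon>: "\<epsilon> > 0"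
  shows "\<exists>\<delta>0>0. \<forall>\<delta>. 0 < \<delta> \<and> \<delta> < \<delta>0 \<longrightarrow>
    integrable lborel (\<lambda>\<xi>. \<phi> \<xi> * gaussian (\<delta>\<^sup>2) \<xi>) \<and> \<delta> * (\<integral>\<xi>. \<phi> \<xi> * gaussian (\<delta>\<^sup>2) \<xi> \<partial>lborel) \<le> \<epsilon> * sqrt \<delta>"
proof -
  \<comment> \<open>Chosen so that, with Young weight \<open>b / sqrt \<delta>\<close>, the purely
    Gaussian term equals \<open>\<epsilon> / 4 * sqrt \<delta>\<close>. The tail beyond
    \<open>n\<close> is then taken below \<open>\<epsilon> / (2 * b)\<close>.\<close>
  define b where "b = 2 * sqrt pi / \<epsilon>"
  have "b > 0" using \<epsilon> by (simp add: b_def)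
  have "(\<lambda>n. \<integral>\<xi>. indicator (- cball 0 (real n)) \<xi> * (\<phi> \<xi>)\<^sup>2 \<partial>lborel) \<longlonglongrightarrow> (\<integral>\<xi>. 0 \<partial>(lborel :: real measure))"
  proof (rule integral_dominated_convergence[where w="\<lambda>\<xi>. (\<phi> \<xi>)\<^sup>2"])
    show "AE \<xi> in lborel. (\<lambda>n. indicator (- cball 0 (real n)) \<xi> * (\<phi> \<xi>)\<^sup>2) \<longlonglongrightarrow> 0"
    proof (intro AE_I2 tendsto_eventually)
      fix \<xi> :: real
      obtain n0 :: nat where "\<bar>\<xi>\<bar> \<le> real n0" using real_arch_simple by blast
      then show "\<forall>\<^sub>F n in sequentially. indicator (- cball 0 (real n)) \<xi> * (\<phi> \<xi>)\<^sup>2 = 0"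
        by (intro eventually_sequentiallyI[of n0]) (auto simp: indicator_def)
    qed
  qed (use \<phi>2 in \<open>auto split: split_indicator\<close>)
  then have "\<forall>\<^sub>F n in sequentially. (\<integral>\<xi>. indicator (- cball 0 (real n)) \<xi> * (\<phi> \<xi>)\<^sup>2 \<partial>lborel) < \<epsilon> / (2 * b)"
    by (intro order_tendstoD) (use \<epsilon> \<open>b > 0\<close> in auto)
  then obtain n where n: "(\<integral>\<xi>. indicator (- cball 0 (real n)) \<xi> * (\<phi> \<xi>)\<^sup>2 \<partial>lborel) < \<epsilon> / (2 * b)"
    using eventually_happens'[OF sequentially_bot] by blast
  define tail where "tail = (\<integral>\<xi>. indicator (- cball 0 (real n)) \<xi> * (\<phi> \<xi>)\<^sup>2 \<partial>lborel)"
  have it: "integrable lborel (\<lambda>\<xi>. indicator (- cball 0 (real n)) \<xi> * (\<phi> \<xi>)\<^sup>2)"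
    using integrable_mult_indicator[OF _ \<phi>2, of "- cball 0 (real n)"] by simp
  have ic: "integrable lborel (indicat_real (cball (0::real) (real n)))"
    by (rule integrable_real_indicator) (use emeasure_bounded_finite[of "cball (0::real) (real n)"] in auto)
  have i1: "integrable lborel (\<lambda>\<xi>. indicator (cball 0 (real n)) \<xi> * \<phi> \<xi>)"
  proof (rule Bochner_Integration.integrable_bound)
    show "integrable lborel (\<lambda>\<xi>. indicator (cball 0 (real n)) \<xi> + (\<phi> \<xi>)\<^sup>2)"
      using ic \<phi>2 by simp
    have "\<phi> \<xi> \<le> 1 + (\<phi> \<xi>)\<^sup>2" for \<xi>
      using sum_squares_bound[of 1 "\<phi> \<xi>"] nn[of \<xi>] by simp
    then show "AE \<xi> in lborel. norm (indicator (cball 0 (real n)) \<xi> * \<phi> \<xi>) \<le> norm (indicator (cball 0 (real n)) \<xi> + (\<phi> \<xi>)\<^sup>2)"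
      using nn by (intro AE_I2) (auto split: split_indicator)
  qed (auto intro!: borel_measurable_times borel_measurable_indicator)
  define A where "A = (\<integral>\<xi>. indicator (cball 0 (real n)) \<xi> * \<phi> \<xi> \<partial>lborel)"
  have "A \<ge> 0" unfolding A_def using nn by (intro integral_nonneg_AE) auto
  define \<delta>0 where "\<delta>0 = (\<epsilon> / (4 * (A + 1)))\<^sup>2"
  have "\<delta>0 > 0" using \<epsilon> \<open>A \<ge> 0\<close> by (simp add: \<delta>0_def)
  moreover have "integrable lborel (\<lambda>\<xi>. \<phi> \<xi> * gaussian (\<delta>\<^sup>2) \<xi>) \<and> \<delta> * (\<integral>\<xi>. \<phi> \<xi> * gaussian (\<delta>\<^sup>2) \<xi> \<partial>lborel) \<le> \<epsilon> * sqrt \<delta>"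
    if \<delta>: "0 < \<delta>" "\<delta> < \<delta>0" for \<delta>
  proof
    define a where "a = b / sqrt \<delta>"
    have "a > 0" using \<open>b > 0\<close> \<delta> by (simp add: a_def)
    have g2: "(gaussian (\<delta>\<^sup>2) \<xi>)\<^sup>2 = gaussian (2 * \<delta>\<^sup>2) \<xi>" for \<xi> :: real
      by (simp add: gaussian_def power2_eq_square exp_add[symmetric])
    have ig: "integrable lborel (\<lambda>\<xi>::real. gaussian (2 * \<delta>\<^sup>2) \<xi> / (2 * a))"
      using \<delta> by (intro integrable_divide_zero integrable_gaussian) auto
    have le: "\<phi> \<xi> * gaussian (\<delta>\<^sup>2) \<xi> \<le> indicator (cball 0 (real n)) \<xi> * \<phi> \<xi> + a / 2 * (indicator (- cball 0 (real n)) \<xi> * (\<phi> \<xi>)\<^sup>2) + gaussian (2 * \<delta>\<^sup>2) \<xi> / (2 * a)" for \<xi>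
    proof (cases "\<xi> \<in> cball 0 (real n)")
      case True
      have "\<phi> \<xi> * gaussian (\<delta>\<^sup>2) \<xi> \<le> \<phi> \<xi>" using nn gaussian_le_1[of "\<delta>\<^sup>2" \<xi>] by (intro mult_left_le) auto
      moreover have "0 \<le> gaussian (2 * \<delta>\<^sup>2) \<xi> / (2 * a)" using \<open>a > 0\<close> by simp
      ultimately show ?thesis using True by simp
    next
      case False
      have "0 \<le> (a * \<phi> \<xi> - gaussian (\<delta>\<^sup>2) \<xi>)\<^sup>2 / (2 * a)" using \<open>a > 0\<close> by simp
      also have "\<dots> = a / 2 * (\<phi> \<xi>)\<^sup>2 + gaussian (2 * \<delta>\<^sup>2) \<xi> / (2 * a) - \<phi> \<xi> * gaussian (\<delta>\<^sup>2) \<xi>"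
        using \<open>a > 0\<close> unfolding g2[symmetric] by (simp add: field_simps power2_eq_square)
      finally show ?thesis using False by simp
    qed
    have ir: "integrable lborel (\<lambda>\<xi>. indicator (cball 0 (real n)) \<xi> * \<phi> \<xi> + a / 2 * (indicator (- cball 0 (real n)) \<xi> * (\<phi> \<xi>)\<^sup>2) + gaussian (2 * \<delta>\<^sup>2) \<xi> / (2 * a))"
      by (intro Bochner_Integration.integrable_add integrable_mult_right i1 it ig)
    show i: "integrable lborel (\<lambda>\<xi>. \<phi> \<xi> * gaussian (\<delta>\<^sup>2) \<xi>)"
    proof (rule Bochner_Integration.integrable_bound[OF ir])
      show "AE \<xi> in lborel. norm (\<phi> \<xi> * gaussian (\<delta>\<^sup>2) \<xi>) \<le> norm (indicator (cball 0 (real n)) \<xi> * \<phi> \<xi> + a / 2 * (indicator (- cball 0 (real n)) \<xi> * (\<phi> \<xi>)\<^sup>2) + gaussian (2 * \<delta>\<^sup>2) \<xi> / (2 * a))"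
        using le nn by (intro AE_I2) (simp add: abs_mult order_trans[OF _ abs_ge_self])
    qed measurable
    have "(\<integral>\<xi>. \<phi> \<xi> * gaussian (\<delta>\<^sup>2) \<xi> \<partial>lborel) \<le> (\<integral>\<xi>. indicator (cball 0 (real n)) \<xi> * \<phi> \<xi> + a / 2 * (indicator (- cball 0 (real n)) \<xi> * (\<phi> \<xi>)\<^sup>2) + gaussian (2 * \<delta>\<^sup>2) \<xi> / (2 * a) \<partial>lborel)"
      by (rule integral_mono[OF i ir le])
    also have "\<dots> = A + a / 2 * tail + (\<integral>\<xi>. gaussian (2 * \<delta>\<^sup>2) \<xi> \<partial>(lborel :: real measure)) / (2 * a)"
      unfolding A_def tail_def using i1 it ig by simp
    also have "(\<integral>\<xi>. gaussian (2 * \<delta>\<^sup>2) \<xi> \<partial>(lborel :: real measure)) = sqrt pi / \<delta>"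
      using \<delta> by (subst integral_gaussian) (auto simp: real_sqrt_divide)
    finally have "\<delta> * (\<integral>\<xi>. \<phi> \<xi> * gaussian (\<delta>\<^sup>2) \<xi> \<partial>lborel) \<le> \<delta> * (A + a / 2 * tail + sqrt pi / \<delta> / (2 * a))"
      using \<delta> by (intro mult_left_mono) auto
    also have "\<dots> = \<delta> * A + sqrt \<delta> * (b * tail / 2) + sqrt \<delta> * (\<epsilon> / 4)"
    proof -
      have "\<delta> * (a / 2 * tail) = sqrt \<delta> * (b * tail / 2)"
        using \<delta> by (simp add: a_def field_simps) 
      moreover have "\<delta> * (sqrt pi / \<delta> / (2 * a)) = sqrt \<delta> * (\<epsilon> / 4)"
        using \<delta> \<epsilon> by (simp add: a_def b_def)
      ultimately show ?thesis by (simp only: distrib_left)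
    qed
    also have "\<dots> \<le> sqrt \<delta> * (\<epsilon> / 4) + sqrt \<delta> * (\<epsilon> / 4) + sqrt \<delta> * (\<epsilon> / 4)"
    proof (intro add_mono mult_left_mono)
      have "sqrt \<delta> \<le> \<epsilon> / (4 * (A + 1))"
        using \<delta> \<epsilon> \<open>A \<ge> 0\<close> unfolding \<delta>0_def by (intro real_le_lsqrt) auto
      then have "sqrt \<delta> * (4 * (A + 1)) \<le> \<epsilon>" using \<open>A \<ge> 0\<close> by (simp add: field_simps)
      moreover have "sqrt \<delta> * (4 * A) \<le> sqrt \<delta> * (4 * (A + 1))" using \<delta> by (intro mult_left_mono) auto
      ultimately have "sqrt \<delta> * A \<le> \<epsilon> / 4" by linarith
      then have "sqrt \<delta> * (sqrt \<delta> * A) \<le> sqrt \<delta> * (\<epsilon> / 4)" using \<delta> by (intro mult_left_mono) auto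
      then show "\<delta> * A \<le> sqrt \<delta> * (\<epsilon> / 4)" using \<delta> by (simp add: mult.assoc[symmetric])
      show "b * tail / 2 \<le> \<epsilon> / 4" using n[folded tail_def] \<open>b > 0\<close> by (simp add: field_simps)
    qed (use \<delta> in auto)
    also have "\<dots> \<le> \<epsilon> * sqrt \<delta>"
    proof -
      have "0 \<le> \<epsilon> * sqrt \<delta>" using \<epsilon> \<delta> by simp
      then show ?thesis by (simp add: mult.commute[of _ \<epsilon>])
    qed
    finally show "\<delta> * (\<integral>\<xi>. \<phi> \<xi> * gaussian (\<delta>\<^sup>2) \<xi> \<partial>lborel) \<le> \<epsilon> * sqrt \<delta>" .
  qed
  ultimately show ?thesis by blast
qed

text \<open>Oddness lets a pairing see only symmetric differences around the centre. Being a
  difference of two translates of one Gaussian, it produces on the Fourier side a factor of size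
  \<open>\<delta> \<bar>\<xi>\<bar>\<close>, which pairs with the \<open>H^1\<close> weight.\<close>

definition odd_bump :: "real \<Rightarrow> real \<Rightarrow> real" where
  "odd_bump \<delta> x = gaussian (1 / \<delta>\<^sup>2) (x - \<delta>) - gaussian (1 / \<delta>\<^sup>2) (x + \<delta>)"

lemma borel_measurable_odd_bump [measurable]: "odd_bump \<delta> \<in> borel_measurable borel"
  unfolding odd_bump_def by measurable

lemma odd_bump_minus: "odd_bump \<delta> (- x) = - odd_bump \<delta> x"
  by (simp add: odd_bump_def gaussian_def algebra_simps)

lemma odd_bump_nonneg:
  assumes "x \<ge> 0" "\<delta> > 0"
  shows "odd_bump \<delta> x \<ge> 0"
proof -
  have "(x - \<delta>) * (x - \<delta>) \<le> (x + \<delta>) * (x + \<delta>)"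
    using assms by (simp add: algebra_simps)
  then have "(1 / \<delta>\<^sup>2) * ((x - \<delta>) * (x - \<delta>)) \<le> (1 / \<delta>\<^sup>2) * ((x + \<delta>) * (x + \<delta>))"
    by (rule mult_left_mono) simp
  then show ?thesis by (simp add: odd_bump_def gaussian_def)
qed

text \<open>On this window the exponent of the near Gaussian is at most 1/2 and that of the far one
  at least 2. The window has length \<open>\<delta>\<close>, so a square-root jump pairs to at least
  a multiple of \<open>sqrt \<delta> * \<delta>\<close>.\<close>

lemma odd_bump_ge:
  assumes "\<delta> > 0" "x \<in> {\<delta>..2 * \<delta>}"
  shows "odd_bump \<delta> x \<ge> exp (- 1 / 2) - exp (- 2)"
proof -
  have "(x - \<delta>)\<^sup>2 \<le> \<delta>\<^sup>2" using assms by (intro power_mono) auto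
  then have "exp (- 1 / 2) \<le> gaussian (1 / \<delta>\<^sup>2) (x - \<delta>)"
    using assms by (simp add: gaussian_def power2_eq_square[symmetric] field_simps)
  moreover have "(2 * \<delta>)\<^sup>2 \<le> (x + \<delta>)\<^sup>2" using assms by (intro power_mono) auto
  then have "gaussian (1 / \<delta>\<^sup>2) (x + \<delta>) \<le> exp (- 2)"
    using assms by (simp add: gaussian_def power2_eq_square[symmetric] field_simps)
  ultimately show ?thesis by (simp add: odd_bump_def)
qed

lemma integrable_odd_bump: 
  assumes "\<delta> > 0"
  shows "integrable lborel (odd_bump \<delta>)"
proof -
  have g: "integrable lborel (gaussian (1 / \<delta>\<^sup>2) :: real \<Rightarrow> real)"
    using assms by (intro integrable_gaussian) auto
  show ?thesis
    unfolding odd_bump_def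
    using integrable_lborel_shift[OF g, of \<delta>] integrable_lborel_shift[OF g, of "- \<delta>"] by simp
qed

text \<open>The price of an error linear in \<open>x\<close>: it costs \<open>\<delta>^2\<close>, a
  lower order than the main term \<open>sqrt \<delta> * \<delta>\<close>.\<close>

lemma odd_bump_first_moment:
  assumes \<delta>: "\<delta> > 0"
  shows "integrable lborel (\<lambda>x. indicator {0<..} x * (x * odd_bump \<delta> x))"
    and "(\<integral>x. indicator {0<..} x * (x * odd_bump \<delta> x) \<partial>lborel) \<le> 8 * \<delta>\<^sup>2"
proof -
  define w where "w x = \<delta> * gaussian (1 / (2 * \<delta>\<^sup>2)) (x - \<delta>) + \<delta> * gaussian (1 / \<delta>\<^sup>2) (x - \<delta>)" for x :: real
  have g: "integrable lborel (gaussian \<alpha> :: real \<Rightarrow> real)" if "\<alpha> > 0" for \<alpha>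
    using that by (rule integrable_gaussian)
  have iw: "integrable lborel w"
    unfolding w_def using \<delta>
    by (intro Bochner_Integration.integrable_add integrable_mult_right integrable_lborel_shift g) auto
  have le: "indicator {0<..} x * (x * odd_bump \<delta> x) \<le> w x" for x
  proof (cases "x > 0")
    case True
    \<comment> \<open>With \<open>u = y / \<delta>\<close>, the inequality
      \<open>u \<le> 1 + u^2 / 4 \<le> exp (u^2 / 4)\<close> absorbs the linear factor into a
      Gaussian of larger width.\<close>
    have pt: "y * gaussian (1 / \<delta>\<^sup>2) y \<le> \<delta> * gaussian (1 / (2 * \<delta>\<^sup>2)) y" for y :: real
    proof -
      define u where "u = y / \<delta>"
      have "u \<le> 1 + u\<^sup>2 / 4" using zero_le_power2[of "u / 2 - 1"] by (simp add: power2_eq_square algebra_simps)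
      also have "\<dots> \<le> exp (u\<^sup>2 / 4)" by (rule exp_ge_add_one_self)
      finally have "u * exp (- u\<^sup>2 / 2) \<le> exp (u\<^sup>2 / 4) * exp (- u\<^sup>2 / 2)" by (intro mult_right_mono) auto
      also have "\<dots> = exp (- u\<^sup>2 / 4)" by (simp add: exp_add[symmetric])
      finally have "\<delta> * (u * exp (- u\<^sup>2 / 2)) \<le> \<delta> * exp (- u\<^sup>2 / 4)" using \<delta> by (intro mult_left_mono) auto
      moreover have "gaussian (1 / \<delta>\<^sup>2) y = exp (- u\<^sup>2 / 2)" "gaussian (1 / (2 * \<delta>\<^sup>2)) y = exp (- u\<^sup>2 / 4)" "\<delta> * u = y"
        using \<delta> by (simp_all add: gaussian_def u_def power_divide power2_eq_square)
      ultimately show ?thesis by (metis mult.assoc)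
    qed
    have "x * odd_bump \<delta> x \<le> x * gaussian (1 / \<delta>\<^sup>2) (x - \<delta>)"
      using True by (intro mult_left_mono) (auto simp: odd_bump_def)
    also have "\<dots> = (x - \<delta>) * gaussian (1 / \<delta>\<^sup>2) (x - \<delta>) + \<delta> * gaussian (1 / \<delta>\<^sup>2) (x - \<delta>)" by (simp add: algebra_simps)
    also have "\<dots> \<le> w x" unfolding w_def using pt by simp
    finally show ?thesis using True by simp
  next
    case False
    then show ?thesis using \<delta> by (simp add: w_def)
  qed
  show i: "integrable lborel (\<lambda>x. indicator {0<..} x * (x * odd_bump \<delta> x))"
  proof (rule Bochner_Integration.integrable_bound[OF iw])
    have "0 \<le> indicator {0<..} x * (x * odd_bump \<delta> x)" for x
      using odd_bump_nonneg[OF _ \<delta>] by (auto split: split_indicator)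
    then show "AE x in lborel. norm (indicator {0<..} x * (x * odd_bump \<delta> x)) \<le> norm (w x)"
      using le by (intro AE_I2) (simp add: order_trans[OF _ abs_ge_self])
  qed measurable
  have sh: "(\<integral>x. gaussian \<alpha> (x - \<delta>) \<partial>lborel) = sqrt (2 * pi / \<alpha>)" if "\<alpha> > 0" for \<alpha>
    using integral_lborel_affine[of "gaussian \<alpha> :: real \<Rightarrow> real" 1 "- \<delta>"] integral_gaussian[OF that, where 'a=real] by simp
  have "(\<integral>x. indicator {0<..} x * (x * odd_bump \<delta> x) \<partial>lborel) \<le> (\<integral>x. w x \<partial>lborel)"
    by (rule integral_mono[OF i iw le])
  also have "\<dots> = \<delta> * sqrt (2 * pi * (2 * \<delta>\<^sup>2)) + \<delta> * sqrt (2 * pi * \<delta>\<^sup>2)"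
    unfolding w_def using \<delta>
    by (subst Bochner_Integration.integral_add) (auto intro!: integrable_mult_right integrable_lborel_shift g simp: sh)
  also have "\<dots> \<le> \<delta> * (4 * \<delta>) + \<delta> * (4 * \<delta>)"
  proof -
    have "sqrt (2 * pi * (2 * \<delta>\<^sup>2)) \<le> 4 * \<delta>" "sqrt (2 * pi * \<delta>\<^sup>2) \<le> 4 * \<delta>"
      using pi_less_4 \<delta> by (auto intro!: real_le_lsqrt simp: power_mult_distrib)
    then show ?thesis using \<delta> by (intro add_mono mult_left_mono) auto
  qed
  finally show "(\<integral>x. indicator {0<..} x * (x * odd_bump \<delta> x) \<partial>lborel) \<le> 8 * \<delta>\<^sup>2"
    by (simp add: power2_eq_square)
qed

lemma integral_odd_bump:
  fixes G :: "real \<Rightarrow> real"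
  assumes [measurable]: "G \<in> borel_measurable borel" and K: "\<And>s. \<bar>G s\<bar> \<le> K" and \<delta>: "\<delta> > 0"
  shows "(\<integral>x. G (s0 + x) * odd_bump \<delta> x \<partial>lborel) = (\<integral>x. indicator {0<..} x * ((G (s0 + x) - G (s0 - x)) * odd_bump \<delta> x) \<partial>lborel)"
    and "integrable lborel (\<lambda>x. indicator {0<..} x * ((G (s0 + x) - G (s0 - x)) * odd_bump \<delta> x))"
proof -
  have "K \<ge> 0" using K[of 0] by linarith
  have i: "integrable lborel (\<lambda>x. indicator S x * (G (s0 + c * x) * odd_bump \<delta> x))" if [measurable]: "S \<in> sets borel" for S c
  proof (rule Bochner_Integration.integrable_bound)
    show "integrable lborel (\<lambda>x. K * odd_bump \<delta> x)" using integrable_odd_bump[OF \<delta>] by simp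
    show "AE x in lborel. norm (indicator S x * (G (s0 + c * x) * odd_bump \<delta> x)) \<le> norm (K * odd_bump \<delta> x)"
      using K \<open>K \<ge> 0\<close> by (intro AE_I2) (auto simp: abs_mult mult_right_mono split: split_indicator)
  qed measurable
  have ip: "integrable lborel (\<lambda>x. indicator {0<..} x * (G (s0 + x) * odd_bump \<delta> x))"
    and im: "integrable lborel (\<lambda>x. indicator {0<..} x * (G (s0 - x) * odd_bump \<delta> x))"
    and in': "integrable lborel (\<lambda>x. indicator {..<0} x * (G (s0 + x) * odd_bump \<delta> x))"
    using i[of "{0<..}" 1] i[of "{0<..}" "-1"] i[of "{..<0}" 1] by auto
  have "odd_bump \<delta> 0 = 0" using odd_bump_minus[of \<delta> 0] by simp
  then have "(\<integral>x. G (s0 + x) * odd_bump \<delta> x \<partial>lborel) =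
    (\<integral>x. indicator {0<..} x * (G (s0 + x) * odd_bump \<delta> x) + indicator {..<0} x * (G (s0 + x) * odd_bump \<delta> x) \<partial>lborel)"
    by (intro Bochner_Integration.integral_cong) (auto split: split_indicator)
  also have "\<dots> = (\<integral>x. indicator {0<..} x * (G (s0 + x) * odd_bump \<delta> x) \<partial>lborel) + (\<integral>x. indicator {..<0} x * (G (s0 + x) * odd_bump \<delta> x) \<partial>lborel)"
    by (intro Bochner_Integration.integral_add ip in')
  also have "(\<integral>x. indicator {..<0} x * (G (s0 + x) * odd_bump \<delta> x) \<partial>lborel) = (\<integral>x. - (indicator {0<..} x * (G (s0 - x) * odd_bump \<delta> x)) \<partial>lborel)"
    by (subst lborel_integral_real_affine[where c="-1" and t=0])
      (auto simp: odd_bump_minus intro!: Bochner_Integration.integral_cong split: split_indicator)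
  finally show "(\<integral>x. G (s0 + x) * odd_bump \<delta> x \<partial>lborel) = (\<integral>x. indicator {0<..} x * ((G (s0 + x) - G (s0 - x)) * odd_bump \<delta> x) \<partial>lborel)"
    using ip im by (simp add: left_diff_distrib right_diff_distrib)
  show "integrable lborel (\<lambda>x. indicator {0<..} x * ((G (s0 + x) - G (s0 - x)) * odd_bump \<delta> x))"
    using Bochner_Integration.integrable_diff[OF ip im] by (simp add: left_diff_distrib right_diff_distrib)
qed

text \<open>The positive part is kept only on \<open>{\<delta>..2 * \<delta>}\<close>, where
  \<open>sqrt x \<ge> sqrt \<delta>\<close>, and dropped elsewhere by positivity of the bump. The
  hypothesis combines a jump valid for \<open>x < x2\<close> with a linear error for all
  \<open>x > 0\<close>, so the Gaussian tails need no separate treatment.\<close>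

lemma odd_bump_lower_bound:
  fixes G :: "real \<Rightarrow> real"
  assumes [measurable]: "G \<in> borel_measurable borel" and K: "\<And>s. \<bar>G s\<bar> \<le> K"
    and "c > 0" "K' \<ge> 0"
    and G: "\<And>x. x > 0 \<Longrightarrow> c * sqrt x * indicator {..<x2} x - K' * x \<le> G (s0 + x) - G (s0 - x)"
    and \<delta>: "\<delta> > 0" "2 * \<delta> < x2"
  shows "(\<integral>x. G (s0 + x) * odd_bump \<delta> x \<partial>lborel) \<ge> c * (exp (- 1 / 2) - exp (- 2)) * sqrt \<delta> * \<delta> - 8 * K' * \<delta>\<^sup>2"
proof -
  define \<kappa> :: real where "\<kappa> = exp (- 1 / 2) - exp (- 2)"
  have ii: "integrable lborel (indicat_real {\<delta>..2 * \<delta>})"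
    by (rule integrable_real_indicator) (use \<delta> in auto)
  have "c * \<kappa> * sqrt \<delta> * \<delta> - 8 * K' * \<delta>\<^sup>2 \<le> (c * sqrt \<delta> * \<kappa>) * (\<integral>x. indicator {\<delta>..2 * \<delta>} x \<partial>lborel) - K' * (\<integral>x. indicator {0<..} x * (x * odd_bump \<delta> x) \<partial>lborel)"
    using mult_left_mono[OF odd_bump_first_moment(2)[OF \<delta>(1)] \<open>K' \<ge> 0\<close>] \<delta> by simp
  also have "\<dots> = (\<integral>x. (c * sqrt \<delta> * \<kappa>) * indicator {\<delta>..2 * \<delta>} x - K' * (indicator {0<..} x * (x * odd_bump \<delta> x)) \<partial>lborel)"
    using ii odd_bump_first_moment(1)[OF \<delta>(1)] by simp
  also have "\<dots> \<le> (\<integral>x. indicator {0<..} x * ((G (s0 + x) - G (s0 - x)) * odd_bump \<delta> x) \<partial>lborel)"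
  proof (rule integral_mono)
    show "integrable lborel (\<lambda>x. (c * sqrt \<delta> * \<kappa>) * indicator {\<delta>..2 * \<delta>} x - K' * (indicator {0<..} x * (x * odd_bump \<delta> x)))"
      using ii odd_bump_first_moment(1)[OF \<delta>(1)] by simp
    show "integrable lborel (\<lambda>x. indicator {0<..} x * ((G (s0 + x) - G (s0 - x)) * odd_bump \<delta> x))"
      by (rule integral_odd_bump(2)[OF _ K \<delta>(1)]) measurable
    fix x
    show "(c * sqrt \<delta> * \<kappa>) * indicator {\<delta>..2 * \<delta>} x - K' * (indicator {0<..} x * (x * odd_bump \<delta> x)) \<le> indicator {0<..} x * ((G (s0 + x) - G (s0 - x)) * odd_bump \<delta> x)"
    proof (cases "x > 0")
      case True
      have nn: "odd_bump \<delta> x \<ge> 0" using True \<delta> by (intro odd_bump_nonneg) auto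
      have "(c * sqrt \<delta> * \<kappa>) * indicator {\<delta>..2 * \<delta>} x \<le> c * sqrt x * indicator {..<x2} x * odd_bump \<delta> x"
      proof (cases "x \<in> {\<delta>..2 * \<delta>}")
        case True
        have "(c * sqrt \<delta>) * \<kappa> \<le> (c * sqrt x) * odd_bump \<delta> x"
          using True \<delta> \<open>c > 0\<close> nn odd_bump_ge[OF \<delta>(1) True] unfolding \<kappa>_def
          by (intro mult_mono) auto
        then show ?thesis using True \<delta> by auto
      next
        case False
        then show ?thesis using nn \<open>c > 0\<close> True by (auto split: split_indicator)
      qed
      moreover have "(c * sqrt x * indicator {..<x2} x - K' * x) * odd_bump \<delta> x \<le> (G (s0 + x) - G (s0 - x)) * odd_bump \<delta> x"
        by (intro mult_right_mono G True nn)
      ultimately show ?thesis using True by (simp add: left_diff_distrib)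
    qed (use \<delta> in \<open>auto split: split_indicator\<close>)
  qed
  also have "\<dots> = (\<integral>x. G (s0 + x) * odd_bump \<delta> x \<partial>lborel)"
    by (rule integral_odd_bump(1)[symmetric, OF _ K \<delta>(1)]) measurable
  finally show ?thesis unfolding \<kappa>_def .
qed

text \<open>Lipschitz relative to the fixed point \<open>x\<close> only. It serves the cut-off at
  \<open>s0\<close> and the tangential derivative at a tangent point, which vanishes there.\<close>

lemma differentiable_imp_lipschitz_at:
  fixes f :: "'a::real_normed_vector \<Rightarrow> 'b::real_normed_vector"
  assumes "f differentiable (at x)"
  obtains L d where "L \<ge> 0" "d > 0" "\<And>y. norm (y - x) < d \<Longrightarrow> norm (f y - f x) \<le> L * norm (y - x)"
proof -
  obtain f' where f': "bounded_linear f'"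
    "\<forall>e>0. \<exists>d>0. \<forall>y. norm (y - x) < d \<longrightarrow> norm (f y - f x - f' (y - x)) \<le> e * norm (y - x)"
    using assms unfolding differentiable_def has_derivative_at_alt by blast
  obtain d where d: "d > 0" "\<And>y. norm (y - x) < d \<Longrightarrow> norm (f y - f x - f' (y - x)) \<le> 1 * norm (y - x)"
    using f'(2) zero_less_one by blast
  obtain B where B: "B \<ge> 0" "\<And>h. norm (f' h) \<le> norm h * B"
    using bounded_linear.nonneg_bounded[OF f'(1)] by blast
  show ?thesis
  proof (rule that[of "B + 1" d])
    fix y assume "norm (y - x) < d"
    then show "norm (f y - f x) \<le> (B + 1) * norm (y - x)"
      using d(2)[of y] B(2)[of "y - x"] norm_triangle_ineq[of "f y - f x - f' (y - x)" "f' (y - x)"]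
      by (simp add: algebra_simps)
  qed (use B d in auto)
qed

lemma test_function_bounded:
  assumes "test_function \<eta>"
  obtains K where "\<And>s. norm (\<eta> s) \<le> K"
proof -
  have "\<eta> differentiable (at x)" for x
    using assms unfolding test_function_def smooth_on_def by (metis UNIV_I empty_set empty_subsetI iter_deriv.simps(1))
  then have "continuous_on (closure {x. \<eta> x \<noteq> 0}) \<eta>"
    by (meson continuous_at_imp_continuous_on differentiable_imp_continuous_within)
  then have "bounded (\<eta> ` closure {x. \<eta> x \<noteq> 0})"
    using assms unfolding test_function_def by (intro compact_imp_bounded compact_continuous_image) auto
  then obtain K where K: "\<And>x. x \<in> closure {x. \<eta> x \<noteq> 0} \<Longrightarrow> norm (\<eta> x) \<le> K"
    unfolding bounded_iff by auto
  have "norm (\<eta> s) \<le> max K 0" for s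
    using K[of s] closure_subset[of "{x. \<eta> x \<noteq> 0}"] by (cases "\<eta> s = 0") auto
  then show ?thesis by (rule that)
qed

text \<open>The pairing with the odd bump of width \<open>\<delta>\<close> is computed twice. From
  the jump it is at least \<open>c * \<kappa> * sqrt \<delta> * \<delta>\<close> up to
  \<open>O(\<delta>^2)\<close>; from the Fourier side it is at most a quarter of that, by the
  small-o estimate. Small \<open>\<delta>\<close> gives the contradiction.\<close>

lemma not_in_H1_near:
  fixes R :: "real \<Rightarrow> real"
  assumes [measurable]: "R \<in> borel_measurable borel" and K: "\<And>s. \<bar>R s\<bar> \<le> K"
    and \<sigma>: "\<bar>\<sigma>\<bar> = 1" and c: "c > 0" and x1: "x1 > 0"
    and jump: "\<And>x. 0 < x \<Longrightarrow> x < x1 \<Longrightarrow> \<sigma> * (R (s0 + x) - R (s0 - x)) \<ge> c * sqrt x"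
  shows "\<not> in_H_near 1 2 (distribution_of (\<lambda>s. complex_of_real (R s))) s0"
proof
  assume "in_H_near 1 2 (distribution_of (\<lambda>s. complex_of_real (R s))) s0"
  then obtain \<eta> where \<eta>: "test_function \<eta>" "\<eta> s0 \<noteq> 0"
    and H: "in_H 1 2 (\<lambda>h. distribution_of (\<lambda>s. complex_of_real (R s)) (\<lambda>y. \<eta> y * h y))"
    unfolding in_H_near_def by blast
  have diff: "\<eta> differentiable (at x)" for x
    using \<eta>(1) unfolding test_function_def smooth_on_def by (metis UNIV_I empty_set empty_subsetI iter_deriv.simps(1))
  have [measurable]: "\<eta> \<in> borel_measurable borel"
    using diff by (intro borel_measurable_continuous_onI) (meson continuous_at_imp_continuous_on differentiable_imp_continuous_within)
  obtain K\<eta> where K\<eta>: "\<And>s. norm (\<eta> s) \<le> K\<eta>"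
    using test_function_bounded[OF \<eta>(1)] by blast
  obtain L d where L: "L \<ge> 0" "d > 0" "\<And>y. norm (y - s0) < d \<Longrightarrow> norm (\<eta> y - \<eta> s0) \<le> L * norm (y - s0)"
    using differentiable_imp_lipschitz_at[OF diff] by blast
  have "K \<ge> 0" using K[of 0] by linarith
  have "K\<eta> \<ge> 0" using K\<eta>[of 0] norm_ge_zero order_trans by blast
  \<comment> \<open>The cut-off is complex valued; dividing by its value at \<open>s0\<close> and
    taking the real part gives a real weight equal to 1 at \<open>s0\<close>. Near \<open>s0\<close>
    it therefore changes the jump only by \<open>O(x)\<close>.\<close>
  define r where "r s = Re (\<eta> s / \<eta> s0)" for s
  have [measurable]: "r \<in> borel_measurable borel" unfolding r_def by measurable
  have r_bd: "\<bar>r s\<bar> \<le> K\<eta> / norm (\<eta> s0)" for s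
    unfolding r_def using abs_Re_le_cmod[of "\<eta> s / \<eta> s0"] K\<eta>[of s] \<eta>(2)
    by (simp add: norm_divide) (meson divide_right_mono norm_ge_zero order_trans)
  define L' where "L' = L / norm (\<eta> s0)"
  have r_lip: "\<bar>r s - 1\<bar> \<le> L' * \<bar>s - s0\<bar>" if "\<bar>s - s0\<bar> < d" for s
  proof -
    have "r s - 1 = Re ((\<eta> s - \<eta> s0) / \<eta> s0)" using \<eta>(2) by (simp add: r_def diff_divide_distrib)
    then have "\<bar>r s - 1\<bar> \<le> norm (\<eta> s - \<eta> s0) / norm (\<eta> s0)"
      using abs_Re_le_cmod[of "(\<eta> s - \<eta> s0) / \<eta> s0"] by (simp add: norm_divide)
    also have "\<dots> \<le> L * \<bar>s - s0\<bar> / norm (\<eta> s0)" using L(3)[of s] that by (intro divide_right_mono) auto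
    finally show ?thesis by (simp add: L'_def)
  qed
  have "L' \<ge> 0" using L by (simp add: L'_def)
  define G where "G s = \<sigma> * R s * r s" for s
  have [measurable]: "G \<in> borel_measurable borel" unfolding G_def by measurable
  define KG where "KG = K * (K\<eta> / norm (\<eta> s0))"
  have KG: "\<bar>G s\<bar> \<le> KG" for s
    unfolding G_def KG_def abs_mult \<sigma> mult_1 by (intro mult_mono K r_bd \<open>K \<ge> 0\<close> abs_ge_zero)
  have "KG \<ge> 0" using KG[of 0] by linarith
  define x2 where "x2 = min x1 d"
  have "x2 > 0" using x1 L by (simp add: x2_def)
  \<comment> \<open>The first summand covers the variation of the cut-off for \<open>x < x2\<close>.
    The second makes the linear term exceed \<open>2 * KG\<close>, a bound for any increment of
    \<open>G\<close>, once \<open>x \<ge> x2\<close>.\<close>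
  define K' where "K' = 2 * K * L' + 2 * KG / x2"
  have "K' \<ge> 0" using \<open>K \<ge> 0\<close> \<open>L' \<ge> 0\<close> \<open>KG \<ge> 0\<close> \<open>x2 > 0\<close> by (simp add: K'_def)
  have Gj: "c * sqrt x * indicator {..<x2} x - K' * x \<le> G (s0 + x) - G (s0 - x)" if "x > 0" for x
  proof (cases "x < x2")
    case True
    have b: "\<bar>\<sigma> * R (s0 + y) * (r (s0 + y) - 1)\<bar> \<le> K * (L' * x)" if "\<bar>y\<bar> = x" for y
      unfolding abs_mult \<sigma> using that True \<open>K \<ge> 0\<close> K r_lip[of "s0 + y"] by (auto simp: x2_def intro!: mult_mono)
    have "G (s0 + x) - G (s0 - x) = \<sigma> * (R (s0 + x) - R (s0 - x)) + \<sigma> * R (s0 + x) * (r (s0 + x) - 1) - \<sigma> * R (s0 + - x) * (r (s0 + - x) - 1)"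
      by (simp add: G_def algebra_simps)
    also have "\<dots> \<ge> c * sqrt x - 2 * K * L' * x"
      using b[of x] b[of "- x"] jump[of x] that True by (simp add: x2_def)
    finally have "c * sqrt x - 2 * K * L' * x \<le> G (s0 + x) - G (s0 - x)" .
    moreover have "2 * K * L' * x \<le> K' * x"
      unfolding K'_def using that \<open>KG \<ge> 0\<close> \<open>x2 > 0\<close> by (intro mult_right_mono) auto
    ultimately show ?thesis using True by simp
  next
    case False
    have "2 * KG = 2 * KG / x2 * x2" using \<open>x2 > 0\<close> by simp
    also have "\<dots> \<le> K' * x"
      unfolding K'_def using that False \<open>KG \<ge> 0\<close> \<open>x2 > 0\<close> \<open>K \<ge> 0\<close> \<open>L' \<ge> 0\<close> by (intro mult_mono) auto
    finally show ?thesis using KG[of "s0 + x"] KG[of "s0 - x"] False by simp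
  qed
  obtain F0 where F0: "F0 \<in> borel_measurable lebesgue"
    "\<And>h. schwartz h \<Longrightarrow> integrable lebesgue (\<lambda>\<xi>. F0 \<xi> * h \<xi>)"
    "\<And>h. schwartz h \<Longrightarrow> distribution_of (\<lambda>s. complex_of_real (R s)) (\<lambda>y. \<eta> y * fourier h y) = distribution_of F0 h"
    "finite_Lp_norm 2 (\<lambda>\<xi>. complex_of_real ((1 + (norm \<xi>)\<^sup>2) powr (1 / 2)) * F0 \<xi>)"
    using H unfolding in_H_def has_fourier_transform_def by blast
  obtain F where F [measurable]: "F \<in> borel_measurable borel" "AE x in lborel. F0 x = F x"
    using completion_ex_borel_measurable_complex[OF F0(1)] by auto
  define \<phi> where "\<phi> \<xi> = \<bar>\<xi>\<bar> * norm (F \<xi>)" for \<xi>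
  have [measurable]: "\<phi> \<in> borel_measurable borel" unfolding \<phi>_def by measurable
  have \<phi>2: "integrable lborel (\<lambda>\<xi>. (\<phi> \<xi>)\<^sup>2)"
  proof (rule integrableI_bounded)
    have "(\<integral>\<^sup>+\<xi>. ennreal (norm ((\<phi> \<xi>)\<^sup>2)) \<partial>lborel) \<le> (\<integral>\<^sup>+\<xi>. ennreal (norm (complex_of_real ((1 + (norm \<xi>)\<^sup>2) powr (1 / 2)) * F0 \<xi>) powr enn2real 2) \<partial>lborel)"
    proof (rule nn_integral_mono_AE)
      show "AE \<xi> in lborel. ennreal (norm ((\<phi> \<xi>)\<^sup>2)) \<le> ennreal (norm (complex_of_real ((1 + (norm \<xi>)\<^sup>2) powr (1 / 2)) * F0 \<xi>) powr enn2real 2)"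
        using F(2)
      proof eventually_elim
        case (elim \<xi>)
        have "\<bar>\<xi>\<bar> \<le> sqrt (1 + \<xi>\<^sup>2)" by (rule real_le_rsqrt) simp
        then have "\<phi> \<xi> \<le> sqrt (1 + \<xi>\<^sup>2) * norm (F0 \<xi>)"
          unfolding \<phi>_def elim by (intro mult_right_mono) auto
        then have "(\<phi> \<xi>)\<^sup>2 \<le> (sqrt (1 + \<xi>\<^sup>2) * norm (F0 \<xi>))\<^sup>2"
          by (intro power_mono) (auto simp: \<phi>_def)
        also have "\<dots> = norm (complex_of_real ((1 + (norm \<xi>)\<^sup>2) powr (1 / 2)) * F0 \<xi>) powr 2"
          by (simp add: powr_half_sqrt norm_mult)
        finally show ?case by (intro ennreal_leI) simp
      qed
    qed
    also have "\<dots> < \<infinity>"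
      using F0(4) by (simp add: finite_Lp_norm_def nn_integral_completion)
    finally show "(\<integral>\<^sup>+\<xi>. ennreal (norm ((\<phi> \<xi>)\<^sup>2)) \<partial>lborel) < \<infinity>" .
  qed measurable
  define \<kappa> :: real where "\<kappa> = exp (- 1 / 2) - exp (- 2)"
  have "\<kappa> > 0" by (simp add: \<kappa>_def)
  \<comment> \<open>The 8 leaves a quarter of the lower bound: a factor 2 comes from the translates
    lying \<open>2 * \<delta>\<close> apart.\<close>
  define \<epsilon> where "\<epsilon> = c * \<kappa> * norm (\<eta> s0) / 8"
  have "\<epsilon> > 0" using c \<open>\<kappa> > 0\<close> \<eta>(2) by (simp add: \<epsilon>_def)
  obtain \<delta>0 where "\<delta>0 > 0" and \<delta>0: "\<And>\<delta>. 0 < \<delta> \<Longrightarrow> \<delta> < \<delta>0 \<Longrightarrow>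
    integrable lborel (\<lambda>\<xi>. \<phi> \<xi> * gaussian (\<delta>\<^sup>2) \<xi>) \<and> \<delta> * (\<integral>\<xi>. \<phi> \<xi> * gaussian (\<delta>\<^sup>2) \<xi> \<partial>lborel) \<le> \<epsilon> * sqrt \<delta>"
    using gaussian_L2_small_o[of \<phi> \<epsilon>] \<phi>2 \<open>\<epsilon> > 0\<close> by (auto simp: \<phi>_def)
  have main: "c * \<kappa> \<le> 8 * K' * sqrt \<delta> + c * \<kappa> / 4" if \<delta>: "0 < \<delta>" "\<delta> < \<delta>0" "2 * \<delta> < x2" for \<delta>
  proof -
    define J where "J = (\<integral>s. complex_of_real (R s) * \<eta> s * complex_of_real (odd_bump \<delta> (s - s0)) \<partial>lborel)"
    define C where "C = sqrt (2 * pi / \<delta>\<^sup>2)"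
    have d2: "\<delta>\<^sup>2 > 0" using \<delta> by simp
    have F_int: "integrable lborel (\<lambda>\<xi>. F \<xi> * gauss_wave (\<delta>\<^sup>2) z \<xi>)" for z
    proof -
      have ae: "AE \<xi> in lebesgue. F0 \<xi> * gauss_wave (\<delta>\<^sup>2) z \<xi> = F \<xi> * gauss_wave (\<delta>\<^sup>2) z \<xi>"
        using AE_completion[OF F(2)] by eventually_elim simp
      have m: "(\<lambda>\<xi>. F \<xi> * gauss_wave (\<delta>\<^sup>2) z \<xi>) \<in> borel_measurable lborel" by measurable
      have i0: "integrable lebesgue (\<lambda>\<xi>. F0 \<xi> * gauss_wave (\<delta>\<^sup>2) z \<xi>)"
        by (rule F0(2)[OF schwartz_gauss_wave[OF d2]])
      have "integrable lebesgue (\<lambda>\<xi>. F \<xi> * gauss_wave (\<delta>\<^sup>2) z \<xi>)"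
        using integrable_cong_AE[OF borel_measurable_integrable[OF i0] measurable_completion[OF m] ae] i0 by simp
      then show ?thesis using integrable_completion[OF m] by simp
    qed
    have R_int: "integrable lborel (\<lambda>s. complex_of_real (R s) * \<eta> s * complex_of_real (gaussian (1 / \<delta>\<^sup>2) (s - z)))" for z
    proof (rule Bochner_Integration.integrable_bound)
      show "integrable lborel (\<lambda>s. K * K\<eta> * gaussian (1 / \<delta>\<^sup>2) (s - z))"
        using d2 by (intro integrable_mult_right integrable_lborel_shift integrable_gaussian) auto
      have "norm (complex_of_real (R s) * \<eta> s * complex_of_real (gaussian (1 / \<delta>\<^sup>2) (s - z))) \<le> K * K\<eta> * gaussian (1 / \<delta>\<^sup>2) (s - z)" for s
        unfolding norm_mult norm_of_real using K K\<eta> \<open>K \<ge> 0\<close> \<open>K\<eta> \<ge> 0\<close> by (intro mult_mono) auto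
      then show "AE s in lborel. norm (complex_of_real (R s) * \<eta> s * complex_of_real (gaussian (1 / \<delta>\<^sup>2) (s - z))) \<le> norm (K * K\<eta> * gaussian (1 / \<delta>\<^sup>2) (s - z))"
        by (intro AE_I2) (simp add: order_trans[OF _ abs_ge_self])
    qed measurable
    have test: "complex_of_real C * (\<integral>s. complex_of_real (R s) * \<eta> s * complex_of_real (gaussian (1 / \<delta>\<^sup>2) (s - z)) \<partial>lborel) = (\<integral>\<xi>. F \<xi> * gauss_wave (\<delta>\<^sup>2) z \<xi> \<partial>lborel)" for z
    proof -
      have "complex_of_real C * (\<integral>s. complex_of_real (R s) * \<eta> s * complex_of_real (gaussian (1 / \<delta>\<^sup>2) (s - z)) \<partial>lborel)
        = (\<integral>s. complex_of_real (R s) * (\<eta> s * fourier (gauss_wave (\<delta>\<^sup>2) z) s) \<partial>lborel)"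
        unfolding fourier_gauss_wave[OF d2] C_def integral_mult_right_zero[symmetric] by (simp add: mult_ac)
      also have "\<dots> = distribution_of (\<lambda>s. complex_of_real (R s)) (\<lambda>y. \<eta> y * fourier (gauss_wave (\<delta>\<^sup>2) z) y)"
        unfolding distribution_of_def
        by (rule integral_lebesgue_AE_borel[symmetric]) (auto simp: fourier_gauss_wave[OF d2])
      also have "\<dots> = distribution_of F0 (gauss_wave (\<delta>\<^sup>2) z)"
        by (rule F0(3)[OF schwartz_gauss_wave[OF d2]])
      also have "\<dots> = (\<integral>\<xi>. F \<xi> * gauss_wave (\<delta>\<^sup>2) z \<xi> \<partial>lborel)"
        unfolding distribution_of_def by (rule integral_lebesgue_AE_borel) (use F(2) in auto)
      finally show ?thesis .
    qed
    have J: "J = (\<integral>s. complex_of_real (R s) * \<eta> s * complex_of_real (gaussian (1 / \<delta>\<^sup>2) (s - (s0 + \<delta>))) \<partial>lborel) - (\<integral>s. complex_of_real (R s) * \<eta> s * complex_of_real (gaussian (1 / \<delta>\<^sup>2) (s - (s0 - \<delta>))) \<partial>lborel)"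
      unfolding J_def by (subst Bochner_Integration.integral_diff[OF R_int R_int, symmetric])
        (simp add: odd_bump_def algebra_simps)
    have "complex_of_real C * J = (\<integral>\<xi>. F \<xi> * gauss_wave (\<delta>\<^sup>2) (s0 + \<delta>) \<xi> - F \<xi> * gauss_wave (\<delta>\<^sup>2) (s0 - \<delta>) \<xi> \<partial>lborel)"
      unfolding J right_diff_distrib test by (rule Bochner_Integration.integral_diff[OF F_int F_int, symmetric])
    also have "norm \<dots> \<le> (\<integral>\<xi>. 2 * \<delta> * (\<phi> \<xi> * gaussian (\<delta>\<^sup>2) \<xi>) \<partial>lborel)"
    proof (rule Bochner_Integration.integral_norm_bound_integral)
      show "integrable lborel (\<lambda>\<xi>. 2 * \<delta> * (\<phi> \<xi> * gaussian (\<delta>\<^sup>2) \<xi>))" using \<delta>0[OF \<delta>(1,2)] by simp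
      show "integrable lborel (\<lambda>\<xi>. F \<xi> * gauss_wave (\<delta>\<^sup>2) (s0 + \<delta>) \<xi> - F \<xi> * gauss_wave (\<delta>\<^sup>2) (s0 - \<delta>) \<xi>)"
        by (intro Bochner_Integration.integrable_diff F_int)
      fix \<xi> :: real
      have "norm (exp (\<i> * complex_of_real ((s0 + \<delta>) * \<xi>)) - exp (\<i> * complex_of_real ((s0 - \<delta>) * \<xi>))) =
        norm (exp (\<i> * complex_of_real ((s0 - \<delta>) * \<xi>)) * (exp (\<i> * complex_of_real (2 * \<delta> * \<xi>)) - 1))"
        unfolding right_diff_distrib mult_exp_exp by (simp add: algebra_simps)
      also have "\<dots> = norm (exp (\<i> * complex_of_real (2 * \<delta> * \<xi>)) - 1)" by (simp only: norm_mult norm_exp_i_times mult_1)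
      also have "\<dots> \<le> 2 * \<delta> * \<bar>\<xi>\<bar>" using iexp_approx1[of "2 * \<delta> * \<xi>" 0] \<delta> by (simp add: abs_mult)
      finally have *: "norm (exp (\<i> * complex_of_real ((s0 + \<delta>) * \<xi>)) - exp (\<i> * complex_of_real ((s0 - \<delta>) * \<xi>))) \<le> 2 * \<delta> * \<bar>\<xi>\<bar>" .
      have "F \<xi> * gauss_wave (\<delta>\<^sup>2) (s0 + \<delta>) \<xi> - F \<xi> * gauss_wave (\<delta>\<^sup>2) (s0 - \<delta>) \<xi> =
        (exp (\<i> * complex_of_real ((s0 + \<delta>) * \<xi>)) - exp (\<i> * complex_of_real ((s0 - \<delta>) * \<xi>))) * (F \<xi> * complex_of_real (gaussian (\<delta>\<^sup>2) \<xi>))"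
        by (simp add: gauss_wave_def algebra_simps)
      also have "norm \<dots> \<le> (2 * \<delta> * \<bar>\<xi>\<bar>) * (norm (F \<xi>) * gaussian (\<delta>\<^sup>2) \<xi>)"
        unfolding norm_mult using * \<delta> by (intro mult_mono) auto
      finally show "norm (F \<xi> * gauss_wave (\<delta>\<^sup>2) (s0 + \<delta>) \<xi> - F \<xi> * gauss_wave (\<delta>\<^sup>2) (s0 - \<delta>) \<xi>) \<le> 2 * \<delta> * (\<phi> \<xi> * gaussian (\<delta>\<^sup>2) \<xi>)"
        by (simp add: \<phi>_def mult_ac)
    qed
    also have "\<dots> \<le> 2 * (\<epsilon> * sqrt \<delta>)" using \<delta>0[OF \<delta>(1,2)] by simp
    finally have CJ: "norm (complex_of_real C * J) \<le> 2 * (\<epsilon> * sqrt \<delta>)" .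
    \<comment> \<open>\<open>C\<close> is the factor in the transform of the Gaussian wave; dividing
      by it supplies the missing power of \<open>\<delta>\<close>, so the pairing is bounded by
      \<open>2 * \<epsilon> * sqrt \<delta> * \<delta>\<close>.\<close>
    have "1 / \<delta> \<le> C"
      unfolding C_def using \<delta> pi_gt3 by (intro real_le_rsqrt) (auto simp: power_divide intro!: divide_right_mono)
    then have "1 / \<delta> * norm J \<le> norm (complex_of_real C * J)"
      unfolding norm_mult norm_of_real by (intro mult_right_mono) auto
    with CJ have "1 / \<delta> * norm J \<le> 2 * (\<epsilon> * sqrt \<delta>)" by linarith
    then have "norm J \<le> 2 * (\<epsilon> * sqrt \<delta>) * \<delta>" using \<delta> by (simp add: field_simps)
    then have Jn: "norm (J / \<eta> s0) \<le> c * \<kappa> / 4 * sqrt \<delta> * \<delta>"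
      using \<eta>(2) unfolding \<epsilon>_def by (simp add: norm_divide field_simps)
    have "(\<integral>x. G (s0 + x) * odd_bump \<delta> x \<partial>lborel) = \<sigma> * Re (J / \<eta> s0)"
    proof -
      have iJ: "integrable lborel (\<lambda>s. complex_of_real (R s) * \<eta> s * complex_of_real (odd_bump \<delta> (s - s0)))"
        using Bochner_Integration.integrable_diff[OF R_int[of "s0 + \<delta>"] R_int[of "s0 - \<delta>"]]
        by (simp add: odd_bump_def algebra_simps)
      have "(\<integral>x. G (s0 + x) * odd_bump \<delta> x \<partial>lborel) = (\<integral>s. G s * odd_bump \<delta> (s - s0) \<partial>lborel)"
        by (subst (2) lborel_integral_real_affine[where c=1 and t=s0]) auto
      also have "\<dots> = (\<integral>s. \<sigma> * Re (complex_of_real (R s) * \<eta> s * complex_of_real (odd_bump \<delta> (s - s0)) / \<eta> s0) \<partial>lborel)"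
        by (intro Bochner_Integration.integral_cong refl) (simp add: G_def r_def Re_divide_of_real Re_divide field_simps)
      also have "\<dots> = \<sigma> * Re (J / \<eta> s0)"
        unfolding J_def using iJ by simp
      finally show ?thesis .
    qed
    also have "\<dots> \<le> norm (J / \<eta> s0)"
      using abs_Re_le_cmod[of "J / \<eta> s0"] \<sigma> abs_ge_self[of "\<sigma> * Re (J / \<eta> s0)"] by (simp only: abs_mult)
    finally have "(\<integral>x. G (s0 + x) * odd_bump \<delta> x \<partial>lborel) \<le> c * \<kappa> / 4 * sqrt \<delta> * \<delta>" using Jn by linarith
    moreover have "c * \<kappa> * sqrt \<delta> * \<delta> - 8 * K' * \<delta>\<^sup>2 \<le> (\<integral>x. G (s0 + x) * odd_bump \<delta> x \<partial>lborel)"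
      unfolding \<kappa>_def using KG c \<open>K' \<ge> 0\<close> Gj \<delta> by (intro odd_bump_lower_bound) auto
    ultimately have ineq: "c * \<kappa> * sqrt \<delta> * \<delta> - 8 * K' * \<delta>\<^sup>2 \<le> c * \<kappa> / 4 * sqrt \<delta> * \<delta>" by linarith
    have sq: "\<delta>\<^sup>2 = sqrt \<delta> * (sqrt \<delta> * \<delta>)" using \<delta> by (simp add: power2_eq_square mult.assoc[symmetric])
    have factor: "p * y * d - q * (y * (y * d)) \<le> p / 4 * y * d \<Longrightarrow> p * (y * d) \<le> (q * y + p / 4) * (y * d)" for p q y d :: real
      by (simp add: algebra_simps)
    have "(c * \<kappa>) * (sqrt \<delta> * \<delta>) \<le> (8 * K' * sqrt \<delta> + c * \<kappa> / 4) * (sqrt \<delta> * \<delta>)"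
      by (rule factor) (use ineq in \<open>simp only: sq\<close>)
    then show ?thesis using \<delta> by (simp only: mult_le_cancel_right) auto
  qed
  \<comment> \<open>The last entry of the minimum gives
    \<open>8 * K' * sqrt \<delta> \<le> c * \<kappa> / 4\<close>, which leaves
    \<open>c * \<kappa> \<le> c * \<kappa> / 2\<close>.\<close>
  define \<delta> where "\<delta> = min (min (\<delta>0 / 2) (x2 / 4)) ((c * \<kappa> / (32 * (K' + 1)))\<^sup>2)"
  have \<delta>: "0 < \<delta>" "\<delta> < \<delta>0" "2 * \<delta> < x2"
    using \<open>\<delta>0 > 0\<close> \<open>x2 > 0\<close> c \<open>\<kappa> > 0\<close> \<open>K' \<ge> 0\<close> by (auto simp: \<delta>_def min_def)
  have "sqrt \<delta> \<le> c * \<kappa> / (32 * (K' + 1))"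
    using c \<open>\<kappa> > 0\<close> \<open>K' \<ge> 0\<close> by (intro real_le_lsqrt) (auto simp: \<delta>_def)
  then have "sqrt \<delta> * (32 * (K' + 1)) \<le> c * \<kappa>" using \<open>K' \<ge> 0\<close> by (simp add: field_simps)
  moreover have "sqrt \<delta> * (32 * K') \<le> sqrt \<delta> * (32 * (K' + 1))" using \<delta> by (intro mult_left_mono) auto
  ultimately have "8 * K' * sqrt \<delta> \<le> c * \<kappa> / 4" by (simp add: mult_ac)
  with main[OF \<delta>] have "c * \<kappa> \<le> c * \<kappa> / 2" by linarith
  moreover have "c * \<kappa> > 0" using c \<open>\<kappa> > 0\<close> by simp
  ultimately show False by linarith
qed

section \<open>Smooth level curves\<close>

lemma frechet_derivative_eqI: "(f has_derivative f') (at x) \<Longrightarrow> frechet_derivative f (at x) = f'"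
  using frechet_derivative_at by metis

lemma iter_deriv_append: "iter_deriv (vs @ ws) f = iter_deriv vs (iter_deriv ws f)"
  by (induction vs) auto

lemma smooth_on_differentiable: "smooth_on U f \<Longrightarrow> x \<in> U \<Longrightarrow> f differentiable (at x)"
  unfolding smooth_on_def by (metis empty_set empty_subsetI iter_deriv.simps(1))

lemma smooth_on_partial:
  assumes "smooth_on U f" "b \<in> Basis"
  shows "smooth_on U (\<lambda>x. frechet_derivative f (at x) b)"
  unfolding smooth_on_def
proof (intro allI impI ballI)
  fix vs x assume "set vs \<subseteq> (Basis :: 'a set)" "x \<in> U"
  then have "iter_deriv (vs @ [b]) f differentiable (at x)"
    using assms unfolding smooth_on_def by auto
  then show "iter_deriv vs (\<lambda>x. frechet_derivative f (at x) b) differentiable (at x)"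
    by (simp add: iter_deriv_append)
qed

text \<open>A recursive form of smoothness of order \<open>n\<close>: the rules for sums, products
  and inverses are inductions on \<open>n\<close>, since differentiating lowers the order by
  one.\<close>

primrec n_smooth_on :: "nat \<Rightarrow> 'a::euclidean_space set \<Rightarrow> ('a \<Rightarrow> real) \<Rightarrow> bool" where
  "n_smooth_on 0 U f \<longleftrightarrow> True"
| "n_smooth_on (Suc n) U f \<longleftrightarrow> (\<forall>x\<in>U. f differentiable (at x)) \<and>
     (\<forall>b\<in>Basis. n_smooth_on n U (\<lambda>x. frechet_derivative f (at x) b))"

lemma smooth_on_imp_n_smooth_on: "smooth_on U f \<Longrightarrow> n_smooth_on n U f"
  by (induction n arbitrary: f) (auto intro: smooth_on_differentiable smooth_on_partial)

lemma differentiable_cong_open: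
  assumes "open U" "x \<in> U" "\<And>y. y \<in> U \<Longrightarrow> f y = g y"
  shows "f differentiable (at x) \<longleftrightarrow> g differentiable (at x)"
    and "frechet_derivative f (at x) = frechet_derivative g (at x)"
proof -
  have *: "(f has_derivative D) (at x) \<longleftrightarrow> (g has_derivative D) (at x)" for D
    using has_derivative_transform_within_open[of f D x UNIV U g] has_derivative_transform_within_open[of g D x UNIV U f] assms by auto
  show "f differentiable (at x) \<longleftrightarrow> g differentiable (at x)" unfolding differentiable_def * ..
  show "frechet_derivative f (at x) = frechet_derivative g (at x)" unfolding frechet_derivative_def * ..
qed

lemma n_smooth_on_cong:
  assumes "open U" "\<And>x. x \<in> U \<Longrightarrow> f x = g x"
  shows "n_smooth_on n U f \<longleftrightarrow> n_smooth_on n U g"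
  using assms(2)
proof (induction n arbitrary: f g)
  case (Suc n)
  have "n_smooth_on n U (\<lambda>x. frechet_derivative f (at x) b) \<longleftrightarrow> n_smooth_on n U (\<lambda>x. frechet_derivative g (at x) b)" for b
    using differentiable_cong_open(2)[OF assms(1) _ Suc.prems] by (intro Suc.IH) auto
  then show ?case using differentiable_cong_open(1)[OF assms(1) _ Suc.prems] by simp
qed simp

lemma n_smooth_on_Suc_imp: "n_smooth_on (Suc n) U f \<Longrightarrow> n_smooth_on n U f"
  by (induction n arbitrary: f) auto

lemma n_smooth_on_const: "n_smooth_on n U (\<lambda>_. c)"
  by (induction n arbitrary: c) auto

lemma n_smooth_on_add:
  assumes "open U" "n_smooth_on n U f" "n_smooth_on n U g"
  shows "n_smooth_on n U (\<lambda>x. f x + g x)"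
  using assms(2,3)
proof (induction n arbitrary: f g)
  case (Suc n)
  have "n_smooth_on n U (\<lambda>x. frechet_derivative (\<lambda>x. f x + g x) (at x) b)" if "b \<in> Basis" for b
  proof (subst n_smooth_on_cong[OF assms(1)])
    fix x assume "x \<in> U"
    then show "frechet_derivative (\<lambda>x. f x + g x) (at x) b = frechet_derivative f (at x) b + frechet_derivative g (at x) b"
      using Suc.prems by (auto simp: frechet_derivative_works intro!: fun_cong[OF frechet_derivative_eqI] has_derivative_add)
  next
    show "n_smooth_on n U (\<lambda>x. frechet_derivative f (at x) b + frechet_derivative g (at x) b)"
      using Suc that by auto
  qed
  then show ?case using Suc.prems by auto
qed simp

lemma n_smooth_on_mult:
  assumes "open U" "n_smooth_on n U f" "n_smooth_on n U g"
  shows "n_smooth_on n U (\<lambda>x. f x * g x)"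
  using assms(2,3)
proof (induction n arbitrary: f g)
  case (Suc n)
  have "n_smooth_on n U (\<lambda>x. frechet_derivative (\<lambda>x. f x * g x) (at x) b)" if "b \<in> Basis" for b
  proof (subst n_smooth_on_cong[OF assms(1)])
    fix x assume "x \<in> U"
    then show "frechet_derivative (\<lambda>x. f x * g x) (at x) b = f x * frechet_derivative g (at x) b + frechet_derivative f (at x) b * g x"
      using Suc.prems by (auto simp: frechet_derivative_works intro!: fun_cong[OF frechet_derivative_eqI] has_derivative_mult)
  next
    show "n_smooth_on n U (\<lambda>x. f x * frechet_derivative g (at x) b + frechet_derivative f (at x) b * g x)"
      using Suc that n_smooth_on_Suc_imp[OF Suc.prems(1)] n_smooth_on_Suc_imp[OF Suc.prems(2)]
      by (intro n_smooth_on_add assms(1)) auto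
  qed
  then show ?case using Suc.prems by auto
qed simp

lemma n_smooth_on_inverse:
  assumes "open U" "n_smooth_on n U f" and nz: "\<And>x. x \<in> U \<Longrightarrow> f x \<noteq> 0"
  shows "n_smooth_on n U (\<lambda>x. inverse (f x))"
  using assms(2)
proof (induction n)
  case (Suc n)
  then have IH: "n_smooth_on n U (\<lambda>x. inverse (f x))" using n_smooth_on_Suc_imp by blast
  have D: "((\<lambda>x. inverse (f x)) has_derivative (\<lambda>h. - (inverse (f x) * frechet_derivative f (at x) h * inverse (f x)))) (at x)" if "x \<in> U" for x
    using Suc.prems nz that by (intro Deriv.has_derivative_inverse) (auto simp: frechet_derivative_works[symmetric])
  have "n_smooth_on n U (\<lambda>x. frechet_derivative (\<lambda>x. inverse (f x)) (at x) b)" if "b \<in> Basis" for b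
  proof (subst n_smooth_on_cong[OF assms(1)])
    fix x assume "x \<in> U"
    then show "frechet_derivative (\<lambda>x. inverse (f x)) (at x) b = (-1) * (inverse (f x) * frechet_derivative f (at x) b * inverse (f x))"
      using fun_cong[OF frechet_derivative_eqI[OF D], of x b] by simp
  next
    show "n_smooth_on n U (\<lambda>x. (-1) * (inverse (f x) * frechet_derivative f (at x) b * inverse (f x)))"
      using Suc.prems that IH by (intro n_smooth_on_mult n_smooth_on_const assms(1)) auto
  qed
  moreover have "\<forall>x\<in>U. (\<lambda>x. inverse (f x)) differentiable (at x)"
    using D unfolding differentiable_def by blast
  ultimately show ?case by simp
qed simp

lemma frechet_derivative_eq_sum:
  assumes "f differentiable (at x)"
  shows "frechet_derivative f (at x) v = (\<Sum>b\<in>Basis. (v \<bullet> b) *\<^sub>R frechet_derivative f (at x) b)"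
proof -
  have lin: "linear (frechet_derivative f (at x))" using linear_frechet_derivative[OF assms] .
  have "frechet_derivative f (at x) v = frechet_derivative f (at x) (\<Sum>b\<in>Basis. (v \<bullet> b) *\<^sub>R b)"
    by (simp add: euclidean_representation)
  also have "\<dots> = (\<Sum>b\<in>Basis. (v \<bullet> b) *\<^sub>R frechet_derivative f (at x) b)"
    using lin by (simp add: linear_sum linear_scale)
  finally show ?thesis .
qed

lemma n_smooth_on_sum:
  assumes "open U" "finite I" "\<And>i. i \<in> I \<Longrightarrow> n_smooth_on n U (f i)"
  shows "n_smooth_on n U (\<lambda>x. \<Sum>i\<in>I. f i x)"
  using assms(2,3) by (induction I) (auto intro: n_smooth_on_const n_smooth_on_add assms(1))

text \<open>The definition speaks of basis directions only; linearity extends it to every direction,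
  as the frames used below are rotated.\<close>

lemma n_smooth_on_directional:
  assumes "open U" "n_smooth_on (Suc n) U f"
  shows "n_smooth_on n U (\<lambda>x. frechet_derivative f (at x) v)"
proof (subst n_smooth_on_cong[OF assms(1)])
  fix x assume "x \<in> U"
  then show "frechet_derivative f (at x) v = (\<Sum>b\<in>Basis. (v \<bullet> b) * frechet_derivative f (at x) b)"
    using assms(2) frechet_derivative_eq_sum[of f x v] by simp
next
  show "n_smooth_on n U (\<lambda>x. \<Sum>b\<in>Basis. (v \<bullet> b) * frechet_derivative f (at x) b)"
    using assms by (intro n_smooth_on_sum n_smooth_on_mult n_smooth_on_const) auto
qed

lemma smooth_on_directional_differentiable:
  fixes f :: "'a::euclidean_space \<Rightarrow> real"
  assumes "open U" "smooth_on U f" "x \<in> U"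
  shows "(\<lambda>x. frechet_derivative f (at x) v) differentiable (at x)"
  using n_smooth_on_directional[OF assms(1) smooth_on_imp_n_smooth_on[OF assms(2), of "Suc (Suc 0)"], of v] assms(3) by simp

lemma smooth_on_directional_continuous_on:
  fixes f :: "'a::euclidean_space \<Rightarrow> real"
  assumes "open U" "smooth_on U f"
  shows "continuous_on U (\<lambda>x. frechet_derivative f (at x) v)"
  using smooth_on_directional_differentiable[OF assms]
  by (intro continuous_at_imp_continuous_on ballI differentiable_imp_continuous_within)

text \<open>The level set of a smooth function is locally a smooth curve: the implicit function \<open>G\<close> is
  found by monotonicity, and the derivatives of \<open>t \<mapsto> q (\<gamma> t)\<close> are again of this form, since
  \<open>\<gamma>' t\<close> is a smooth function of \<open>\<gamma> t\<close>.\<close>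

lemma implicit_curve:
  fixes \<rho> :: "'a::euclidean_space \<Rightarrow> real"
  assumes "open U" "p \<in> U" and \<rho>: "smooth_on U \<rho>" "\<rho> p = 0"
    and pos: "frechet_derivative \<rho> (at p) e1 > 0"
  obtains \<gamma> e q where "e > 0" "\<gamma> 0 = p" "smooth_on {-e<..<e} \<gamma>"
    "\<And>t. t \<in> {-e<..<e} \<Longrightarrow> \<gamma> t \<in> U \<and> \<rho> (\<gamma> t) = 0 \<and> (\<gamma> has_vector_derivative (q t *\<^sub>R e1 + e2)) (at t)"
    "q 0 = - frechet_derivative \<rho> (at p) e2 / frechet_derivative \<rho> (at p) e1"
proof -
  define D1 where "D1 x = frechet_derivative \<rho> (at x) e1" for x
  define D2 where "D2 x = frechet_derivative \<rho> (at x) e2" for x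
  define c where "c = D1 p / 2"
  define C where "C = \<bar>D2 p\<bar> + 1"
  have "c > 0" "C > 0" using pos by (auto simp: c_def C_def D1_def)
  have cont: "continuous_on U D1" "continuous_on U D2"
    unfolding D1_def D2_def using assms by (auto intro: smooth_on_directional_continuous_on)
  have der: "(\<rho> has_derivative frechet_derivative \<rho> (at x)) (at x)" if "x \<in> U" for x
    using smooth_on_differentiable[OF \<rho>(1) that] by (simp add: frechet_derivative_works)
  \<comment> \<open>On \<open>V\<close> the function \<open>\<rho>\<close> increases along
    \<open>e1\<close> with slope above \<open>c\<close> and varies along \<open>e2\<close> with
    slope below \<open>C\<close> in absolute value. All later estimates take place in a box inside
    \<open>V\<close>.\<close>
  define V where "V = U \<inter> D1 -` {c<..} \<inter> (U \<inter> D2 -` {-C<..<C})"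
  have "open V"
    unfolding V_def using cont assms(1) by (intro open_Int continuous_open_preimage) auto
  have "p \<in> V" using assms(2) \<open>c > 0\<close> by (auto simp: V_def c_def C_def)
  have "V \<subseteq> U" by (auto simp: V_def)
  obtain d where d: "d > 0" "ball p d \<subseteq> V" using \<open>open V\<close> \<open>p \<in> V\<close> open_contains_ball by blast
  define r where "r = d / (norm e1 + norm e2 + 1)"
  have "r > 0" using d by (simp add: r_def add_nonneg_pos)
  define X where "X s t = p + s *\<^sub>R e1 + t *\<^sub>R e2" for s t
  have X: "X s t \<in> V" if "\<bar>s\<bar> \<le> r" "\<bar>t\<bar> \<le> r" for s t
  proof -
    have "norm (s *\<^sub>R e1 + t *\<^sub>R e2) \<le> r * norm e1 + r * norm e2"
      using that by (intro order_trans[OF norm_triangle_ineq]) (auto intro!: add_mono mult_right_mono)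
    also have "\<dots> < r * (norm e1 + norm e2 + 1)" using \<open>r > 0\<close> by (simp add: algebra_simps)
    also have "\<dots> = d" unfolding r_def by (simp add: add_nonneg_pos[THEN less_imp_neq, symmetric])
    also have "norm (s *\<^sub>R e1 + t *\<^sub>R e2) = dist (X s t) p" by (simp add: X_def dist_norm)
    finally have "dist p (X s t) < d" by (simp add: dist_commute)
    then show ?thesis using d by auto
  qed
  have ds: "((\<lambda>s. \<rho> (X s t)) has_real_derivative D1 (X s t)) (at s)" if "X s t \<in> U" for s t
  proof -
    have "((\<lambda>s. X s t) has_derivative (\<lambda>h. h *\<^sub>R e1)) (at s)"
      unfolding X_def by (auto intro!: derivative_eq_intros)
    note has_derivative_compose[OF this der[OF that]]
    moreover have "(\<lambda>h. frechet_derivative \<rho> (at (X s t)) (h *\<^sub>R e1)) = (*) (D1 (X s t))"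
      using linear_frechet_derivative[OF smooth_on_differentiable[OF \<rho>(1) that]]
      by (simp add: fun_eq_iff linear_scale D1_def)
    ultimately show ?thesis
      unfolding has_field_derivative_def by simp
  qed
  have dt: "((\<lambda>t. \<rho> (X s t)) has_real_derivative D2 (X s t)) (at t)" if "X s t \<in> U" for s t
  proof -
    have "((\<lambda>t. X s t) has_derivative (\<lambda>h. h *\<^sub>R e2)) (at t)"
      unfolding X_def by (auto intro!: derivative_eq_intros)
    note has_derivative_compose[OF this der[OF that]]
    moreover have "(\<lambda>h. frechet_derivative \<rho> (at (X s t)) (h *\<^sub>R e2)) = (*) (D2 (X s t))"
      using linear_frechet_derivative[OF smooth_on_differentiable[OF \<rho>(1) that]]
      by (simp add: fun_eq_iff linear_scale D2_def)
    ultimately show ?thesis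
      unfolding has_field_derivative_def by simp
  qed
  have mono: "c * (s' - s) \<le> \<rho> (X s' t) - \<rho> (X s t)" if "-r \<le> s" "s \<le> s'" "s' \<le> r" "\<bar>t\<bar> \<le> r" for s s' t
  proof (cases "s = s'")
    case False
    then have "s < s'" using that by simp
    moreover have "((\<lambda>s. \<rho> (X s t)) has_real_derivative D1 (X z t)) (at z)" if "s \<le> z" "z \<le> s'" for z
    proof -
      have "X z t \<in> V" using that \<open>-r \<le> s\<close> \<open>s' \<le> r\<close> \<open>\<bar>t\<bar> \<le> r\<close> by (intro X) auto
      then show ?thesis using \<open>V \<subseteq> U\<close> by (intro ds) auto
    qed
    ultimately obtain z where z: "s < z" "z < s'" "\<rho> (X s' t) - \<rho> (X s t) = (s' - s) * D1 (X z t)"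
      using MVT2[of s s' "\<lambda>s. \<rho> (X s t)" "\<lambda>s. D1 (X s t)"] by blast
    then have "X z t \<in> V" using that by (intro X) auto
    then have "c \<le> D1 (X z t)" by (auto simp: V_def)
    then show ?thesis using z that mult_left_mono[of c "D1 (X z t)" "s' - s"] by (simp add: mult.commute)
  qed simp
  have lip: "\<bar>\<rho> (X s t') - \<rho> (X s t)\<bar> \<le> C * \<bar>t' - t\<bar>" if "\<bar>s\<bar> \<le> r" "\<bar>t\<bar> \<le> r" "\<bar>t'\<bar> \<le> r" for s t t'
  proof -
    have "norm (\<rho> (X s t') - \<rho> (X s t)) \<le> C * norm (t' - t)"
    proof (rule field_differentiable_bound[of "{-r..r}" "\<lambda>t. \<rho> (X s t)" "\<lambda>t. D2 (X s t)"])
      fix z assume "z \<in> {-r..r}"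
      then have "X s z \<in> V" using that by (intro X) auto
      then show "((\<lambda>t. \<rho> (X s t)) has_field_derivative D2 (X s z)) (at z within {-r..r})" "norm (D2 (X s z)) \<le> C"
        using dt[of s z] \<open>V \<subseteq> U\<close> by (auto simp: V_def has_field_derivative_at_within abs_le_iff)
    qed (use that in auto)
    then show ?thesis by simp
  qed
  have X00: "\<rho> (X 0 0) = 0" using \<rho>(2) by (simp add: X_def)
  \<comment> \<open>For \<open>\<bar>t\<bar> < e\<close> the change of \<open>\<rho>\<close> along
    \<open>e2\<close>, below \<open>C * e\<close>, cannot outweigh the change \<open>c * r\<close>
    along \<open>e1\<close>; so \<open>\<rho>\<close> has opposite signs at \<open>s = r\<close> and
    \<open>s = -r\<close>.\<close>
  define e where "e = min r (c * r / C)"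
  have "e > 0" "e \<le> r" "C * e \<le> c * r" using \<open>c > 0\<close> \<open>C > 0\<close> \<open>r > 0\<close> by (auto simp: e_def min_def field_simps)
  have ex: "\<exists>s. \<bar>s\<bar> < r \<and> \<rho> (X s t) = 0" if "\<bar>t\<bar> < e" for t
  proof -
    have "C * \<bar>t\<bar> < C * e" using that \<open>C > 0\<close> by simp
    then have Ct: "C * \<bar>t\<bar> < c * r" using \<open>C * e \<le> c * r\<close> by linarith
    have "\<rho> (X r t) > 0"
      using mono[of 0 r 0] lip[of r 0 t] X00 Ct that \<open>e \<le> r\<close> \<open>r > 0\<close> by simp
    moreover have "\<rho> (X (-r) t) < 0"
      using mono[of "-r" 0 0] lip[of "-r" 0 t] X00 Ct that \<open>e \<le> r\<close> \<open>r > 0\<close> by simp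
    moreover have "\<forall>x. -r \<le> x \<and> x \<le> r \<longrightarrow> isCont (\<lambda>s. \<rho> (X s t)) x"
    proof (intro allI impI)
      fix x assume "-r \<le> x \<and> x \<le> r"
      then have "X x t \<in> V" using that \<open>e \<le> r\<close> by (intro X) auto
      then show "isCont (\<lambda>s. \<rho> (X s t)) x" using \<open>V \<subseteq> U\<close> by (intro DERIV_isCont[OF ds]) auto
    qed
    ultimately obtain s where "-r \<le> s" "s \<le> r" "\<rho> (X s t) = 0"
      using IVT[of "\<lambda>s. \<rho> (X s t)" "-r" 0 r] \<open>r > 0\<close> by auto
    moreover have "s \<noteq> r" "s \<noteq> -r" using \<open>\<rho> (X r t) > 0\<close> \<open>\<rho> (X (-r) t) < 0\<close> \<open>\<rho> (X s t) = 0\<close> by auto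
    ultimately show ?thesis by (intro exI[of _ s]) (auto simp: abs_less_iff)
  qed
  define G where "G t = (SOME s. \<bar>s\<bar> < r \<and> \<rho> (X s t) = 0)" for t
  have G: "\<bar>G t\<bar> < r" "\<rho> (X (G t) t) = 0" if "\<bar>t\<bar> < e" for t
    using someI_ex[OF ex[OF that]] unfolding G_def by auto
  have monoabs: "c * \<bar>s' - s\<bar> \<le> \<bar>\<rho> (X s' t) - \<rho> (X s t)\<bar>" if "\<bar>s\<bar> \<le> r" "\<bar>s'\<bar> \<le> r" "\<bar>t\<bar> \<le> r" for s s' t
  proof (cases "s \<le> s'")
    case True
    then have "c * (s' - s) \<le> \<rho> (X s' t) - \<rho> (X s t)" using that by (intro mono) auto
    then show ?thesis using True by simp
  next
    case False
    then have "c * (s - s') \<le> \<rho> (X s t) - \<rho> (X s' t)" using that by (intro mono) auto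
    then show ?thesis using False by simp
  qed
  \<comment> \<open>Both points are zeros of \<open>\<rho>\<close>. Comparing them through the
    corner with coordinates \<open>G t\<close> and \<open>t'\<close>, growth along \<open>e1\<close>
    is paid for by variation along \<open>e2\<close>. Continuity of the chosen root thus comes from
    monotonicity alone.\<close>
  have Glip: "c * \<bar>G t' - G t\<bar> \<le> C * \<bar>t' - t\<bar>" if "\<bar>t\<bar> < e" "\<bar>t'\<bar> < e" for t t'
    using monoabs[of "G t" "G t'" t'] lip[of "G t" t t'] G[of t] G[of t'] that \<open>e \<le> r\<close> by simp
  have "G 0 = 0"
    using monoabs[of 0 "G 0" 0] G[of 0] X00 \<open>e > 0\<close> \<open>c > 0\<close> \<open>r > 0\<close> by (simp add: mult_le_0_iff)
  define \<gamma> where "\<gamma> t = X (G t) t" for t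
  have \<gamma>V: "\<gamma> t \<in> V" if "\<bar>t\<bar> < e" for t
    unfolding \<gamma>_def using G[OF that] that \<open>e \<le> r\<close> by (intro X) auto
  define Q where "Q x = - D2 x / D1 x" for x
  have G': "(G has_real_derivative Q (\<gamma> t)) (at t)" if t: "\<bar>t\<bar> < e" for t
    unfolding has_field_derivative_def has_derivative_at_alt
  proof (intro conjI allI impI)
    show "bounded_linear ((*) (Q (\<gamma> t)))" by (rule bounded_linear_mult_right)
    fix \<epsilon> :: real assume "\<epsilon> > 0"
    define y where "y = \<gamma> t"
    have y: "y \<in> V" "y \<in> U" using \<gamma>V[OF t] \<open>V \<subseteq> U\<close> by (auto simp: y_def)
    then have "D1 y > c" by (auto simp: V_def)
    define M where "M = C / c * norm e1 + norm e2 + 1"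
    have "M > 0" using \<open>c > 0\<close> \<open>C > 0\<close> by (simp add: M_def add_nonneg_pos)
    \<comment> \<open>Since \<open>\<gamma>\<close> moves by at most
      \<open>M * \<bar>t' - t\<bar>\<close>, the linearisation error is at most
      \<open>\<epsilon> * c * \<bar>t' - t\<bar>\<close>; division by \<open>D1 y > c\<close> then
      leaves \<open>\<epsilon>\<close>.\<close>
    define \<eta> where "\<eta> = \<epsilon> * c / M"
    have "\<eta> > 0" using \<open>\<epsilon> > 0\<close> \<open>c > 0\<close> \<open>M > 0\<close> by (simp add: \<eta>_def)
    obtain d where d: "d > 0" "\<And>z. norm (z - y) < d \<Longrightarrow> norm (\<rho> z - \<rho> y - frechet_derivative \<rho> (at y) (z - y)) \<le> \<eta> * norm (z - y)"
      using der[OF y(2)] \<open>\<eta> > 0\<close> unfolding has_derivative_at_alt by blast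
    define d' where "d' = min (d / M) (e - \<bar>t\<bar>)"
    have "d' > 0" using d \<open>M > 0\<close> t by (simp add: d'_def)
    moreover have "norm (G t' - G t - Q (\<gamma> t) * (t' - t)) \<le> \<epsilon> * norm (t' - t)" if t': "norm (t' - t) < d'" for t'
    proof -
      have "\<bar>t'\<bar> < e" using t' by (auto simp: d'_def)
      have h: "\<gamma> t' - y = (G t' - G t) *\<^sub>R e1 + (t' - t) *\<^sub>R e2"
        by (simp add: y_def \<gamma>_def X_def algebra_simps)
      have "\<bar>G t' - G t\<bar> \<le> C / c * \<bar>t' - t\<bar>"
        using Glip[OF t \<open>\<bar>t'\<bar> < e\<close>] \<open>c > 0\<close> by (simp add: field_simps)
      then have "\<bar>G t' - G t\<bar> * norm e1 + \<bar>t' - t\<bar> * norm e2 \<le> C / c * \<bar>t' - t\<bar> * norm e1 + \<bar>t' - t\<bar> * norm e2"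
        by (intro add_mono mult_right_mono) auto
      moreover have "norm (\<gamma> t' - y) \<le> \<bar>G t' - G t\<bar> * norm e1 + \<bar>t' - t\<bar> * norm e2"
        unfolding h by (rule order_trans[OF norm_triangle_ineq]) simp
      moreover have "C / c * \<bar>t' - t\<bar> * norm e1 + \<bar>t' - t\<bar> * norm e2 \<le> M * \<bar>t' - t\<bar>"
        by (simp add: M_def distrib_right algebra_simps)
      ultimately have nh: "norm (\<gamma> t' - y) \<le> M * \<bar>t' - t\<bar>" by linarith
      moreover have "M * \<bar>t' - t\<bar> < d" using t' \<open>M > 0\<close> by (simp add: d'_def field_simps)
      ultimately have "norm (\<gamma> t' - y) < d" by linarith
      then have "\<bar>\<rho> (\<gamma> t') - \<rho> y - frechet_derivative \<rho> (at y) (\<gamma> t' - y)\<bar> \<le> \<eta> * norm (\<gamma> t' - y)"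
        using d(2) by simp
      moreover have "\<rho> (\<gamma> t') = 0" "\<rho> y = 0"
        using G(2)[OF t] G(2)[OF \<open>\<bar>t'\<bar> < e\<close>] by (auto simp: \<gamma>_def y_def)
      moreover have "frechet_derivative \<rho> (at y) (\<gamma> t' - y) = (G t' - G t) * D1 y + (t' - t) * D2 y"
        unfolding h D1_def D2_def using linear_frechet_derivative[OF smooth_on_differentiable[OF \<rho>(1) y(2)]]
        by (simp add: linear_add linear_scale)
      ultimately have "\<bar>(G t' - G t) * D1 y + (t' - t) * D2 y\<bar> \<le> \<eta> * norm (\<gamma> t' - y)"
        by (simp add: abs_minus_commute)
      also have "\<dots> \<le> \<eta> * (M * \<bar>t' - t\<bar>)" using nh \<open>\<eta> > 0\<close> by (intro mult_left_mono) auto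
      also have "\<dots> = c * (\<epsilon> * \<bar>t' - t\<bar>)" using \<open>M > 0\<close> by (simp add: \<eta>_def)
      also have "\<dots> \<le> D1 y * (\<epsilon> * \<bar>t' - t\<bar>)" using \<open>D1 y > c\<close> \<open>\<epsilon> > 0\<close> by (intro mult_right_mono) auto
      finally have "\<bar>(G t' - G t) * D1 y + (t' - t) * D2 y\<bar> \<le> D1 y * (\<epsilon> * \<bar>t' - t\<bar>)" .
      moreover have "(G t' - G t) * D1 y + (t' - t) * D2 y = D1 y * (G t' - G t - Q y * (t' - t))"
        using \<open>D1 y > c\<close> \<open>c > 0\<close> by (simp add: Q_def field_simps)
      ultimately show ?thesis
        using \<open>D1 y > c\<close> \<open>c > 0\<close> by (simp add: abs_mult y_def)
    qed
    ultimately show "\<exists>d>0. \<forall>t'. norm (t' - t) < d \<longrightarrow> norm (G t' - G t - Q (\<gamma> t) * (t' - t)) \<le> \<epsilon> * norm (t' - t)"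
      by blast
  qed
  have \<gamma>': "(\<gamma> has_vector_derivative (Q (\<gamma> t) *\<^sub>R e1 + e2)) (at t)" if "\<bar>t\<bar> < e" for t
  proof -
    have "((\<lambda>t. p + G t *\<^sub>R e1 + t *\<^sub>R e2) has_vector_derivative (0 + Q (\<gamma> t) *\<^sub>R e1 + 1 *\<^sub>R e2)) (at t)"
      using G'[OF that] by (intro has_vector_derivative_add has_vector_derivative_const)
        (auto intro!: derivative_eq_intros simp: has_real_derivative_iff_has_vector_derivative)
    then show ?thesis by (simp add: \<gamma>_def[abs_def] X_def)
  qed
  have smV: "n_smooth_on n V q" if "n_smooth_on n U q" for n q
    using that \<open>V \<subseteq> U\<close> by (induction n arbitrary: q) auto
  have QV: "n_smooth_on n V Q" for n
  proof -
    have "n_smooth_on n U D1" "n_smooth_on n U D2"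
      unfolding D1_def D2_def by (intro n_smooth_on_directional assms(1) smooth_on_imp_n_smooth_on \<rho>(1))+
    then have "n_smooth_on n V (\<lambda>x. (-1) * D2 x * inverse (D1 x))"
      using \<open>c > 0\<close> by (intro n_smooth_on_mult n_smooth_on_inverse n_smooth_on_const \<open>open V\<close> smV) (auto simp: V_def)
    then show ?thesis by (simp add: Q_def[abs_def] divide_inverse)
  qed
  \<comment> \<open>The derivative along the velocity field \<open>Q e1 + e2\<close> of the curve.
    It maps smooth functions on \<open>V\<close> to smooth functions on \<open>V\<close>.\<close>
  define \<Lambda> where "\<Lambda> q x = Q x * frechet_derivative q (at x) e1 + frechet_derivative q (at x) e2" for q x
  have \<Lambda>: "n_smooth_on n V (\<Lambda> q)" if "\<And>n. n_smooth_on n V q" for n q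
    unfolding \<Lambda>_def by (intro n_smooth_on_add n_smooth_on_mult n_smooth_on_directional \<open>open V\<close> QV that)
  have q\<gamma>: "((\<lambda>t. q (\<gamma> t)) has_real_derivative \<Lambda> q (\<gamma> t)) (at t)" if "\<And>n. n_smooth_on n V q" "\<bar>t\<bar> < e" for q t
  proof -
    have dq: "q differentiable (at (\<gamma> t))" using that(1)[of "Suc 0"] \<gamma>V[OF that(2)] by simp
    from has_derivative_compose[OF \<gamma>'[OF that(2), unfolded has_vector_derivative_def] dq[unfolded frechet_derivative_works]]
    have "((\<lambda>t. q (\<gamma> t)) has_derivative (\<lambda>h. frechet_derivative q (at (\<gamma> t)) (h *\<^sub>R (Q (\<gamma> t) *\<^sub>R e1 + e2)))) (at t)" .
    moreover have "(\<lambda>h. frechet_derivative q (at (\<gamma> t)) (h *\<^sub>R (Q (\<gamma> t) *\<^sub>R e1 + e2))) = (*) (\<Lambda> q (\<gamma> t))"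
      using linear_frechet_derivative[OF dq] by (simp add: fun_eq_iff linear_scale linear_add \<Lambda>_def algebra_simps)
    ultimately show ?thesis by (simp add: has_field_derivative_def)
  qed
  let ?I = "{-e<..<e}"
  \<comment> \<open>The constant \<open>k\<close> is \<open>e2\<close> for the first derivative and
    0 for the higher ones; the coefficient \<open>q\<close> is \<open>Q\<close> at first and is then
    transformed by \<open>\<Lambda>\<close>.\<close>
  have it: "\<exists>q k. (\<forall>n. n_smooth_on n V q) \<and> (\<forall>t\<in>?I. iter_deriv vs \<gamma> t = q (\<gamma> t) *\<^sub>R e1 + k)"
    if "set vs \<subseteq> (Basis :: real set)" "vs \<noteq> []" for vs
    using that
  proof (induction vs)
    case (Cons v vs)
    then have [simp]: "v = 1" by simp
    show ?case
    proof (cases "vs = []")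
      case True
      have "iter_deriv (v # vs) \<gamma> t = Q (\<gamma> t) *\<^sub>R e1 + e2" if "t \<in> ?I" for t
        using frechet_derivative_eqI[OF \<gamma>'[of t, unfolded has_vector_derivative_def]] that True by auto
      then show ?thesis using QV by blast
    next
      case False
      then obtain q k where q: "\<And>n. n_smooth_on n V q" "\<And>t. t \<in> ?I \<Longrightarrow> iter_deriv vs \<gamma> t = q (\<gamma> t) *\<^sub>R e1 + k"
        using Cons.IH[OF _ False] Cons.prems(1) by auto metis
      have "iter_deriv (v # vs) \<gamma> t = \<Lambda> q (\<gamma> t) *\<^sub>R e1 + 0" if "t \<in> ?I" for t
      proof -
        have "((\<lambda>t. q (\<gamma> t) *\<^sub>R e1 + k) has_derivative (\<lambda>h. (h * \<Lambda> q (\<gamma> t)) *\<^sub>R e1)) (at t)"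
        proof -
          have "((\<lambda>t. q (\<gamma> t)) has_derivative (\<lambda>h. h * \<Lambda> q (\<gamma> t))) (at t)"
            using q\<gamma>[OF q(1), of t] that by (simp add: has_field_derivative_def mult_commute_abs abs_less_iff)
          then show ?thesis by (auto intro!: derivative_eq_intros)
        qed
        from frechet_derivative_eqI[OF this] show ?thesis
          using differentiable_cong_open(2)[of ?I t "iter_deriv vs \<gamma>" "\<lambda>t. q (\<gamma> t) *\<^sub>R e1 + k"] q(2) that by simp
      qed
      then show ?thesis using \<Lambda>[OF q(1)] by blast
    qed
  qed simp
  have sm: "smooth_on ?I \<gamma>"
    unfolding smooth_on_def
  proof (intro allI impI ballI)
    fix vs t assume vs: "set vs \<subseteq> (Basis :: real set)" and t: "t \<in> ?I"
    show "iter_deriv vs \<gamma> differentiable (at t)"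
    proof (cases "vs = []")
      case True
      then show ?thesis using \<gamma>'[of t] t by (auto simp: has_vector_derivative_def differentiable_def abs_less_iff)
    next
      case False
      then obtain q k where q: "\<And>n. n_smooth_on n V q" "\<And>t. t \<in> ?I \<Longrightarrow> iter_deriv vs \<gamma> t = q (\<gamma> t) *\<^sub>R e1 + k"
        using it[OF vs] by blast
      have "(\<lambda>t. q (\<gamma> t) *\<^sub>R e1 + k) differentiable (at t)"
        using q\<gamma>[OF q(1), of t] t
        by (intro derivative_intros) (auto simp: has_field_derivative_def differentiable_def abs_less_iff)
      then show ?thesis
        using differentiable_cong_open(1)[of ?I t "iter_deriv vs \<gamma>" "\<lambda>t. q (\<gamma> t) *\<^sub>R e1 + k"] q(2) t by simp
    qed
  qed
  show ?thesis
  proof (rule that[of e \<gamma> "\<lambda>t. Q (\<gamma> t)"])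
    show "\<gamma> 0 = p" by (simp add: \<gamma>_def X_def \<open>G 0 = 0\<close>)
    then show "Q (\<gamma> 0) = - frechet_derivative \<rho> (at p) e2 / frechet_derivative \<rho> (at p) e1"
      by (simp add: Q_def D1_def D2_def)
    show "\<gamma> t \<in> U \<and> \<rho> (\<gamma> t) = 0 \<and> (\<gamma> has_vector_derivative (Q (\<gamma> t) *\<^sub>R e1 + e2)) (at t)" if "t \<in> ?I" for t
      using that \<gamma>V[of t] \<open>V \<subseteq> U\<close> G(2)[of t] \<gamma>'[of t] by (auto simp: \<gamma>_def)
  qed (use \<open>e > 0\<close> sm in auto)
qed

section \<open>Lines meeting the boundary of a smooth domain\<close>

definition boundary_chart :: "(real^2) set \<Rightarrow> (real^2) set \<Rightarrow> (real^2 \<Rightarrow> real) \<Rightarrow> bool" where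
  "boundary_chart \<Omega> U \<rho> \<longleftrightarrow> open U \<and> smooth_on U \<rho> \<and>
     (\<forall>x\<in>U. frechet_derivative \<rho> (at x) \<noteq> (\<lambda>_. 0)) \<and> \<Omega> \<inter> U = {x \<in> U. \<rho> x \<le> 0}"

lemma compact_smooth_domain_chart:
  assumes "compact_smooth_domain \<Omega>" "p \<in> frontier \<Omega>"
  obtains U \<rho> where "boundary_chart \<Omega> U \<rho>" "p \<in> U"
proof -
  have "\<forall>p\<in>frontier \<Omega>. \<exists>U \<rho>. boundary_chart \<Omega> U \<rho> \<and> p \<in> U"
    using assms(1) unfolding compact_smooth_domain_def boundary_chart_def by meson
  with assms(2) that show ?thesis by blast
qed

text \<open>Where \<open>\<rho>\<close> is not 0, continuity puts the point into the interior of the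
  domain or of its complement. A zero of \<open>\<rho>\<close> in the interior would be a local
  maximum, against the nonvanishing derivative.\<close>

lemma boundary_chart_frontier:
  assumes c: "boundary_chart \<Omega> U \<rho>" and "x \<in> U"
  shows "x \<in> frontier \<Omega> \<longleftrightarrow> \<rho> x = 0"
proof
  have U: "open U" and sm: "smooth_on U \<rho>" and "\<Omega> \<inter> U = {x \<in> U. \<rho> x \<le> 0}"
    and nz: "frechet_derivative \<rho> (at x) \<noteq> (\<lambda>_. 0)"
    using c \<open>x \<in> U\<close> unfolding boundary_chart_def by blast+
  then have eq: "\<And>y. y \<in> U \<Longrightarrow> y \<in> \<Omega> \<longleftrightarrow> \<rho> y \<le> 0" by blast
  have cont: "continuous_on U \<rho>"
    using smooth_on_differentiable[OF sm] by (intro continuous_at_imp_continuous_on ballI differentiable_imp_continuous_within)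
  {
    assume x: "x \<in> frontier \<Omega>"
    show "\<rho> x = 0"
    proof (rule ccontr)
      assume "\<rho> x \<noteq> 0"
      then consider "\<rho> x < 0" | "\<rho> x > 0" by linarith
      then show False
      proof cases
        case 1
        have "open (U \<inter> \<rho> -` {..<0})" using cont U by (intro continuous_open_preimage) auto
        moreover have "x \<in> U \<inter> \<rho> -` {..<0}" "U \<inter> \<rho> -` {..<0} \<subseteq> \<Omega>" using 1 \<open>x \<in> U\<close> eq by auto
        ultimately have "x \<in> interior \<Omega>" by (meson interiorI)
        with x show False by (simp add: frontier_def)
      next
        case 2
        have "open (U \<inter> \<rho> -` {0<..})" using cont U by (intro continuous_open_preimage) auto
        moreover have "x \<in> U \<inter> \<rho> -` {0<..}" "U \<inter> \<rho> -` {0<..} \<inter> \<Omega> = {}" using 2 \<open>x \<in> U\<close> eq by auto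
        ultimately have "x \<notin> closure \<Omega>" using open_Int_closure_eq_empty by blast
        with x show False by (simp add: frontier_def)
      qed
    qed
  next
    assume "\<rho> x = 0"
    then have "x \<in> \<Omega>" using eq \<open>x \<in> U\<close> by auto
    moreover have "x \<notin> interior \<Omega>"
    proof
      assume "x \<in> interior \<Omega>"
      have "\<forall>y\<in>interior \<Omega> \<inter> U. \<rho> y \<le> \<rho> x" using eq interior_subset[of \<Omega>] \<open>\<rho> x = 0\<close> by auto
      then have "frechet_derivative \<rho> (at x) = (\<lambda>_. 0)"
        using differential_zero_maxmin[of x "interior \<Omega> \<inter> U" \<rho> "frechet_derivative \<rho> (at x)"]
          smooth_on_differentiable[OF sm \<open>x \<in> U\<close>] \<open>x \<in> interior \<Omega>\<close> \<open>x \<in> U\<close> U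
        by (auto simp: frechet_derivative_works)
      with nz show False by contradiction
    qed
    ultimately show "x \<in> frontier \<Omega>" using closure_subset[of \<Omega>] by (auto simp: frontier_def)
  }
qed

section \<open>The orthonormal frame of a direction and tangency\<close>

lemma direction_inner: "direction \<alpha> \<bullet> direction \<beta> = cos (\<alpha> - \<beta>)"
  by (simp add: direction_def inner_vec_def UNIV_2 cos_diff)

lemma direction_orthonormal:
  "direction \<theta> \<bullet> direction \<theta> = 1" "direction (\<theta> + pi / 2) \<bullet> direction (\<theta> + pi / 2) = 1"
  "direction \<theta> \<bullet> direction (\<theta> + pi / 2) = 0" "direction (\<theta> + pi / 2) \<bullet> direction \<theta> = 0"
  by (simp_all add: direction_inner)

lemma direction_expand:
  "v = (v \<bullet> direction \<theta>) *\<^sub>R direction \<theta> + (v \<bullet> direction (\<theta> + pi / 2)) *\<^sub>R direction (\<theta> + pi / 2)"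
proof -
  have "cos \<theta> * (cos \<theta> * x) + sin \<theta> * (sin \<theta> * x) = (cos \<theta> * cos \<theta> + sin \<theta> * sin \<theta>) * x" for x
    by (simp only: distrib_right mult.assoc)
  then have sq: "cos \<theta> * (cos \<theta> * x) + sin \<theta> * (sin \<theta> * x) = x" for x
    by (simp only: sin_cos_squared_add3 mult_1)
  show ?thesis
    by (simp add: vec_eq_iff forall_2 direction_def inner_vec_def UNIV_2 cos_add sin_add algebra_simps sq)
qed

lemma norm_direction [simp]: "norm (direction \<theta>) = 1"
  by (simp add: norm_eq_sqrt_inner direction_orthonormal)

lemma direction_pythagoras: "(v \<bullet> direction \<theta>)\<^sup>2 + (v \<bullet> direction (\<theta> + pi / 2))\<^sup>2 = (norm v)\<^sup>2"
proof -
  have "(norm v)\<^sup>2 = v \<bullet> ((v \<bullet> direction \<theta>) *\<^sub>R direction \<theta> + (v \<bullet> direction (\<theta> + pi / 2)) *\<^sub>R direction (\<theta> + pi / 2))"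
    using direction_expand[of v \<theta>] by (simp add: power2_norm_eq_inner)
  then show ?thesis by (simp add: inner_add_right power2_eq_square)
qed

lemma boundary_chart_gradient:
  assumes "boundary_chart \<Omega> U \<rho>" "x \<in> U" "frechet_derivative \<rho> (at x) (direction (\<theta> + pi / 2)) = 0"
  shows "frechet_derivative \<rho> (at x) (direction \<theta>) \<noteq> 0"
proof
  assume *: "frechet_derivative \<rho> (at x) (direction \<theta>) = 0"
  have "linear (frechet_derivative \<rho> (at x))"
    using assms(1,2) by (intro linear_frechet_derivative smooth_on_differentiable) (auto simp: boundary_chart_def)
  then have "frechet_derivative \<rho> (at x) v = 0" for v
    by (subst direction_expand[of v \<theta>]) (simp add: linear_add linear_scale * assms(3))
  then have "frechet_derivative \<rho> (at x) = (\<lambda>_. 0)" by (rule ext)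
  then show False using assms(1,2) by (auto simp: boundary_chart_def)
qed

text \<open>Replaces curves by a condition on the chart. In one direction \<open>\<rho>\<close> is
  constant along the curve and its velocity is a nonzero multiple of the direction of the line. In
  the other, the gradient is normal to the line and the implicit curve has the required
  velocity.\<close>

lemma tangent_point_iff:
  assumes c: "boundary_chart \<Omega> U \<rho>" and p: "p \<in> U" "p \<in> frontier \<Omega>" "p \<in> line s \<theta>"
  shows "p \<in> tangent_points \<Omega> s \<theta> \<longleftrightarrow> frechet_derivative \<rho> (at p) (direction (\<theta> + pi / 2)) = 0"
proof
  define e1 where "e1 = direction \<theta>"
  define e2 where "e2 = direction (\<theta> + pi / 2)"
  have U: "open U" and sm: "smooth_on U \<rho>" using c by (auto simp: boundary_chart_def)
  have der: "(\<rho> has_derivative frechet_derivative \<rho> (at p)) (at p)"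
    using smooth_on_differentiable[OF sm p(1)] by (simp add: frechet_derivative_works)
  have lin: "linear (frechet_derivative \<rho> (at p))"
    using smooth_on_differentiable[OF sm p(1)] by (rule linear_frechet_derivative)
  {
    assume "p \<in> tangent_points \<Omega> s \<theta>"
    then obtain \<gamma> where \<gamma>: "regular_curve_at (frontier \<Omega>) p \<gamma>" "vector_derivative \<gamma> (at 0) \<bullet> e1 = 0"
      unfolding tangent_points_def e1_def by blast
    then obtain e where e: "e > 0" "\<gamma> 0 = p" "smooth_on {-e<..<e} \<gamma>" "\<And>t. t \<in> {-e<..<e} \<Longrightarrow> \<gamma> t \<in> frontier \<Omega>"
      "\<And>t. t \<in> {-e<..<e} \<Longrightarrow> vector_derivative \<gamma> (at t) \<noteq> 0"
      unfolding regular_curve_at_def by blast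
    define v where "v = vector_derivative \<gamma> (at 0)"
    have "\<gamma> differentiable (at 0)" using smooth_on_differentiable[OF e(3)] e(1) by auto
    then have "(\<gamma> has_vector_derivative v) (at 0)"
      unfolding v_def by (simp add: vector_derivative_works)
    then have \<gamma>': "(\<gamma> has_derivative (\<lambda>h. h *\<^sub>R v)) (at 0)" by (simp add: has_vector_derivative_def)
    have "((\<lambda>t. \<rho> (\<gamma> t)) has_derivative (\<lambda>h. frechet_derivative \<rho> (at p) (h *\<^sub>R v))) (at 0)"
      using has_derivative_compose[OF \<gamma>', of \<rho> "frechet_derivative \<rho> (at p)"] der e(2) by simp
    moreover have "((\<lambda>t. \<rho> (\<gamma> t)) has_derivative (\<lambda>_. 0)) (at 0)"
    proof -
      have "isCont \<gamma> 0" using \<open>\<gamma> differentiable (at 0)\<close> by (rule differentiable_imp_continuous_within)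
      then have "(\<gamma> \<longlongrightarrow> \<gamma> 0) (nhds 0)" by (simp only: isCont_def tendsto_at_iff_tendsto_nhds)
      then have "\<forall>\<^sub>F t in nhds 0. \<gamma> t \<in> U"
        using topological_tendstoD[OF _ U] p(1) e(2) by auto
      moreover have "\<forall>\<^sub>F t in nhds 0. t \<in> {-e<..<e}"
        using e(1) by (intro eventually_nhds_in_open) auto
      ultimately have "\<forall>\<^sub>F t in nhds 0. \<rho> (\<gamma> t) = 0"
        by eventually_elim (use boundary_chart_frontier[OF c] e(4) in auto)
      then obtain S where "open S" "0 \<in> S" "\<And>t. t \<in> S \<Longrightarrow> \<rho> (\<gamma> t) = 0"
        unfolding eventually_nhds by blast
      then show ?thesis
        using has_derivative_transform_within_open[OF has_derivative_const[of 0 "at 0"], of S "\<lambda>t. \<rho> (\<gamma> t)"] by simp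
    qed
    ultimately have "(\<lambda>h. frechet_derivative \<rho> (at p) (h *\<^sub>R v)) = (\<lambda>_. 0)" by (rule has_derivative_unique)
    then have "frechet_derivative \<rho> (at p) (1 *\<^sub>R v) = 0" by (rule fun_cong)
    moreover have v: "v = (v \<bullet> e2) *\<^sub>R e2"
      using direction_expand[of v \<theta>] \<gamma>(2) by (simp add: v_def e1_def e2_def)
    moreover have "v \<bullet> e2 \<noteq> 0" using v e(5)[of 0] e(1) by (auto simp: v_def)
    ultimately show "frechet_derivative \<rho> (at p) (direction (\<theta> + pi / 2)) = 0"
      using lin linear_scale[OF lin, of "v \<bullet> e2" e2] by (simp add: e2_def)
  next
    assume 0: "frechet_derivative \<rho> (at p) (direction (\<theta> + pi / 2)) = 0"
    have "frechet_derivative \<rho> (at p) e1 \<noteq> 0"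
      unfolding e1_def by (rule boundary_chart_gradient[OF c p(1) 0])
    \<comment> \<open>The implicit curve needs a positive derivative; using the derivative itself as
      scaling factor makes it a nonzero square.\<close>
    then have "\<exists>a. frechet_derivative \<rho> (at p) (a *\<^sub>R e1) > 0"
      by (intro exI[of _ "frechet_derivative \<rho> (at p) e1"]) (auto simp: linear_scale[OF lin] zero_less_mult_iff neq_iff)
    then obtain a where a: "frechet_derivative \<rho> (at p) (a *\<^sub>R e1) > 0" ..
    have "\<rho> p = 0" using boundary_chart_frontier[OF c p(1)] p(2) by simp
    obtain \<gamma> e q where \<gamma>: "e > 0" "\<gamma> 0 = p" "smooth_on {-e<..<e} \<gamma>"
      "\<And>t. t \<in> {-e<..<e} \<Longrightarrow> \<gamma> t \<in> U \<and> \<rho> (\<gamma> t) = 0 \<and> (\<gamma> has_vector_derivative (q t *\<^sub>R (a *\<^sub>R e1) + e2)) (at t)"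
      "q 0 = - frechet_derivative \<rho> (at p) e2 / frechet_derivative \<rho> (at p) (a *\<^sub>R e1)"
      by (rule implicit_curve[OF U p(1) sm \<open>\<rho> p = 0\<close> a, of e2]) (rule that)
    have vd: "vector_derivative \<gamma> (at t) = q t *\<^sub>R (a *\<^sub>R e1) + e2" if "t \<in> {-e<..<e}" for t
      using \<gamma>(4)[OF that] by (auto intro: vector_derivative_at)
    have "vector_derivative \<gamma> (at t) \<noteq> 0" if "t \<in> {-e<..<e}" for t
    proof -
      have "vector_derivative \<gamma> (at t) \<bullet> e2 = 1"
        unfolding vd[OF that] by (simp add: inner_add_left e1_def e2_def direction_orthonormal)
      then show ?thesis by auto
    qed
    moreover have "\<gamma> t \<in> frontier \<Omega>" if "t \<in> {-e<..<e}" for t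
      using \<gamma>(4)[OF that] boundary_chart_frontier[OF c] by auto
    ultimately have "regular_curve_at (frontier \<Omega>) p \<gamma>"
      using \<gamma>(1-3) unfolding regular_curve_at_def by blast
    moreover have "vector_derivative \<gamma> (at 0) \<bullet> direction \<theta> = 0"
      using vd[of 0] \<gamma>(1,5) 0 by (simp add: e2_def direction_orthonormal)
    ultimately show "p \<in> tangent_points \<Omega> s \<theta>"
      using p unfolding tangent_points_def by blast
  }
qed

section \<open>Coordinates along the lines and mean values\<close>

lemma smooth_on_MVT:
  fixes \<rho> :: "'a::euclidean_space \<Rightarrow> real"
  assumes "smooth_on U \<rho>" "a < b" "\<And>z. a \<le> z \<Longrightarrow> z \<le> b \<Longrightarrow> y + z *\<^sub>R v \<in> U"
  shows "\<exists>z. a < z \<and> z < b \<and> \<rho> (y + b *\<^sub>R v) - \<rho> (y + a *\<^sub>R v) = (b - a) * frechet_derivative \<rho> (at (y + z *\<^sub>R v)) v"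
proof (rule MVT2[OF assms(2)])
  fix z assume z: "a \<le> z" "z \<le> b"
  have d: "\<rho> differentiable (at (y + z *\<^sub>R v))" using smooth_on_differentiable[OF assms(1)] assms(3)[OF z] by blast
  have "((\<lambda>z. y + z *\<^sub>R v) has_derivative (\<lambda>h. h *\<^sub>R v)) (at z)" by (auto intro!: derivative_eq_intros)
  from has_derivative_compose[OF this d[unfolded frechet_derivative_works]]
  show "((\<lambda>z. \<rho> (y + z *\<^sub>R v)) has_real_derivative frechet_derivative \<rho> (at (y + z *\<^sub>R v)) v) (at z)"
    using linear_frechet_derivative[OF d] by (simp add: has_field_derivative_def linear_scale mult_commute_abs)
qed

text \<open>\<open>s\<close> selects the line and \<open>t\<close> is arc length on it, in agreement
  with the parametrization in \<open>line_integral\<close>.\<close>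

definition line_point :: "real \<Rightarrow> real \<Rightarrow> real \<Rightarrow> real^2" where
  "line_point \<theta> s t = s *\<^sub>R direction \<theta> + t *\<^sub>R direction (\<theta> + pi / 2)"

lemma line_point_inner [simp]:
  "line_point \<theta> s t \<bullet> direction \<theta> = s" "line_point \<theta> s t \<bullet> direction (\<theta> + pi / 2) = t"
  by (simp_all add: line_point_def inner_add_left direction_orthonormal)

lemma line_point_eta: "p \<bullet> direction \<theta> = s \<Longrightarrow> line_point \<theta> s (p \<bullet> direction (\<theta> + pi / 2)) = p"
  using direction_expand[of p \<theta>] by (simp add: line_point_def)

lemma dist_line_point: "dist (line_point \<theta> s t) (line_point \<theta> s' t') \<le> \<bar>s - s'\<bar> + \<bar>t - t'\<bar>"
proof -
  have "line_point \<theta> s t - line_point \<theta> s' t' = (s - s') *\<^sub>R direction \<theta> + (t - t') *\<^sub>R direction (\<theta> + pi / 2)"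
    by (simp add: line_point_def algebra_simps)
  then show ?thesis
    unfolding dist_norm using norm_triangle_ineq[of "(s - s') *\<^sub>R direction \<theta>" "(t - t') *\<^sub>R direction (\<theta> + pi / 2)"] by simp
qed

lemma line_point_nhd:
  assumes "open V" "line_point \<theta> s0 t0 \<in> V"
  obtains \<epsilon> where "\<epsilon> > 0" "\<And>x t. \<bar>x\<bar> \<le> \<epsilon> \<Longrightarrow> \<bar>t - t0\<bar> \<le> \<epsilon> \<Longrightarrow> line_point \<theta> (s0 + x) t \<in> V"
proof -
  obtain d where d: "d > 0" "ball (line_point \<theta> s0 t0) d \<subseteq> V"
    using assms open_contains_ball by blast
  show ?thesis
  proof (rule that[of "d / 3"])
    fix x t assume "\<bar>x\<bar> \<le> d / 3" "\<bar>t - t0\<bar> \<le> d / 3"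
    then have "dist (line_point \<theta> s0 t0) (line_point \<theta> (s0 + x) t) < d"
      using dist_line_point[of \<theta> s0 t0 "s0 + x" t] d(1) by (simp add: abs_minus_commute)
    then show "line_point \<theta> (s0 + x) t \<in> V" using d(2) by auto
  qed (use d in simp)
qed

lemma line_point_MVT1:
  fixes \<rho> :: "real^2 \<Rightarrow> real"
  assumes "smooth_on U \<rho>" "a < b" "\<And>z. a \<le> z \<Longrightarrow> z \<le> b \<Longrightarrow> line_point \<theta> (s0 + z) t \<in> U"
  shows "\<exists>z. a < z \<and> z < b \<and> \<rho> (line_point \<theta> (s0 + b) t) - \<rho> (line_point \<theta> (s0 + a) t) =
    (b - a) * frechet_derivative \<rho> (at (line_point \<theta> (s0 + z) t)) (direction \<theta>)"
proof -
  have "line_point \<theta> (s0 + z) t = line_point \<theta> s0 t + z *\<^sub>R direction \<theta>" for z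
    by (simp add: line_point_def algebra_simps)
  then show ?thesis using smooth_on_MVT[OF assms(1,2), of "line_point \<theta> s0 t" "direction \<theta>"] assms(3) by simp
qed

lemma line_point_MVT2:
  fixes \<rho> :: "real^2 \<Rightarrow> real"
  assumes "smooth_on U \<rho>" "a < b" "\<And>z. a \<le> z \<Longrightarrow> z \<le> b \<Longrightarrow> line_point \<theta> s z \<in> U"
  shows "\<exists>z. a < z \<and> z < b \<and> \<rho> (line_point \<theta> s b) - \<rho> (line_point \<theta> s a) =
    (b - a) * frechet_derivative \<rho> (at (line_point \<theta> s z)) (direction (\<theta> + pi / 2))"
proof -
  have "line_point \<theta> s z = s *\<^sub>R direction \<theta> + z *\<^sub>R direction (\<theta> + pi / 2)" for z
    by (simp add: line_point_def)
  then show ?thesis using smooth_on_MVT[OF assms(1,2), of "s *\<^sub>R direction \<theta>" "direction (\<theta> + pi / 2)"] assms(3) by simp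
qed

text \<open>Off the boundary, a whole neighbourhood lies in the interior or in the exterior, so both
  points lie on the same side.\<close>

lemma frontier_complement_crossing:
  assumes "line_point \<theta> s0 t0 \<notin> frontier \<Omega>"
  obtains \<epsilon> where "\<epsilon> > 0" "\<And>x t. 0 < x \<Longrightarrow> x < \<epsilon> \<Longrightarrow> \<bar>t - t0\<bar> < \<epsilon> \<Longrightarrow>
    line_point \<theta> (s0 + x) t \<in> \<Omega> \<longleftrightarrow> line_point \<theta> (s0 - x) t \<in> \<Omega>"
proof -
  define V where "V = (if line_point \<theta> s0 t0 \<in> interior \<Omega> then interior \<Omega> else - closure \<Omega>)"
  have "open V" "line_point \<theta> s0 t0 \<in> V"
    using assms by (auto simp: V_def frontier_def)
  then obtain \<epsilon> where \<epsilon>: "\<epsilon> > 0" "\<And>x t. \<bar>x\<bar> \<le> \<epsilon> \<Longrightarrow> \<bar>t - t0\<bar> \<le> \<epsilon> \<Longrightarrow> line_point \<theta> (s0 + x) t \<in> V"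
    by (rule line_point_nhd) (rule that)
  have V: "(y \<in> \<Omega>) = (line_point \<theta> s0 t0 \<in> interior \<Omega>)" if "y \<in> V" for y
    using that interior_subset[of \<Omega>] closure_subset[of \<Omega>] by (auto simp: V_def split: if_splits)
  show ?thesis
  proof (rule that[OF \<epsilon>(1)])
    fix x t assume "0 < x" "x < \<epsilon>" "\<bar>t - t0\<bar> < \<epsilon>"
    then show "line_point \<theta> (s0 + x) t \<in> \<Omega> \<longleftrightarrow> line_point \<theta> (s0 - x) t \<in> \<Omega>"
      using V[OF \<epsilon>(2)[of x t]] V[OF \<epsilon>(2)[of "-x" t]] by simp
  qed
qed

text \<open>If exactly one of the points on the lines \<open>s0 + x\<close> and
  \<open>s0 - x\<close> is in the domain, \<open>\<rho>\<close> changes sign between them and is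
  \<open>O(x)\<close> on the middle line. There it varies in \<open>t\<close> at a rate of at least
  \<open>c\<close>, so such \<open>t\<close> differ from each other by \<open>O(x)\<close>.\<close>

lemma transversal_crossing:
  assumes c: "boundary_chart \<Omega> U \<rho>" and p: "line_point \<theta> s0 t0 \<in> U"
    and tr: "frechet_derivative \<rho> (at (line_point \<theta> s0 t0)) (direction (\<theta> + pi / 2)) \<noteq> 0"
  obtains \<epsilon> C where "\<epsilon> > 0" "C \<ge> 0" "\<And>x. 0 < x \<Longrightarrow> x < \<epsilon> \<Longrightarrow>
    \<exists>l. {t. \<bar>t - t0\<bar> < \<epsilon> \<and> (line_point \<theta> (s0 + x) t \<in> \<Omega>) \<noteq> (line_point \<theta> (s0 - x) t \<in> \<Omega>)} \<subseteq> {l - C * x..l + C * x}"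
proof -
  have U: "open U" and sm: "smooth_on U \<rho>" and "\<Omega> \<inter> U = {x \<in> U. \<rho> x \<le> 0}"
    using c unfolding boundary_chart_def by blast+
  then have eq: "\<And>y. y \<in> U \<Longrightarrow> y \<in> \<Omega> \<longleftrightarrow> \<rho> y \<le> 0" by blast
  define D1 where "D1 x = frechet_derivative \<rho> (at x) (direction \<theta>)" for x
  define D2 where "D2 x = frechet_derivative \<rho> (at x) (direction (\<theta> + pi / 2))" for x
  define c where "c = \<bar>D2 (line_point \<theta> s0 t0)\<bar> / 2"
  define C1 where "C1 = \<bar>D1 (line_point \<theta> s0 t0)\<bar> + 1"
  have "c > 0" "C1 > 0" using tr by (auto simp: c_def C1_def D2_def)
  have cont: "continuous_on U D1" "continuous_on U D2"
    unfolding D1_def D2_def using U sm by (auto intro: smooth_on_directional_continuous_on)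
  define V where "V = (U \<inter> (\<lambda>x. \<bar>D2 x\<bar>) -` {c<..}) \<inter> (U \<inter> (\<lambda>x. \<bar>D1 x\<bar>) -` {..<C1})"
  have "open V"
    unfolding V_def using cont U by (intro open_Int continuous_open_preimage continuous_on_rabs) auto
  have "line_point \<theta> s0 t0 \<in> V"
    using p \<open>c > 0\<close> by (auto simp: V_def c_def C1_def)
  obtain \<epsilon> where \<epsilon>: "\<epsilon> > 0" "\<And>x t. \<bar>x\<bar> \<le> \<epsilon> \<Longrightarrow> \<bar>t - t0\<bar> \<le> \<epsilon> \<Longrightarrow> line_point \<theta> (s0 + x) t \<in> V"
    using line_point_nhd[OF \<open>open V\<close> \<open>line_point \<theta> s0 t0 \<in> V\<close>] by blast
  have V: "V \<subseteq> U" by (auto simp: V_def)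
  have lip: "\<bar>\<rho> (line_point \<theta> (s0 + b) t) - \<rho> (line_point \<theta> (s0 + a) t)\<bar> \<le> C1 * (b - a)"
    if "-\<epsilon> \<le> a" "a < b" "b \<le> \<epsilon>" "\<bar>t - t0\<bar> \<le> \<epsilon>" for a b t
  proof -
    have inV: "line_point \<theta> (s0 + z) t \<in> V" if "a \<le> z" "z \<le> b" for z
      using that \<open>-\<epsilon> \<le> a\<close> \<open>b \<le> \<epsilon>\<close> \<open>\<bar>t - t0\<bar> \<le> \<epsilon>\<close> by (intro \<epsilon>(2)) auto
    obtain z where z: "a < z" "z < b" "\<rho> (line_point \<theta> (s0 + b) t) - \<rho> (line_point \<theta> (s0 + a) t) = (b - a) * D1 (line_point \<theta> (s0 + z) t)"
      using line_point_MVT1[OF sm \<open>a < b\<close>, of \<theta> s0 t] inV V unfolding D1_def by blast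
    have "\<bar>D1 (line_point \<theta> (s0 + z) t)\<bar> \<le> C1" using inV[of z] z by (auto simp: V_def)
    then show ?thesis using z \<open>a < b\<close> by (simp add: abs_mult mult.commute)
  qed
  have expand: "c * \<bar>b - a\<bar> \<le> \<bar>\<rho> (line_point \<theta> s0 b) - \<rho> (line_point \<theta> s0 a)\<bar>"
    if "\<bar>a - t0\<bar> \<le> \<epsilon>" "\<bar>b - t0\<bar> \<le> \<epsilon>" "a < b" for a b
  proof -
    have inV: "line_point \<theta> s0 z \<in> V" if "a \<le> z" "z \<le> b" for z
      using that \<open>\<bar>a - t0\<bar> \<le> \<epsilon>\<close> \<open>\<bar>b - t0\<bar> \<le> \<epsilon>\<close> \<epsilon>(2)[of 0 z] \<epsilon>(1) by auto
    obtain z where z: "a < z" "z < b" "\<rho> (line_point \<theta> s0 b) - \<rho> (line_point \<theta> s0 a) = (b - a) * D2 (line_point \<theta> s0 z)"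
      using line_point_MVT2[OF sm \<open>a < b\<close>, of \<theta> s0] inV V unfolding D2_def by blast
    have "c \<le> \<bar>D2 (line_point \<theta> s0 z)\<bar>" using inV[of z] z by (auto simp: V_def)
    then show ?thesis using z \<open>a < b\<close> by (simp add: abs_mult mult.commute)
  qed
  define C where "C = 2 * C1 / c"
  have "C \<ge> 0" using \<open>c > 0\<close> \<open>C1 > 0\<close> by (simp add: C_def)
  show ?thesis
  proof (rule that[OF \<epsilon>(1) \<open>C \<ge> 0\<close>])
    fix x assume x: "0 < x" "x < \<epsilon>"
    let ?S = "{t. \<bar>t - t0\<bar> < \<epsilon> \<and> (line_point \<theta> (s0 + x) t \<in> \<Omega>) \<noteq> (line_point \<theta> (s0 - x) t \<in> \<Omega>)}"
    have small: "\<bar>\<rho> (line_point \<theta> s0 t)\<bar> \<le> C1 * x" if "t \<in> ?S" for t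
    proof -
      have t: "\<bar>t - t0\<bar> \<le> \<epsilon>" using that by auto
      have "line_point \<theta> (s0 + x) t \<in> U" "line_point \<theta> (s0 - x) t \<in> U"
        using \<epsilon>(2)[of x t] \<epsilon>(2)[of "-x" t] x t V by auto
      then have "(\<rho> (line_point \<theta> (s0 + x) t) \<le> 0) \<noteq> (\<rho> (line_point \<theta> (s0 - x) t) \<le> 0)"
        using that eq by auto
      moreover have "\<bar>\<rho> (line_point \<theta> (s0 + x) t) - \<rho> (line_point \<theta> s0 t)\<bar> \<le> C1 * x"
        using lip[of 0 x t] x t \<epsilon>(1) by simp
      moreover have "\<bar>\<rho> (line_point \<theta> s0 t) - \<rho> (line_point \<theta> (s0 - x) t)\<bar> \<le> C1 * x"
        using lip[of "-x" 0 t] x t \<epsilon>(1) by simp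
      ultimately show ?thesis by (auto simp: abs_le_iff)
    qed
    have close: "\<bar>b - a\<bar> \<le> C * x" if "a \<in> ?S" "b \<in> ?S" for a b
    proof -
      have "c * \<bar>b - a\<bar> \<le> \<bar>\<rho> (line_point \<theta> s0 b) - \<rho> (line_point \<theta> s0 a)\<bar>"
        using expand[of a b] expand[of b a] that by (cases a b rule: linorder_cases) (auto simp: abs_minus_commute)
      also have "\<dots> \<le> 2 * C1 * x" using small[OF that(1)] small[OF that(2)] by linarith
      finally show ?thesis using \<open>c > 0\<close> by (simp add: C_def field_simps)
    qed
    show "\<exists>l. ?S \<subseteq> {l - C * x..l + C * x}"
    proof (cases "?S = {}")
      case True
      then show ?thesis by blast
    next
      case False
      then obtain l where "l \<in> ?S" by blast
      then have "?S \<subseteq> {l - C * x..l + C * x}" using close by (fastforce simp: abs_le_iff)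
      then show ?thesis ..
    qed
  qed
qed

text \<open>Here the domain is monotone in the direction orthogonal to the line, and the level set
  stays within a parabola.\<close>

lemma tangential_crossing:
  assumes c: "boundary_chart \<Omega> U \<rho>" and p: "line_point \<theta> s0 t0 \<in> U" and 0: "\<rho> (line_point \<theta> s0 t0) = 0"
    and ta: "frechet_derivative \<rho> (at (line_point \<theta> s0 t0)) (direction (\<theta> + pi / 2)) = 0"
  obtains \<epsilon> k \<tau> where "\<epsilon> > 0" "k > 0" "\<bar>\<tau>\<bar> = (1::real)"
    "\<And>x t. 0 < x \<Longrightarrow> x < \<epsilon> \<Longrightarrow> \<bar>t - t0\<bar> < \<epsilon> \<Longrightarrow>
      \<tau> * (indicator \<Omega> (line_point \<theta> (s0 + x) t) - indicator \<Omega> (line_point \<theta> (s0 - x) t)) \<ge> 0"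
    "\<And>x t. 0 < x \<Longrightarrow> x < \<epsilon> \<Longrightarrow> \<bar>t - t0\<bar> \<le> k * sqrt x \<Longrightarrow>
      \<tau> * (indicator \<Omega> (line_point \<theta> (s0 + x) t) - indicator \<Omega> (line_point \<theta> (s0 - x) t)) = 1"
proof -
  have U: "open U" and sm: "smooth_on U \<rho>" and "\<Omega> \<inter> U = {x \<in> U. \<rho> x \<le> 0}"
    using c unfolding boundary_chart_def by blast+
  then have eq: "\<And>y. y \<in> U \<Longrightarrow> y \<in> \<Omega> \<longleftrightarrow> \<rho> y \<le> 0" by blast
  define q where "q = line_point \<theta> s0 t0"
  define D1 where "D1 x = frechet_derivative \<rho> (at x) (direction \<theta>)" for x
  define D2 where "D2 x = frechet_derivative \<rho> (at x) (direction (\<theta> + pi / 2))" for x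
  have "D1 q \<noteq> 0" unfolding D1_def q_def by (rule boundary_chart_gradient[OF c p ta])
  \<comment> \<open>The sign of the normal derivative: \<open>a * \<rho>\<close> increases with
    \<open>s\<close>. Since \<open>\<rho> \<le> 0\<close> describes the domain, crossing towards
    larger \<open>s\<close> leaves it if \<open>a = 1\<close>, whence \<open>\<tau> = - a\<close>
    below.\<close>
  define a where "a = sgn (D1 q)"
  have a: "a = 1 \<or> a = -1" using \<open>D1 q \<noteq> 0\<close> by (auto simp: a_def sgn_if)
  define c where "c = \<bar>D1 q\<bar> / 2"
  have "c > 0" using \<open>D1 q \<noteq> 0\<close> by (simp add: c_def)
  obtain L d where L: "L \<ge> 0" "d > 0" "\<And>y. norm (y - q) < d \<Longrightarrow> norm (D2 y - D2 q) \<le> L * norm (y - q)"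
    using differentiable_imp_lipschitz_at[OF smooth_on_directional_differentiable[OF U sm p]] unfolding D2_def q_def by blast
  define V where "V = (U \<inter> (\<lambda>x. a * D1 x) -` {c<..}) \<inter> ball q d"
  have "open V"
    unfolding V_def D1_def using U sm
    by (intro open_Int continuous_open_preimage continuous_on_mult continuous_on_const smooth_on_directional_continuous_on) auto
  have "a * D1 q = \<bar>D1 q\<bar>" by (simp add: a_def linordered_idom_class.abs_sgn mult.commute)
  then have "line_point \<theta> s0 t0 \<in> V"
    using p \<open>c > 0\<close> L by (auto simp: V_def c_def q_def)
  obtain \<epsilon> where \<epsilon>: "\<epsilon> > 0" "\<And>x t. \<bar>x\<bar> \<le> \<epsilon> \<Longrightarrow> \<bar>t - t0\<bar> \<le> \<epsilon> \<Longrightarrow> line_point \<theta> (s0 + x) t \<in> V"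
    using line_point_nhd[OF \<open>open V\<close> \<open>line_point \<theta> s0 t0 \<in> V\<close>] by blast
  have V: "V \<subseteq> U" by (auto simp: V_def)
  have mono: "c * (y - x) < a * \<rho> (line_point \<theta> (s0 + y) t) - a * \<rho> (line_point \<theta> (s0 + x) t)"
    if "-\<epsilon> \<le> x" "x < y" "y \<le> \<epsilon>" "\<bar>t - t0\<bar> \<le> \<epsilon>" for x y t
  proof -
    have inV: "line_point \<theta> (s0 + z) t \<in> V" if "x \<le> z" "z \<le> y" for z
      using that \<open>-\<epsilon> \<le> x\<close> \<open>y \<le> \<epsilon>\<close> \<open>\<bar>t - t0\<bar> \<le> \<epsilon>\<close> by (intro \<epsilon>(2)) auto
    obtain z where z: "x < z" "z < y" "\<rho> (line_point \<theta> (s0 + y) t) - \<rho> (line_point \<theta> (s0 + x) t) = (y - x) * D1 (line_point \<theta> (s0 + z) t)"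
      using line_point_MVT1[OF sm \<open>x < y\<close>, of \<theta> s0 t] inV V unfolding D1_def by blast
    have "c < a * D1 (line_point \<theta> (s0 + z) t)" using inV[of z] z by (auto simp: V_def)
    then have "c * (y - x) < (a * D1 (line_point \<theta> (s0 + z) t)) * (y - x)" using \<open>x < y\<close> by (intro mult_strict_right_mono) auto
    also have "\<dots> = a * (\<rho> (line_point \<theta> (s0 + y) t) - \<rho> (line_point \<theta> (s0 + x) t))"
      unfolding z(3) by simp
    finally show ?thesis by (simp add: right_diff_distrib)
  qed
  \<comment> \<open>The tangential derivative vanishes at \<open>t0\<close> and is Lipschitz
    relative to that point, so the mean value theorem gives a quadratic bound.\<close>
  have para: "\<bar>\<rho> (line_point \<theta> s0 t)\<bar> \<le> L * (t - t0)\<^sup>2" if "\<bar>t - t0\<bar> \<le> \<epsilon>" for t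
  proof -
    have D2b: "\<bar>D2 (line_point \<theta> s0 z)\<bar> \<le> L * \<bar>t - t0\<bar>" if "\<bar>z - t0\<bar> \<le> \<bar>t - t0\<bar>" for z
    proof -
      have "line_point \<theta> s0 z \<in> V" using \<epsilon>(2)[of 0 z] \<epsilon>(1) that \<open>\<bar>t - t0\<bar> \<le> \<epsilon>\<close> by auto
      then have "norm (line_point \<theta> s0 z - q) < d" by (auto simp: V_def dist_norm norm_minus_commute)
      then have "\<bar>D2 (line_point \<theta> s0 z)\<bar> \<le> L * norm (line_point \<theta> s0 z - q)"
        using L(3)[of "line_point \<theta> s0 z"] ta by (simp add: D2_def q_def)
      also have "\<dots> \<le> L * \<bar>t - t0\<bar>"
        using dist_line_point[of \<theta> s0 z s0 t0] that L(1) by (intro mult_left_mono) (auto simp: dist_norm q_def)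
      finally show ?thesis .
    qed
    have inU: "line_point \<theta> s0 z \<in> U" if "t \<le> z \<and> z \<le> t0 \<or> t0 \<le> z \<and> z \<le> t" for z
      using \<epsilon>(2)[of 0 z] \<epsilon>(1) that \<open>\<bar>t - t0\<bar> \<le> \<epsilon>\<close> V by auto
    have "\<exists>z. \<bar>z - t0\<bar> \<le> \<bar>t - t0\<bar> \<and> \<bar>\<rho> (line_point \<theta> s0 t)\<bar> = \<bar>t - t0\<bar> * \<bar>D2 (line_point \<theta> s0 z)\<bar>"
    proof (cases t t0 rule: linorder_cases)
      case less
      obtain z where "t < z" "z < t0" "\<rho> (line_point \<theta> s0 t0) - \<rho> (line_point \<theta> s0 t) = (t0 - t) * D2 (line_point \<theta> s0 z)"
        using line_point_MVT2[OF sm less, of \<theta> s0] inU unfolding D2_def by blast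
      then show ?thesis using 0 by (intro exI[of _ z]) (auto simp: abs_mult abs_minus_commute dest: arg_cong[where f=abs])
    next
      case equal
      then show ?thesis using 0 by (intro exI[of _ t0]) auto
    next
      case greater
      obtain z where "t0 < z" "z < t" "\<rho> (line_point \<theta> s0 t) - \<rho> (line_point \<theta> s0 t0) = (t - t0) * D2 (line_point \<theta> s0 z)"
        using line_point_MVT2[OF sm greater, of \<theta> s0] inU unfolding D2_def by blast
      then show ?thesis using 0 by (intro exI[of _ z]) (auto simp: abs_mult)
    qed
    then obtain z where "\<bar>z - t0\<bar> \<le> \<bar>t - t0\<bar>" "\<bar>\<rho> (line_point \<theta> s0 t)\<bar> = \<bar>t - t0\<bar> * \<bar>D2 (line_point \<theta> s0 z)\<bar>" by blast
    then have "\<bar>\<rho> (line_point \<theta> s0 t)\<bar> \<le> \<bar>t - t0\<bar> * (L * \<bar>t - t0\<bar>)"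
      using D2b[of z] by (simp add: mult_left_mono)
    then show ?thesis by (simp add: power2_eq_square mult_ac abs_mult_self_eq flip: abs_mult)
  qed
  have sign: "indicator \<Omega> (line_point \<theta> (s0 + x) t) = (if \<rho> (line_point \<theta> (s0 + x) t) \<le> 0 then 1 else (0::real))"
    if "\<bar>x\<bar> \<le> \<epsilon>" "\<bar>t - t0\<bar> \<le> \<epsilon>" for x t
    using eq[of "line_point \<theta> (s0 + x) t"] \<epsilon>(2)[OF that] V by (auto simp: indicator_def)
  \<comment> \<open>Makes \<open>L * k^2 < c\<close>: for
    \<open>\<bar>t - t0\<bar> \<le> k * sqrt x\<close> the value on the middle line is smaller than
    the normal change \<open>c * x\<close>, so \<open>\<rho>\<close> has opposite signs on the two
    outer lines.\<close>
  define k where "k = sqrt (c / (L + 1))"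
  have "k > 0" using \<open>c > 0\<close> L(1) by (simp add: k_def add_nonneg_pos)
  have k2: "L * k\<^sup>2 < c"
  proof -
    have "k\<^sup>2 = c / (L + 1)" using \<open>c > 0\<close> L(1) by (simp add: k_def)
    then have "k\<^sup>2 + L * k\<^sup>2 = c" using L(1) by (simp add: field_simps)
    moreover have "k\<^sup>2 > 0" using \<open>k > 0\<close> by simp
    ultimately show ?thesis by linarith
  qed
  \<comment> \<open>The second entry guarantees \<open>k * sqrt x \<le> \<epsilon>\<close>, so the
    whole window lies in the neighbourhood.\<close>
  define \<epsilon>' where "\<epsilon>' = min \<epsilon> ((\<epsilon> / k)\<^sup>2)"
  have "\<epsilon>' > 0" using \<epsilon>(1) \<open>k > 0\<close> by (simp add: \<epsilon>'_def)
  show ?thesis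
  proof (rule that[OF \<open>\<epsilon>' > 0\<close> \<open>k > 0\<close>, of "- a"])
    show "\<bar>- a\<bar> = 1" using a by auto
    fix x t assume x: "0 < x" "x < \<epsilon>'"
    then have x': "x < \<epsilon>" by (simp add: \<epsilon>'_def)
    {
      assume t: "\<bar>t - t0\<bar> < \<epsilon>'"
      have "\<bar>t - t0\<bar> \<le> \<epsilon>" using t by (simp add: \<epsilon>'_def)
      then show "- a * (indicator \<Omega> (line_point \<theta> (s0 + x) t) - indicator \<Omega> (line_point \<theta> (s0 - x) t)) \<ge> 0"
        using sign[of x t] sign[of "-x" t] mono[of "-x" x t] x x' a mult_pos_pos[OF \<open>c > 0\<close> x(1)] by auto
    next
      assume t: "\<bar>t - t0\<bar> \<le> k * sqrt x"
      have "sqrt x \<le> \<epsilon> / k"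
        using x \<epsilon>(1) \<open>k > 0\<close> by (intro real_le_lsqrt) (auto simp: \<epsilon>'_def)
      then have "k * sqrt x \<le> \<epsilon>" using \<open>k > 0\<close> by (simp add: field_simps)
      then have t': "\<bar>t - t0\<bar> \<le> \<epsilon>" using t by linarith
      have "(t - t0)\<^sup>2 \<le> (k * sqrt x)\<^sup>2" using power_mono[OF t, of 2] by simp
      then have "L * (t - t0)\<^sup>2 \<le> L * (k\<^sup>2 * x)"
        using L(1) x by (intro mult_left_mono) (auto simp: power_mult_distrib)
      also have "\<dots> < c * x" using mult_strict_right_mono[OF k2 x(1)] by (simp add: mult.assoc)
      finally have "\<bar>\<rho> (line_point \<theta> s0 t)\<bar> < c * x" using para[OF t'] by linarith
      then show "- a * (indicator \<Omega> (line_point \<theta> (s0 + x) t) - indicator \<Omega> (line_point \<theta> (s0 - x) t)) = 1"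
        using sign[of x t] sign[of "-x" t] mono[of "-x" 0 t] mono[of 0 x t] x x' t' a \<epsilon>(1) by (auto simp: abs_less_iff)
    }
  qed
qed

text \<open>Changes of membership of the unwanted sign can come only from transversal crossings, of
  total length \<open>O(x)\<close>, provided that all tangent points have the same sign. That is
  ensured by connectedness; finitely many neighbourhoods then cover the relevant part of the middle
  line.\<close>

lemma tangency_geometry:
  assumes dom: "compact_smooth_domain \<Omega>" and ball: "\<Omega> \<subseteq> ball 0 1"
    and ne: "tangent_points \<Omega> s0 \<theta> \<noteq> {}" and conn: "connected (tangent_points \<Omega> s0 \<theta>)"
  defines "d \<equiv> \<lambda>x t. indicator \<Omega> (line_point \<theta> (s0 + x) t) - (indicator \<Omega> (line_point \<theta> (s0 - x) t) :: real)"
  obtains \<sigma> C k x1 t0 where "\<bar>\<sigma>\<bar> = 1" "C \<ge> 0" "k > 0" "x1 > 0"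
    "\<And>x t. 0 < x \<Longrightarrow> x < x1 \<Longrightarrow> \<bar>t - t0\<bar> \<le> k * sqrt x \<Longrightarrow> \<sigma> * d x t = 1"
    "\<And>x. 0 < x \<Longrightarrow> x < x1 \<Longrightarrow> \<exists>N\<in>sets borel. emeasure lborel N \<le> ennreal (C * x) \<and> (\<forall>t. \<sigma> * d x t < 0 \<longrightarrow> t \<in> N)"
proof -
  define T where "T = tangent_points \<Omega> s0 \<theta>"
  define e2 where "e2 = direction (\<theta> + pi / 2)"
  \<comment> \<open>Besides the weak sign in a neighbourhood, a definite gain on a shrinking window
    is recorded: without it, a point could carry both signs.\<close>
  define Pos where "Pos \<tau> p \<longleftrightarrow> (\<exists>\<epsilon>>0. \<exists>k>0.
      (\<forall>x t. 0 < x \<and> x < \<epsilon> \<and> \<bar>t - p \<bullet> e2\<bar> < \<epsilon> \<longrightarrow> \<tau> * d x t \<ge> 0) \<and>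
      (\<forall>x t. 0 < x \<and> x < \<epsilon> \<and> \<bar>t - p \<bullet> e2\<bar> \<le> k * sqrt x \<longrightarrow> \<tau> * d x t = 1))" for \<tau> :: real and p
  have TD: "p \<in> frontier \<Omega>" "p \<in> line s0 \<theta>" "line_point \<theta> s0 (p \<bullet> e2) = p" if "p \<in> T" for p
    using that line_point_eta[of p \<theta> s0] by (auto simp: T_def tangent_points_def line_def e2_def)
  have h1: "Pos 1 p \<or> Pos (-1) p" if "p \<in> T" for p
  proof -
    note p = TD[OF that]
    obtain U \<rho> where c: "boundary_chart \<Omega> U \<rho>" "p \<in> U"
      using compact_smooth_domain_chart[OF dom p(1)] by blast
    have 0: "\<rho> p = 0" using boundary_chart_frontier[OF c] p by simp
    have ta: "frechet_derivative \<rho> (at p) (direction (\<theta> + pi / 2)) = 0"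
      using tangent_point_iff[OF c p(1,2)] that by (simp add: T_def)
    have eq: "line_point \<theta> s0 (p \<bullet> e2) = p" by (rule p(3))
    obtain \<epsilon> k \<tau> where *: "\<epsilon> > 0" "k > 0" "\<bar>\<tau>\<bar> = (1::real)"
      "\<And>x t. 0 < x \<Longrightarrow> x < \<epsilon> \<Longrightarrow> \<bar>t - p \<bullet> e2\<bar> < \<epsilon> \<Longrightarrow>
        \<tau> * (indicator \<Omega> (line_point \<theta> (s0 + x) t) - indicator \<Omega> (line_point \<theta> (s0 - x) t)) \<ge> 0"
      "\<And>x t. 0 < x \<Longrightarrow> x < \<epsilon> \<Longrightarrow> \<bar>t - p \<bullet> e2\<bar> \<le> k * sqrt x \<Longrightarrow>
        \<tau> * (indicator \<Omega> (line_point \<theta> (s0 + x) t) - indicator \<Omega> (line_point \<theta> (s0 - x) t)) = 1"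
      by (rule tangential_crossing[OF c(1), of \<theta> s0 "p \<bullet> e2", unfolded eq, OF c(2) 0 ta]) (rule that)
    have "Pos \<tau> p" unfolding Pos_def d_def using * by blast
    moreover have "\<tau> = 1 \<or> \<tau> = -1" using *(3) by linarith
    ultimately show ?thesis by auto
  qed
  \<comment> \<open>At a small common \<open>x\<close> and at the coordinate of \<open>p'\<close>,
    the weak sign from \<open>p\<close> contradicts the definite opposite sign from
    \<open>p'\<close>. Hence the points of each sign form a relatively open subset of
    \<open>T\<close>.\<close>
  have h2: "\<exists>e>0. \<forall>p'\<in>T. dist p p' < e \<longrightarrow> \<not> Pos (- \<tau>) p'" if "Pos \<tau> p" for \<tau> p
  proof -
    obtain \<epsilon> where \<epsilon>: "\<epsilon> > 0" "\<forall>x t. 0 < x \<and> x < \<epsilon> \<and> \<bar>t - p \<bullet> e2\<bar> < \<epsilon> \<longrightarrow> \<tau> * d x t \<ge> 0"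
      using \<open>Pos \<tau> p\<close> unfolding Pos_def by (elim exE conjE) (rule that)
    have "\<not> Pos (- \<tau>) p'" if p': "dist p p' < \<epsilon>" for p'
    proof
      assume "Pos (- \<tau>) p'"
      then obtain \<epsilon>' k' where \<epsilon>': "\<epsilon>' > 0" "k' > 0" "\<forall>x t. 0 < x \<and> x < \<epsilon>' \<and> \<bar>t - p' \<bullet> e2\<bar> \<le> k' * sqrt x \<longrightarrow> - \<tau> * d x t = 1"
        unfolding Pos_def by (elim exE conjE) (rule that)
      define x where "x = min \<epsilon> \<epsilon>' / 2"
      have x: "0 < x" "x < \<epsilon>" "x < \<epsilon>'" using \<epsilon>(1) \<epsilon>'(1) by (auto simp: x_def)
      have "\<bar>p' \<bullet> e2 - p \<bullet> e2\<bar> \<le> norm (p' - p)"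
        using Cauchy_Schwarz_ineq2[of "p' - p" e2] by (simp add: e2_def inner_diff_left)
      also have "\<dots> < \<epsilon>" using p' by (simp add: dist_norm norm_minus_commute)
      finally have "\<tau> * d x (p' \<bullet> e2) \<ge> 0" using \<epsilon>(2) x by blast
      moreover have "- \<tau> * d x (p' \<bullet> e2) = 1" using \<epsilon>'(2) x by (intro \<epsilon>'(3)[rule_format]) auto
      ultimately show False by simp
    qed
    then show ?thesis using \<epsilon>(1) by blast
  qed
  obtain p0 where p0: "p0 \<in> T" using ne by (auto simp: T_def)
  have "\<exists>\<sigma>. \<bar>\<sigma>\<bar> = 1 \<and> (\<forall>p\<in>T. Pos \<sigma> p)"
  proof -
    define E where "E \<tau> = {p \<in> T. Pos \<tau> p}" for \<tau>
    have op: "openin (top_of_set T) (E \<tau>)" if "\<tau> = 1 \<or> \<tau> = -1" for \<tau>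
      unfolding openin_contains_ball
    proof (intro conjI ballI)
      show "E \<tau> \<subseteq> T" by (auto simp: E_def)
      fix p assume "p \<in> E \<tau>"
      then have "Pos \<tau> p" by (auto simp: E_def)
      from h2[OF this] obtain e where e: "e > 0" "\<And>p'. p' \<in> T \<Longrightarrow> dist p p' < e \<Longrightarrow> \<not> Pos (- \<tau>) p'" by blast
      have "Pos \<tau> p'" if "p' \<in> T" "dist p p' < e" for p'
        using h1[OF that(1)] e(2)[OF that] \<open>\<tau> = 1 \<or> \<tau> = -1\<close> by auto
      then show "\<exists>e>0. ball p e \<inter> T \<subseteq> E \<tau>"
        using e(1) by (intro exI[of _ e]) (auto simp: E_def)
    qed
    have disj: "E 1 \<inter> E (-1) = {}"
    proof -
      have "False" if "p \<in> T" "Pos 1 p" "Pos (-1) p" for p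
        using h2[OF that(2)] that by auto
      then show ?thesis by (auto simp: E_def)
    qed
    have cover: "T \<subseteq> E 1 \<union> E (-1)" using h1 by (auto simp: E_def)
    have "E 1 = {} \<or> E (-1) = {}"
      using conn[folded T_def] op[of 1] op[of "-1"] cover disj unfolding connected_openin by blast
    then show ?thesis
    proof
      assume "E 1 = {}"
      then show ?thesis using cover by (intro exI[of _ "-1"]) (auto simp: E_def)
    next
      assume "E (-1) = {}"
      then show ?thesis using cover by (intro exI[of _ 1]) (auto simp: E_def)
    qed
  qed
  then obtain \<sigma> where \<sigma>: "\<bar>\<sigma>\<bar> = 1" "\<And>p. p \<in> T \<Longrightarrow> Pos \<sigma> p" by blast
  have d_eq0: "d x t = 0" if "line_point \<theta> (s0 + x) t \<in> \<Omega> \<longleftrightarrow> line_point \<theta> (s0 - x) t \<in> \<Omega>" for x t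
    using that by (auto simp: d_def indicator_def)
  \<comment> \<open>Three kinds of points on the middle line: off the boundary and tangent points
    lose nothing (\<open>C = 0\<close>), transversal points lose an interval of length
    \<open>O(x)\<close>.\<close>
  have loc: "\<exists>\<epsilon>>0. \<exists>C\<ge>0. \<forall>x. 0 < x \<and> x < \<epsilon> \<longrightarrow> (\<exists>l. {t'. \<bar>t' - t\<bar> < \<epsilon> \<and> \<sigma> * d x t' < 0} \<subseteq> {l - C * x..l + C * x})" for t
  proof (cases "line_point \<theta> s0 t \<in> frontier \<Omega>")
    case False
    then obtain \<epsilon> where *: "\<epsilon> > 0" "\<And>x t'. 0 < x \<Longrightarrow> x < \<epsilon> \<Longrightarrow> \<bar>t' - t\<bar> < \<epsilon> \<Longrightarrow>
      line_point \<theta> (s0 + x) t' \<in> \<Omega> \<longleftrightarrow> line_point \<theta> (s0 - x) t' \<in> \<Omega>"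
      by (rule frontier_complement_crossing) (rule that)
    have "{t'. \<bar>t' - t\<bar> < \<epsilon> \<and> \<sigma> * d x t' < 0} = {}" if "0 < x \<and> x < \<epsilon>" for x
      using *(2)[THEN d_eq0] that by auto
    then show ?thesis using *(1) by (intro exI[of _ \<epsilon>] conjI exI[of _ 0]) auto
  next
    case True
    obtain U \<rho> where c: "boundary_chart \<Omega> U \<rho>" "line_point \<theta> s0 t \<in> U"
      using compact_smooth_domain_chart[OF dom True] by blast
    show ?thesis
    proof (cases "frechet_derivative \<rho> (at (line_point \<theta> s0 t)) (direction (\<theta> + pi / 2)) = 0")
      case z: True
      have "line_point \<theta> s0 t \<in> T"
        using tangent_point_iff[OF c True] z by (simp add: T_def line_def)
      from \<sigma>(2)[OF this] obtain \<epsilon> where *: "\<epsilon> > 0" "\<forall>x t'. 0 < x \<and> x < \<epsilon> \<and> \<bar>t' - t\<bar> < \<epsilon> \<longrightarrow> \<sigma> * d x t' \<ge> 0"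
        unfolding Pos_def e2_def line_point_inner by (elim exE conjE) (rule that)
      have "{t'. \<bar>t' - t\<bar> < \<epsilon> \<and> \<sigma> * d x t' < 0} = {}" if "0 < x \<and> x < \<epsilon>" for x
      proof -
        have "\<not> \<sigma> * d x t' < 0" if "\<bar>t' - t\<bar> < \<epsilon>" for t'
          using *(2) \<open>0 < x \<and> x < \<epsilon>\<close> that unfolding not_less by blast
        then show ?thesis by blast
      qed
      then show ?thesis using *(1) by (intro exI[of _ \<epsilon>] conjI exI[of _ 0]) auto
    next
      case False
      obtain \<epsilon> C where *: "\<epsilon> > 0" "C \<ge> 0" "\<And>x. 0 < x \<Longrightarrow> x < \<epsilon> \<Longrightarrow>
        \<exists>l. {t'. \<bar>t' - t\<bar> < \<epsilon> \<and> (line_point \<theta> (s0 + x) t' \<in> \<Omega>) \<noteq> (line_point \<theta> (s0 - x) t' \<in> \<Omega>)} \<subseteq> {l - C * x..l + C * x}"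
        by (rule transversal_crossing[OF c False]) (rule that)
      have "{t'. \<bar>t' - t\<bar> < \<epsilon> \<and> \<sigma> * d x t' < 0} \<subseteq> {t'. \<bar>t' - t\<bar> < \<epsilon> \<and> (line_point \<theta> (s0 + x) t' \<in> \<Omega>) \<noteq> (line_point \<theta> (s0 - x) t' \<in> \<Omega>)}" for x
        using d_eq0[of x] by fastforce
      then show ?thesis using * by (meson subset_trans)
    qed
  qed
  define Loc where "Loc t \<epsilon> C \<longleftrightarrow> \<epsilon> > 0 \<and> C \<ge> 0 \<and>
    (\<forall>x. 0 < x \<and> x < \<epsilon> \<longrightarrow> (\<exists>l. {t'. \<bar>t' - t\<bar> < \<epsilon> \<and> \<sigma> * d x t' < 0} \<subseteq> {l - C * x..l + C * x}))" for t \<epsilon> C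
  have "\<exists>\<epsilon> C. Loc t \<epsilon> C" for t
    using loc[of t] unfolding Loc_def by (elim exE conjE) (intro exI conjI; assumption)
  then obtain \<epsilon> C where Loc: "\<And>t. Loc t (\<epsilon> t) (C t)" by metis
  have \<epsilon>: "\<epsilon> t > 0" and C: "C t \<ge> 0" for t using Loc[of t] by (simp_all add: Loc_def)
  have loc: "\<exists>l. {t'. \<bar>t' - t\<bar> < \<epsilon> t \<and> \<sigma> * d x t' < 0} \<subseteq> {l - C t * x..l + C t * x}" if "0 < x" "x < \<epsilon> t" for t x
    using Loc[of t] that unfolding Loc_def by simp
  \<comment> \<open>The domain lies in the unit ball, so only parameters in \<open>{-1..1}\<close>
    can show a change, and compactness applies.\<close>
  have "{-1..1::real} \<subseteq> (\<Union>t\<in>UNIV. ball t (\<epsilon> t))"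
    using \<epsilon> by (intro subsetI UN_I[OF UNIV_I]) (rule centre_in_ball[THEN iffD2])
  then obtain D where D: "finite D" "{-1..1::real} \<subseteq> (\<Union>t\<in>D. ball t (\<epsilon> t))"
    by (rule compactE_image[OF compact_Icc, of UNIV, rotated]) auto
  have "D \<noteq> {}" using D(2) by force
  obtain \<epsilon>' k where k: "\<epsilon>' > 0" "k > 0" "\<forall>x t. 0 < x \<and> x < \<epsilon>' \<and> \<bar>t - p0 \<bullet> e2\<bar> \<le> k * sqrt x \<longrightarrow> \<sigma> * d x t = 1"
    using \<sigma>(2)[OF p0] unfolding Pos_def by (elim exE conjE) (rule that)
  define x1 where "x1 = min \<epsilon>' (Min (\<epsilon> ` D))"
  have x1: "x1 > 0" using k(1) \<epsilon> D(1) \<open>D \<noteq> {}\<close> by (simp add: x1_def)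
  have x1D: "x < \<epsilon> t" if "x < x1" "t \<in> D" for x t
    using that D(1) \<open>D \<noteq> {}\<close> by (auto simp: x1_def)
  define C' where "C' = (\<Sum>t\<in>D. 2 * C t)"
  show ?thesis
  proof (rule that[OF \<sigma>(1) _ k(2) x1, of C' "p0 \<bullet> e2"])
    show "C' \<ge> 0" using C by (auto simp: C'_def intro: sum_nonneg)
    show "\<sigma> * d x t = 1" if "0 < x" "x < x1" "\<bar>t - p0 \<bullet> e2\<bar> \<le> k * sqrt x" for x t
      using that by (intro k(3)[rule_format]) (auto simp: x1_def)
    fix x assume x: "0 < x" "x < x1"
    have "\<forall>t\<in>D. \<exists>l. {t'. \<bar>t' - t\<bar> < \<epsilon> t \<and> \<sigma> * d x t' < 0} \<subseteq> {l - C t * x..l + C t * x}"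
      using loc[OF x(1)] x1D[OF x(2)] by simp
    from bchoice[OF this] obtain l
      where l: "\<forall>t\<in>D. {t'. \<bar>t' - t\<bar> < \<epsilon> t \<and> \<sigma> * d x t' < 0} \<subseteq> {l t - C t * x..l t + C t * x}" ..
    define N where "N = (\<Union>t\<in>D. {l t - C t * x..l t + C t * x})"
    have "emeasure lborel N \<le> (\<Sum>t\<in>D. emeasure lborel {l t - C t * x..l t + C t * x})"
      unfolding N_def by (rule emeasure_subadditive_finite) (auto simp: D)
    also have "\<dots> = (\<Sum>t\<in>D. ennreal (2 * C t * x))"
      using C x by (intro sum.cong refl) (simp add: mult_nonneg_nonneg)
    also have "\<dots> = ennreal (C' * x)"
      using C x by (subst sum_ennreal) (auto simp: C'_def sum_distrib_right)
    finally have "emeasure lborel N \<le> ennreal (C' * x)" .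
    moreover have "t \<in> N" if t: "\<sigma> * d x t < 0" for t
    proof -
      have "d x t \<noteq> 0" using t by auto
      then have "line_point \<theta> (s0 + x) t \<in> \<Omega> \<or> line_point \<theta> (s0 - x) t \<in> \<Omega>"
        using d_eq0 by blast
      then obtain s where "line_point \<theta> s t \<in> \<Omega>" by blast
      then have "norm (line_point \<theta> s t) < 1" using ball by auto
      moreover have "\<bar>line_point \<theta> s t \<bullet> e2\<bar> \<le> norm (line_point \<theta> s t)"
        using Cauchy_Schwarz_ineq2[of "line_point \<theta> s t" e2] by (simp add: e2_def)
      ultimately have "\<bar>t\<bar> \<le> 1" by (simp add: e2_def)
      then have "t \<in> {-1..1}" by (simp add: abs_le_iff)
      then obtain t' where "t' \<in> D" "\<bar>t - t'\<bar> < \<epsilon> t'" using D(2) by (force simp: dist_real_def abs_minus_commute)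
      then show ?thesis using l t unfolding N_def by blast
    qed
    moreover have "N \<in> sets borel" unfolding N_def using D(1) by auto
    ultimately show "\<exists>N\<in>sets borel. emeasure lborel N \<le> ennreal (C' * x) \<and> (\<forall>t. \<sigma> * d x t < 0 \<longrightarrow> t \<in> N)"
      by blast
  qed
qed

text \<open>The factor infinity is the length of the parameter line. With
  \<open>0 * \<infinity> = 0\<close> this is a criterion: \<open>N\<close> is null iff almost every
  line in direction \<open>v\<close> meets it in a null set. Both directions are used.\<close>

lemma emeasure_lines:
  fixes N :: "'a::euclidean_space set"
  assumes [measurable]: "N \<in> sets borel"
  shows "(\<integral>\<^sup>+y. \<integral>\<^sup>+\<tau>. indicator N (y + \<tau> *\<^sub>R v) \<partial>(lborel :: real measure) \<partial>lborel) = emeasure lborel N * \<infinity>"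
proof -
  have "(\<integral>\<^sup>+y. \<integral>\<^sup>+\<tau>. indicator N (y + \<tau> *\<^sub>R v) \<partial>(lborel :: real measure) \<partial>lborel) = (\<integral>\<^sup>+\<tau>. \<integral>\<^sup>+y. indicator N (y + \<tau> *\<^sub>R v) \<partial>lborel \<partial>(lborel :: real measure))"
    by (rule lborel_pair.Fubini'[symmetric]) measurable
  also have "\<dots> = (\<integral>\<^sup>+\<tau>. emeasure lborel N \<partial>(lborel :: real measure))"
    by (subst nn_integral_lborel_shift(1)[of "indicator N"]) auto
  finally show ?thesis by simp
qed

text \<open>In a small ball some directional derivative of the chart has no zero, so by the mean
  value theorem each line in that direction meets the boundary at most once there. Finitely many
  such balls cover the boundary.\<close>

lemma frontier_null:
  assumes dom: "compact_smooth_domain \<Omega>"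
  shows "emeasure lborel (frontier \<Omega>) = 0"
proof -
  have "compact \<Omega>" using dom by (simp add: compact_smooth_domain_def)
  then have cf: "compact (frontier \<Omega>)" by (rule compact_frontier)
  have "\<exists>r>0. emeasure lborel (frontier \<Omega> \<inter> ball p r) = 0" if p: "p \<in> frontier \<Omega>" for p
  proof -
    obtain U \<rho> where c: "boundary_chart \<Omega> U \<rho>" "p \<in> U"
      using compact_smooth_domain_chart[OF dom p] by blast
    have U: "open U" and sm: "smooth_on U \<rho>" using c unfolding boundary_chart_def by blast+
    obtain v where v: "frechet_derivative \<rho> (at p) v \<noteq> 0"
      using c unfolding boundary_chart_def by blast
    have "open (U \<inter> (\<lambda>x. frechet_derivative \<rho> (at x) v) -` (- {0}))"
      using U smooth_on_directional_continuous_on[OF U sm] by (intro continuous_open_preimage) auto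
    moreover have "p \<in> U \<inter> (\<lambda>x. frechet_derivative \<rho> (at x) v) -` (- {0})" using c v by auto
    ultimately obtain r where r: "r > 0" "ball p r \<subseteq> U \<inter> (\<lambda>x. frechet_derivative \<rho> (at x) v) -` (- {0})"
      using open_contains_ball by blast
    define N where "N = frontier \<Omega> \<inter> ball p r"
    have [measurable]: "N \<in> sets borel" unfolding N_def by auto
    have uniq: "a = b" if "y + a *\<^sub>R v \<in> N" "y + b *\<^sub>R v \<in> N" for a b y
    proof -
      have False if ab: "a < b" "y + a *\<^sub>R v \<in> N" "y + b *\<^sub>R v \<in> N" for a b
      proof -
        have seg: "y + z *\<^sub>R v \<in> ball p r" if "a \<le> z" "z \<le> b" for z
        proof -
          define \<mu> where "\<mu> = (z - a) / (b - a)"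
          have \<mu>: "0 \<le> \<mu>" "\<mu> \<le> 1" using that ab(1) by (auto simp: \<mu>_def)
          have "\<mu> * (b - a) = z - a" using ab(1) by (simp add: \<mu>_def)
          then have z: "z = (1 - \<mu>) * a + \<mu> * b" by (simp add: algebra_simps)
          have "y + z *\<^sub>R v = (1 - \<mu>) *\<^sub>R (y + a *\<^sub>R v) + \<mu> *\<^sub>R (y + b *\<^sub>R v)"
            by (subst z) (simp add: algebra_simps)
          then show ?thesis
            using convexD_alt[OF convex_ball[of p r] _ _ \<mu>, of "y + a *\<^sub>R v" "y + b *\<^sub>R v"] ab by (simp add: N_def)
        qed
        have "y + z *\<^sub>R v \<in> U" if "a \<le> z" "z \<le> b" for z using seg[OF that] r(2) by auto
        then obtain z where z: "a < z" "z < b" "\<rho> (y + b *\<^sub>R v) - \<rho> (y + a *\<^sub>R v) = (b - a) * frechet_derivative \<rho> (at (y + z *\<^sub>R v)) v"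
          using smooth_on_MVT[OF sm ab(1), of y v] by blast
        have "\<rho> (y + b *\<^sub>R v) = 0" "\<rho> (y + a *\<^sub>R v) = 0"
          using boundary_chart_frontier[OF c(1)] ab r(2) by (auto simp: N_def)
        moreover have "frechet_derivative \<rho> (at (y + z *\<^sub>R v)) v \<noteq> 0" using seg[of z] z r(2) by auto
        ultimately show False using z by simp
      qed
      then show ?thesis using that by (metis linorder_neqE_linordered_idom)
    qed
    have "(\<integral>\<^sup>+\<tau>. indicator N (y + \<tau> *\<^sub>R v) \<partial>(lborel :: real measure)) = 0" for y
    proof -
      obtain a where a: "{\<tau>. y + \<tau> *\<^sub>R v \<in> N} \<subseteq> {a}" using uniq by blast
      have "(\<integral>\<^sup>+\<tau>. indicator N (y + \<tau> *\<^sub>R v) \<partial>(lborel :: real measure)) \<le> (\<integral>\<^sup>+\<tau>. indicator {a} \<tau> \<partial>(lborel :: real measure))"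
        using a by (intro nn_integral_mono) (auto split: split_indicator)
      then show ?thesis by simp
    qed
    then have "emeasure lborel N * \<infinity> = 0" using emeasure_lines[of N v] by simp
    then have "emeasure lborel N = 0" by (simp add: ennreal_mult_eq_top_iff)
    then show ?thesis using r(1) unfolding N_def by blast
  qed
  then obtain r where r: "\<And>p. p \<in> frontier \<Omega> \<Longrightarrow> r p > 0" "\<And>p. p \<in> frontier \<Omega> \<Longrightarrow> emeasure lborel (frontier \<Omega> \<inter> ball p (r p)) = 0"
    by metis
  have "frontier \<Omega> \<subseteq> (\<Union>p\<in>frontier \<Omega>. ball p (r p))" using r(1) by force
  then obtain D where D: "D \<subseteq> frontier \<Omega>" "finite D" "frontier \<Omega> \<subseteq> (\<Union>p\<in>D. ball p (r p))"
    by (rule compactE_image[OF cf, rotated]) auto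
  have "(\<Union>p\<in>D. frontier \<Omega> \<inter> ball p (r p)) \<in> null_sets lborel"
    using D r(2) by (intro null_sets.finite_UN) (auto simp: null_sets_def)
  moreover have "frontier \<Omega> = (\<Union>p\<in>D. frontier \<Omega> \<inter> ball p (r p))" using D(3) by auto
  ultimately show ?thesis by (simp add: null_sets_def)
qed

text \<open>Full ray integrals of a function supported in the unit ball need not decay along the
  opposite direction. Truncation makes them compactly supported, hence integrable over the plane,
  and keeps their values near the origin.\<close>

definition trunc_ray :: "('a::euclidean_space \<Rightarrow> real) \<Rightarrow> real \<Rightarrow> 'a \<Rightarrow> 'a \<Rightarrow> real" where
  "trunc_ray f R v y = (\<integral>t. indicator {0..R} t * f (y + t *\<^sub>R v) \<partial>lborel)"

lemma borel_measurable_trunc_ray [measurable]: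
  assumes [measurable]: "f \<in> borel_measurable borel"
  shows "trunc_ray f R v \<in> borel_measurable borel"
  unfolding trunc_ray_def by measurable

lemma trunc_ray_bounds:
  fixes f :: "'a::euclidean_space \<Rightarrow> real"
  assumes [measurable]: "f \<in> borel_measurable borel" and f: "\<And>x. 0 \<le> f x" "\<And>x. f x \<le> B" and R: "R \<ge> 0"
  shows "0 \<le> trunc_ray f R v y" "trunc_ray f R v y \<le> B * R"
proof -
  show "0 \<le> trunc_ray f R v y" unfolding trunc_ray_def using f by (intro integral_nonneg_AE) auto
  have "B \<ge> 0" using f[of 0] by linarith
  have i: "integrable lborel (\<lambda>t. B * indicator {0..R} t)"
    using R by (intro integrable_mult_right integrable_real_indicator) auto
  have le: "indicator {0..R} t * f (y + t *\<^sub>R v) \<le> B * indicator {0..R} t" for t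
    using f by (auto split: split_indicator)
  have "trunc_ray f R v y \<le> (\<integral>t. B * indicator {0..R} t \<partial>lborel)"
    unfolding trunc_ray_def
  proof (rule integral_mono[OF _ i le])
    show "integrable lborel (\<lambda>t. indicator {0..R} t * f (y + t *\<^sub>R v))"
      by (rule Bochner_Integration.integrable_bound[OF i]) (use le f \<open>B \<ge> 0\<close> in \<open>auto intro!: AE_I2 split: split_indicator\<close>)
  qed
  also have "\<dots> = B * R" using R by simp
  finally show "trunc_ray f R v y \<le> B * R" .
qed

lemma trunc_ray_eq_0:
  fixes f :: "'a::euclidean_space \<Rightarrow> real"
  assumes f: "\<And>x. norm x \<ge> 1 \<Longrightarrow> f x = 0" and v: "norm v = 1" and y: "norm y \<ge> R + 1"
  shows "trunc_ray f R v y = 0"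
proof -
  have "f (y + t *\<^sub>R v) = 0" if "t \<in> {0..R}" for t
  proof (rule f)
    have "norm y \<le> norm (y + t *\<^sub>R v) + norm (- (t *\<^sub>R v))" using norm_triangle_ineq[of "y + t *\<^sub>R v" "- (t *\<^sub>R v)"] by simp
    also have "norm (- (t *\<^sub>R v)) = t" using that v by simp
    finally show "norm (y + t *\<^sub>R v) \<ge> 1" using that y by simp
  qed
  then have "(\<lambda>t. indicator {0..R} t * f (y + t *\<^sub>R v)) = (\<lambda>_. 0)" by (auto simp: fun_eq_iff split: split_indicator)
  then show ?thesis by (simp add: trunc_ray_def)
qed

text \<open>After time \<open>R\<close> the ray has left the unit ball for good, so truncation loses
  nothing.\<close>

lemma trunc_ray_eq_ray_integral:
  fixes f :: "real^2 \<Rightarrow> real"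
  assumes [measurable]: "f \<in> borel_measurable borel"
    and f: "\<And>x. norm x \<ge> 1 \<Longrightarrow> f x = 0" and v: "norm v = 1" and y: "norm y \<le> R - 1"
  shows "ray_integral f y v = trunc_ray f R v y"
proof -
  have eq: "indicator {0..} t *\<^sub>R f (y + t *\<^sub>R v) = indicator {0..R} t * f (y + t *\<^sub>R v)" for t
  proof (cases "t > R")
    case True
    have "norm (t *\<^sub>R v) \<le> norm (y + t *\<^sub>R v) + norm (- y)" using norm_triangle_ineq[of "y + t *\<^sub>R v" "- y"] by simp
    moreover have "t > 0" using True y norm_ge_zero[of y] by linarith
    then have "norm (t *\<^sub>R v) = t" using v by simp
    ultimately have "norm (y + t *\<^sub>R v) \<ge> 1" using True y by simp
    then show ?thesis using f by simp
  qed (auto split: split_indicator)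
  show ?thesis
    unfolding ray_integral_def set_lebesgue_integral_def trunc_ray_def eq
    by (rule integral_completion) measurable
qed

text \<open>A ray running along the boundary may cause a jump, but for almost every \<open>y\<close>
  the line meets the boundary in a null set of parameters; dominated convergence then gives
  continuity at \<open>y\<close>.\<close>

lemma trunc_ray_AE_isCont:
  fixes f :: "real^2 \<Rightarrow> real"
  assumes dom: "compact_smooth_domain \<Omega>"
    and [measurable]: "f \<in> borel_measurable borel" and B: "\<And>x. \<bar>f x\<bar> \<le> B" and R: "R \<ge> 0"
    and cont: "\<And>x. x \<notin> frontier \<Omega> \<Longrightarrow> isCont f x"
  shows "AE y in lborel. isCont (trunc_ray f R v) y"
proof -
  have [measurable]: "frontier \<Omega> \<in> sets borel" by auto
  have "(\<integral>\<^sup>+y. \<integral>\<^sup>+\<tau>. indicator (frontier \<Omega>) (y + \<tau> *\<^sub>R v) \<partial>(lborel :: real measure) \<partial>lborel) = 0"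
    using emeasure_lines[of "frontier \<Omega>" v] frontier_null[OF dom] by simp
  then have "AE y in lborel. (\<integral>\<^sup>+\<tau>. indicator (frontier \<Omega>) (y + \<tau> *\<^sub>R v) \<partial>(lborel :: real measure)) = 0"
    by (subst (asm) nn_integral_0_iff_AE) auto
  then show ?thesis
  proof eventually_elim
    case (elim y)
    then have ae: "AE \<tau> in (lborel :: real measure). y + \<tau> *\<^sub>R v \<notin> frontier \<Omega>"
      by (subst (asm) nn_integral_0_iff_AE) (auto elim!: eventually_mono split: split_indicator_asm)
    show ?case
      unfolding continuous_at_sequentially comp_def
    proof (intro allI impI)
      fix X assume X: "X \<longlonglongrightarrow> y"
      show "(\<lambda>n. trunc_ray f R v (X n)) \<longlonglongrightarrow> trunc_ray f R v y"
        unfolding trunc_ray_def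
      proof (rule integral_dominated_convergence[where w="\<lambda>t. B * indicator {0..R} t"])
        show "integrable lborel (\<lambda>t. B * indicator {0..R} t)"
          using R by (intro integrable_mult_right integrable_real_indicator) auto
        show "AE t in lborel. (\<lambda>n. indicator {0..R} t * f (X n + t *\<^sub>R v)) \<longlonglongrightarrow> indicator {0..R} t * f (y + t *\<^sub>R v)"
          using ae
        proof eventually_elim
          case (elim t)
          have "(\<lambda>n. X n + t *\<^sub>R v) \<longlonglongrightarrow> y + t *\<^sub>R v" by (intro tendsto_add X tendsto_const)
          then show ?case by (intro tendsto_mult tendsto_const isCont_tendsto_compose[OF cont[OF elim]])
        qed
        show "AE t in lborel. norm (indicator {0..R} t * f (X n + t *\<^sub>R v)) \<le> B * indicator {0..R} t" for n
          using B by (intro AE_I2) (auto split: split_indicator)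
      qed measurable
    qed
  qed
qed

section \<open>Jumps of line integrals\<close>

lemma borel_measurable_line_point [measurable (raw)]:
  assumes [measurable]: "f \<in> borel_measurable M" "g \<in> borel_measurable M"
  shows "(\<lambda>x. line_point \<theta> (f x) (g x)) \<in> borel_measurable M"
  unfolding line_point_def by measurable

lemma norm_line_point_ge: "\<bar>t\<bar> \<le> norm (line_point \<theta> s t)" "\<bar>s\<bar> \<le> norm (line_point \<theta> s t)"
  using Cauchy_Schwarz_ineq2[of "line_point \<theta> s t" "direction (\<theta> + pi / 2)"]
    Cauchy_Schwarz_ineq2[of "line_point \<theta> s t" "direction \<theta>"] by simp_all

lemma exp_minus_lipschitz:
  fixes a b :: real
  assumes "0 \<le> a" "0 \<le> b"
  shows "\<bar>exp (- a) - exp (- b)\<bar> \<le> \<bar>a - b\<bar>"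
proof -
  have *: "exp (- x) - exp (- y) \<le> y - x" if "0 \<le> x" "x \<le> y" for x y :: real
  proof -
    have "exp (- x) - exp (- y) = exp (- x) * (1 - exp (x - y))"
      by (simp add: right_diff_distrib exp_add[symmetric])
    also have "\<dots> \<le> 1 * (1 - exp (x - y))" using that by (intro mult_right_mono) auto
    also have "\<dots> \<le> y - x" unfolding mult_1 using exp_ge_add_one_self[of "x - y"] by linarith
    finally show ?thesis .
  qed
  show ?thesis using *[of a b] *[of b a] assms by (cases "a \<le> b") (auto simp: abs_if)
qed

text \<open>Comparison of integrands at equal \<open>t\<close>: a gain of at least \<open>m\<close>
  on the tangential window of length \<open>2 * k * sqrt x\<close>, a loss of at most
  \<open>M\<close> on the set \<open>N\<close>, and where both points lie in the domain the
  variation of \<open>W\<close> and of the attenuation. All but the gain and the attenuation are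
  \<open>O(x)\<close>.\<close>

lemma line_integral_jump:
  fixes W g :: "real^2 \<Rightarrow> real"
  assumes [measurable]: "W \<in> borel_measurable borel" "g \<in> borel_measurable borel" "\<Omega> \<in> sets borel"
    and ball: "\<Omega> \<subseteq> ball 0 1"
    and W: "Wm > 0" "\<And>y. y \<in> \<Omega> \<Longrightarrow> Wm \<le> W y" "\<And>y. y \<in> \<Omega> \<Longrightarrow> W y \<le> M"
    and L: "L \<ge> 0" "\<And>x t. x > 0 \<Longrightarrow> line_point \<theta> (s0 + x) t \<in> \<Omega> \<Longrightarrow> line_point \<theta> (s0 - x) t \<in> \<Omega> \<Longrightarrow>
      \<bar>W (line_point \<theta> (s0 + x) t) - W (line_point \<theta> (s0 - x) t)\<bar> \<le> L * x"
    and g: "\<And>y. 0 \<le> g y" "\<And>y. g y \<le> G"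
    and gain: "\<And>\<epsilon>. \<epsilon> > 0 \<Longrightarrow> \<exists>x2>0. \<forall>x. 0 < x \<and> x < x2 \<longrightarrow>
      (\<integral>\<^sup>+t. ennreal (indicator {-1..1} t * \<bar>g (line_point \<theta> (s0 + x) t) - g (line_point \<theta> (s0 - x) t)\<bar>) \<partial>lborel) \<le> ennreal (\<epsilon> * sqrt x)"
    and \<sigma>: "\<bar>\<sigma>\<bar> = 1" and C: "C \<ge> 0" and k: "k > 0" and x1: "x1 > 0"
    and pos: "\<And>x t. 0 < x \<Longrightarrow> x < x1 \<Longrightarrow> \<bar>t - t0\<bar> \<le> k * sqrt x \<Longrightarrow>
      \<sigma> * (indicator \<Omega> (line_point \<theta> (s0 + x) t) - indicator \<Omega> (line_point \<theta> (s0 - x) t)) = 1"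
    and neg: "\<And>x. 0 < x \<Longrightarrow> x < x1 \<Longrightarrow> \<exists>N\<in>sets borel. emeasure lborel N \<le> ennreal (C * x) \<and>
      (\<forall>t. \<sigma> * (indicator \<Omega> (line_point \<theta> (s0 + x) t) - indicator \<Omega> (line_point \<theta> (s0 - x) t)) < 0 \<longrightarrow> t \<in> N)"
  defines "H \<equiv> \<lambda>s t. W (line_point \<theta> s t) * indicator \<Omega> (line_point \<theta> s t) * exp (- g (line_point \<theta> s t))"
  shows "\<exists>c>0. \<exists>x3>0. \<forall>x. 0 < x \<and> x < x3 \<longrightarrow> \<sigma> * ((\<integral>t. H (s0 + x) t \<partial>lborel) - (\<integral>t. H (s0 - x) t \<partial>lborel)) \<ge> c * sqrt x"
proof -
  define m where "m = Wm * exp (- G)"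
  have "m > 0" using W(1) by (simp add: m_def)
  define p where "p x t = line_point \<theta> (s0 + x) t" for x t
  define q where "q x t = line_point \<theta> (s0 - x) t" for x t
  have [measurable]: "p x \<in> borel_measurable borel" "q x \<in> borel_measurable borel" for x
    unfolding p_def q_def by measurable
  have tb: "t \<in> {-1..1}" if "line_point \<theta> s t \<in> \<Omega>" for s t
    using norm_line_point_ge(1)[of t \<theta> s] that ball by (auto simp: abs_le_iff subset_iff)
  \<comment> \<open>The window provides a point of the domain, which is needed to compare the bounds
    \<open>Wm\<close> and \<open>M\<close>.\<close>
  obtain t1 where t1: "p (x1 / 2) t1 \<in> \<Omega> \<or> q (x1 / 2) t1 \<in> \<Omega>"
  proof -
    have "\<sigma> * (indicator \<Omega> (p (x1 / 2) t0) - indicator \<Omega> (q (x1 / 2) t0)) = 1"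
      unfolding p_def q_def using x1 k by (intro pos) auto
    then show ?thesis using that[of t0] by (cases "p (x1 / 2) t0 \<in> \<Omega>"; cases "q (x1 / 2) t0 \<in> \<Omega>") auto
  qed
  then have "M \<ge> Wm" using W(2,3) by (meson order_trans)
  then have "M > 0" using W(1) by linarith
  have Habs: "\<bar>H s t\<bar> \<le> M * indicator {-1..1} t" for s t
  proof (cases "line_point \<theta> s t \<in> \<Omega>")
    case True
    have "W (line_point \<theta> s t) * exp (- g (line_point \<theta> s t)) \<le> M * 1"
      using W(1) W(2,3)[OF True] g(1)[of "line_point \<theta> s t"] \<open>M > 0\<close> by (intro mult_mono) auto
    then show ?thesis using True tb[OF True] W(1) W(2)[OF True] by (simp add: H_def abs_mult)
  qed (use \<open>M > 0\<close> in \<open>simp add: H_def\<close>)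
  have [measurable]: "H s \<in> borel_measurable borel" for s unfolding H_def by measurable
  have iI: "integrable lborel (\<lambda>t. indicator {-1..1::real} t * (1::real))"
    by simp
  have iH: "integrable lborel (H s)" for s
  proof (rule Bochner_Integration.integrable_bound)
    show "integrable lborel (\<lambda>t. M * (indicator {-1..1::real} t * (1::real)))" using iI by (rule integrable_mult_right)
    show "AE t in lborel. norm (H s t) \<le> norm (M * (indicator {-1..1} t * (1::real)))"
      using Habs \<open>M > 0\<close> by (intro AE_I2) (simp add: abs_mult)
  qed simp
  \<comment> \<open>Makes the attenuation error \<open>M * \<epsilon> * sqrt x\<close> equal to half
    of the gain \<open>2 * m * k * sqrt x\<close>.\<close>
  define \<epsilon> where "\<epsilon> = m * k / M"
  have "\<epsilon> > 0" using \<open>m > 0\<close> k \<open>M > 0\<close> by (simp add: \<epsilon>_def)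
  from gain[OF this] obtain x2 where x2: "x2 > 0" and gain': "\<And>x. 0 < x \<Longrightarrow> x < x2 \<Longrightarrow>
      (\<integral>\<^sup>+t. ennreal (indicator {-1..1} t * \<bar>g (p x t) - g (q x t)\<bar>) \<partial>lborel) \<le> ennreal (\<epsilon> * sqrt x)"
    unfolding p_def q_def by blast
  define K where "K = M * C + 2 * L"
  have "K \<ge> 0" using C L \<open>M > 0\<close> by (simp add: K_def)
  \<comment> \<open>The last entry bounds the linear errors \<open>K * x\<close> by
    \<open>m * k / 2 * sqrt x\<close>, leaving the same amount as net jump.\<close>
  define x3 where "x3 = min (min x1 x2) ((m * k / (2 * (K + 1)))\<^sup>2)"
  have "x3 > 0" using x1 x2 \<open>m > 0\<close> k \<open>K \<ge> 0\<close> by (simp add: x3_def)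
  have "m * k / 2 * sqrt x \<le> \<sigma> * ((\<integral>t. H (s0 + x) t \<partial>lborel) - (\<integral>t. H (s0 - x) t \<partial>lborel))" if x: "0 < x" "x < x3" for x
  proof -
    have xx: "x < x1" "x < x2" using x by (auto simp: x3_def)
    obtain N where N [measurable]: "N \<in> sets borel" and Nm: "emeasure lborel N \<le> ennreal (C * x)"
      and Nneg: "\<And>t. \<sigma> * (indicator \<Omega> (p x t) - indicator \<Omega> (q x t)) < 0 \<Longrightarrow> t \<in> N"
      using neg[OF x(1) xx(1)] unfolding p_def q_def by blast
    define \<Delta> where "\<Delta> t = indicator {-1..1} t * \<bar>g (p x t) - g (q x t)\<bar>" for t :: real
    have [measurable]: "\<Delta> \<in> borel_measurable borel" unfolding \<Delta>_def by measurable
    have \<Delta>0: "\<Delta> t \<ge> 0" for t by (simp add: \<Delta>_def)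
    have \<Delta>nn: "(\<integral>\<^sup>+t. ennreal (\<Delta> t) \<partial>lborel) \<le> ennreal (\<epsilon> * sqrt x)"
      unfolding \<Delta>_def by (rule gain'[OF x(1) xx(2)])
    have i\<Delta>: "integrable lborel \<Delta>"
      by (rule integrableI_bounded) (use \<Delta>nn \<Delta>0 in \<open>auto intro: le_less_trans\<close>)
    have \<Delta>int: "(\<integral>t. \<Delta> t \<partial>lborel) \<le> \<epsilon> * sqrt x"
      using \<Delta>nn \<open>\<epsilon> > 0\<close> x(1) nn_integral_eq_integral[OF i\<Delta>] \<Delta>0 by (simp add: ennreal_le_iff)
    have Nfin: "emeasure lborel N < \<infinity>" using Nm by (rule le_less_trans) simp
    have iN: "integrable lborel (indicat_real N)" using Nfin by (intro integrable_real_indicator) auto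
    have "ennreal (measure lborel N) \<le> ennreal (C * x)"
      using Nm Nfin by (simp add: emeasure_eq_ennreal_measure)
    then have Nmeas: "measure lborel N \<le> C * x" using C x(1) by (simp add: ennreal_le_iff)
    let ?S = "{t0 - k * sqrt x..t0 + k * sqrt x}"
    have iS: "integrable lborel (indicat_real ?S)" by (intro integrable_real_indicator) (auto simp: emeasure_lborel_Icc_eq)
    \<comment> \<open>An integrable minorant of the signed difference of the integrands, valid in
      all four cases of membership of the two points.\<close>
    define low where "low t = m * indicator ?S t - M * indicator N t - (L * x * (indicator {-1..1} t * 1) + M * \<Delta> t)" for t
    have le: "low t \<le> \<sigma> * (H (s0 + x) t - H (s0 - x) t)" for t
    proof -
      have S: "\<sigma> * (indicator \<Omega> (p x t) - indicator \<Omega> (q x t)) = 1" if "t \<in> ?S"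
        unfolding p_def q_def using that by (intro pos x(1) xx(1)) (auto simp: abs_le_iff)
      have ge: "m \<le> W y * exp (- g y)" if "y \<in> \<Omega>" for y
        unfolding m_def using W(1) W(2)[OF that] g(2)[of y] by (intro mult_mono) auto
      have upp: "W y * exp (- g y) \<le> M" if "y \<in> \<Omega>" for y
      proof -
        have "W y * exp (- g y) \<le> M * 1"
          using W(1) W(2,3)[OF that] g(1)[of y] \<open>M > 0\<close> by (intro mult_mono) auto
        then show ?thesis by simp
      qed
      have rest: "0 \<le> L * x * (indicator {-1..1} t * 1) + M * \<Delta> t" "0 \<le> M * indicator N t"
        using L(1) x(1) \<open>M > 0\<close> \<Delta>0[of t] by (auto intro!: add_nonneg_nonneg mult_nonneg_nonneg)
      have "m * indicator ?S t \<le> m" using \<open>m > 0\<close> by (auto split: split_indicator)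
      then have upm: "low t \<le> m" unfolding low_def using rest by linarith
      have \<sigma>c: "\<sigma> = 1 \<or> \<sigma> = -1" using \<sigma> by linarith
      have Hp: "H (s0 + x) t = W (p x t) * indicator \<Omega> (p x t) * exp (- g (p x t))"
        and Hq: "H (s0 - x) t = W (q x t) * indicator \<Omega> (q x t) * exp (- g (q x t))"
        by (simp_all add: H_def p_def q_def)
      consider "p x t \<in> \<Omega>" "q x t \<in> \<Omega>" | "p x t \<notin> \<Omega>" "q x t \<notin> \<Omega>"
        | "p x t \<in> \<Omega>" "q x t \<notin> \<Omega>" | "p x t \<notin> \<Omega>" "q x t \<in> \<Omega>" by blast
      then show ?thesis
      proof cases
        case 1
        have "t \<notin> ?S" using S 1 by auto
        have t: "t \<in> {-1..1}" using tb 1(1) unfolding p_def by blast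
        have "\<bar>W (p x t) * exp (- g (p x t)) - W (q x t) * exp (- g (q x t))\<bar> =
          \<bar>(W (p x t) - W (q x t)) * exp (- g (p x t)) + W (q x t) * (exp (- g (p x t)) - exp (- g (q x t)))\<bar>"
          by (simp add: algebra_simps)
        also have "\<dots> \<le> \<bar>W (p x t) - W (q x t)\<bar> * exp (- g (p x t)) + \<bar>W (q x t)\<bar> * \<bar>exp (- g (p x t)) - exp (- g (q x t))\<bar>"
          by (rule order_trans[OF abs_triangle_ineq]) (simp add: abs_mult)
        also have "\<dots> \<le> (L * x) * 1 + M * \<bar>g (p x t) - g (q x t)\<bar>"
          using L 1 x(1) g(1) W(1) W(2,3)[OF 1(2)] \<open>M > 0\<close> unfolding p_def q_def
          by (intro add_mono mult_mono exp_minus_lipschitz) auto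
        finally have "\<bar>H (s0 + x) t - H (s0 - x) t\<bar> \<le> L * x + M * \<Delta> t"
          using 1 t by (simp add: Hp Hq \<Delta>_def)
        moreover have "\<bar>\<sigma> * (H (s0 + x) t - H (s0 - x) t)\<bar> = \<bar>H (s0 + x) t - H (s0 - x) t\<bar>"
          using \<sigma> by (simp add: abs_mult)
        ultimately show ?thesis using \<open>t \<notin> ?S\<close> t rest unfolding low_def by (simp del: atLeastAtMost_iff)
      next
        case 2
        then have "t \<notin> ?S" using S by auto
        then show ?thesis using 2 rest unfolding low_def Hp Hq by (simp del: atLeastAtMost_iff)
      next
        case 3
        have eq: "H (s0 + x) t - H (s0 - x) t = W (p x t) * exp (- g (p x t))"
          using 3 by (simp add: Hp Hq)
        show ?thesis
        proof (cases "\<sigma> = 1")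
          case True
          have "low t \<le> W (p x t) * exp (- g (p x t))" using upm ge[OF 3(1)] by linarith
          then show ?thesis by (simp only: eq True mult_1)
        next
          case False
          then have s: "\<sigma> = -1" using \<sigma>c by simp
          then have "t \<notin> ?S" "t \<in> N" using S 3 Nneg[of t] by auto
          then have "low t \<le> - M" unfolding low_def using rest by (simp del: atLeastAtMost_iff)
          with upp[OF 3(1)] have "low t \<le> - (W (p x t) * exp (- g (p x t)))" by linarith
          then show ?thesis by (simp only: eq s mult_minus1)
        qed
      next
        case 4
        have eq: "H (s0 + x) t - H (s0 - x) t = - (W (q x t) * exp (- g (q x t)))"
          using 4 by (simp add: Hp Hq)
        show ?thesis
        proof (cases "\<sigma> = 1")
          case True
          then have "t \<notin> ?S" "t \<in> N" using S 4 Nneg[of t] by auto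
          then have "low t \<le> - M" unfolding low_def using rest by (simp del: atLeastAtMost_iff)
          with upp[OF 4(2)] have "low t \<le> - (W (q x t) * exp (- g (q x t)))" by linarith
          then show ?thesis by (simp only: eq True mult_1)
        next
          case False
          then have s: "\<sigma> = -1" using \<sigma>c by simp
          have "low t \<le> W (q x t) * exp (- g (q x t))" using upm ge[OF 4(2)] by linarith
          then show ?thesis by (simp only: eq s mult_minus1 minus_minus)
        qed
      qed
    qed
    have ilow: "integrable lborel low"
      unfolding low_def
      by (intro Bochner_Integration.integrable_diff Bochner_Integration.integrable_add integrable_mult_right iS iN iI i\<Delta>)
    have "(\<integral>t. low t \<partial>lborel) \<le> (\<integral>t. \<sigma> * (H (s0 + x) t - H (s0 - x) t) \<partial>lborel)"
      by (rule integral_mono[OF ilow _ le]) (intro integrable_mult_right Bochner_Integration.integrable_diff iH)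
    also have "\<dots> = \<sigma> * ((\<integral>t. H (s0 + x) t \<partial>lborel) - (\<integral>t. H (s0 - x) t \<partial>lborel))"
      using iH by simp
    finally have up: "(\<integral>t. low t \<partial>lborel) \<le> \<dots>" .
    have "(\<integral>t. low t \<partial>lborel) = m * (\<integral>t. indicator ?S t \<partial>lborel) - M * (\<integral>t. indicator N t \<partial>lborel) - (L * x * (\<integral>t. indicator {-1..1::real} t * 1 \<partial>lborel) + M * (\<integral>t. \<Delta> t \<partial>lborel))"
      unfolding low_def
      by (simp only: Bochner_Integration.integral_diff Bochner_Integration.integral_add integral_mult_right_zero
          Bochner_Integration.integrable_diff Bochner_Integration.integrable_add integrable_mult_right iS iN iI i\<Delta>)
    also have "\<dots> = m * (2 * (k * sqrt x)) - M * measure lborel N - (L * x * 2 + M * (\<integral>t. \<Delta> t \<partial>lborel))"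
      using k x(1) by simp
    also have "\<dots> \<ge> m * (2 * (k * sqrt x)) - M * (C * x) - (L * x * 2 + M * (\<epsilon> * sqrt x))"
    proof -
      have "M * measure lborel N \<le> M * (C * x)" "M * (\<integral>t. \<Delta> t \<partial>lborel) \<le> M * (\<epsilon> * sqrt x)"
        using Nmeas \<Delta>int \<open>M > 0\<close> by (intro mult_left_mono; simp)+
      then show ?thesis by linarith
    qed
    finally have low: "m * (2 * (k * sqrt x)) - M * (C * x) - (L * x * 2 + M * (\<epsilon> * sqrt x)) \<le> (\<integral>t. low t \<partial>lborel)" .
    have "M * (\<epsilon> * sqrt x) = m * k * sqrt x" using \<open>M > 0\<close> by (simp add: \<epsilon>_def)
    moreover have "m * (2 * (k * sqrt x)) = 2 * (m * k * sqrt x)" "K * x = M * (C * x) + L * x * 2"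
      by (simp_all add: K_def algebra_simps)
    ultimately have low': "m * k * sqrt x - K * x \<le> (\<integral>t. low t \<partial>lborel)" using low by linarith
    have "sqrt x \<le> m * k / (2 * (K + 1))"
      using x \<open>m > 0\<close> k \<open>K \<ge> 0\<close> by (intro real_le_lsqrt) (auto simp: x3_def)
    then have "sqrt x * (2 * (K + 1)) \<le> m * k" using \<open>K \<ge> 0\<close> by (simp add: field_simps)
    moreover have "sqrt x * (2 * K) \<le> sqrt x * (2 * (K + 1))" using x(1) by (intro mult_left_mono) auto
    ultimately have "sqrt x * K \<le> m * k / 2" by linarith
    then have "(sqrt x * K) * sqrt x \<le> m * k / 2 * sqrt x" using x(1) by (intro mult_right_mono) auto
    moreover have "(sqrt x * K) * sqrt x = K * x" using x(1) by (simp add: mult.commute mult.left_commute)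
    ultimately have "K * x \<le> m * k / 2 * sqrt x" by simp
    moreover have "m * k * sqrt x = m * k / 2 * sqrt x + m * k / 2 * sqrt x" by simp
    ultimately show ?thesis using low' up by linarith
  qed
  then show ?thesis using \<open>x3 > 0\<close> \<open>m > 0\<close> k by (intro exI[of _ "m * k / 2"] conjI exI[of _ x3]) auto
qed

text \<open>The intermediate point of the mean value theorem has both coordinates below 1 in
  absolute value, hence norm at most 2; on that ball the derivative is bounded.\<close>

lemma smooth_on_lipschitz_along_line:
  fixes f :: "real^2 \<Rightarrow> real"
  assumes "smooth_on UNIV f"
  obtains L where "L \<ge> 0" "\<And>s0 x t. x > 0 \<Longrightarrow> norm (line_point \<theta> (s0 + x) t) < 1 \<Longrightarrow> norm (line_point \<theta> (s0 - x) t) < 1 \<Longrightarrow>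
    \<bar>f (line_point \<theta> (s0 + x) t) - f (line_point \<theta> (s0 - x) t)\<bar> \<le> L * x"
proof -
  have "compact ((\<lambda>y. frechet_derivative f (at y) (direction \<theta>)) ` cball 0 2)"
    by (intro compact_continuous_image continuous_on_subset[OF smooth_on_directional_continuous_on[OF _ assms]]) auto
  then have "bounded ((\<lambda>y. frechet_derivative f (at y) (direction \<theta>)) ` cball 0 2)"
    by (rule compact_imp_bounded)
  then obtain B where "\<forall>r\<in>(\<lambda>y. frechet_derivative f (at y) (direction \<theta>)) ` cball 0 2. norm r \<le> B"
    unfolding bounded_iff ..
  then have B: "\<bar>frechet_derivative f (at y) (direction \<theta>)\<bar> \<le> B" if "y \<in> cball 0 2" for y
    using that by (simp only: ball_simps real_norm_def)
  have "B \<ge> 0" using B[of 0] by auto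
  show ?thesis
  proof (rule that[of "2 * B"])
    fix s0 x t
    assume x: "x > 0" and n: "norm (line_point \<theta> (s0 + x) t) < 1" "norm (line_point \<theta> (s0 - x) t) < 1"
    have "-x < x" using x by simp
    from line_point_MVT1[OF assms this UNIV_I, of \<theta> s0 t]
    obtain z where z: "-x < z" "z < x" "f (line_point \<theta> (s0 + x) t) - f (line_point \<theta> (s0 + -x) t) =
        (x - -x) * frechet_derivative f (at (line_point \<theta> (s0 + z) t)) (direction \<theta>)"
      by (elim exE conjE) (rule that)
    have "\<bar>s0 + x\<bar> < 1" "\<bar>s0 - x\<bar> < 1" "\<bar>t\<bar> < 1"
      using norm_line_point_ge[of t \<theta> "s0 + x"] norm_line_point_ge[of "s0 - x" \<theta> t] norm_line_point_ge(2)[of "s0 + x" \<theta> t]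
        norm_line_point_ge(2)[of "s0 - x" \<theta> t] norm_line_point_ge(1)[of t \<theta> "s0 + x"] n by linarith+
    then have "\<bar>s0 + z\<bar> + \<bar>t\<bar> \<le> 2" using z by linarith
    then have "norm (line_point \<theta> (s0 + z) t) \<le> 2"
      using dist_line_point[of \<theta> "s0 + z" t 0 0] by (simp add: line_point_def)
    then have "\<bar>frechet_derivative f (at (line_point \<theta> (s0 + z) t)) (direction \<theta>)\<bar> \<le> B" by (intro B) auto
    then show "\<bar>f (line_point \<theta> (s0 + x) t) - f (line_point \<theta> (s0 - x) t)\<bar> \<le> 2 * B * x"
      using z(3) x by (simp add: abs_mult mult.commute)
  qed (use \<open>B \<ge> 0\<close> in simp)
qed

section \<open>The non-linear transform at a tangent line\<close>

lemma isCont_indicator_mult: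
  fixes u :: "'a::t2_space \<Rightarrow> real"
  assumes "isCont u x" "x \<notin> frontier \<Omega>"
  shows "isCont (\<lambda>x. u x * indicator \<Omega> x) x"
proof -
  define V where "V = (if x \<in> interior \<Omega> then interior \<Omega> else - closure \<Omega>)"
  have V: "open V" "x \<in> V" using assms(2) by (auto simp: V_def frontier_def)
  have "indicator \<Omega> y = (if x \<in> interior \<Omega> then 1 else 0 :: real)" if "y \<in> V" for y
    using that interior_subset[of \<Omega>] closure_subset[of \<Omega>] by (auto simp: V_def indicator_def split: if_splits)
  then have "\<forall>\<^sub>F y in nhds x. u y * indicator \<Omega> y = u y * (if x \<in> interior \<Omega> then 1 else 0 :: real)"
    unfolding eventually_nhds using V by (intro exI[of _ V]) simp
  then have "isCont (\<lambda>x. u x * indicator \<Omega> x) x \<longleftrightarrow> isCont (\<lambda>y. u y * (if x \<in> interior \<Omega> then 1 else 0 :: real)) x"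
    by (rule isCont_cong)
  then show ?thesis using assms(1) by (simp add: continuous_intros)
qed

lemma integral_lborel_reflect:
  fixes f :: "'a::euclidean_space \<Rightarrow> real"
  assumes [measurable]: "f \<in> borel_measurable borel"
  shows "(\<integral>y. f y \<partial>lborel) = (\<integral>y. f (z - y) \<partial>lborel)"
  using integral_lborel_affine[OF assms, of "-1" z] by simp

theorem theorem4p14:
  fixes a b \<psi> c0 lam s0 \<theta>0 :: real
    and w u k f :: "real^2 \<Rightarrow> real"
    and \<Omega> :: "(real^2) set"
  assumes "a > 0" and "b > 0" and "2 * \<psi> \<in> {0<..<pi}" and "c0 > 0"
    and "smooth_on UNIV w" and "\<And>x. x \<in> ball 0 1 \<Longrightarrow> w x > 0"
    and "compact_smooth_domain \<Omega>" and "\<Omega> \<subseteq> ball 0 1"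
    and "smooth_on UNIV u" and "\<And>x. u x > 0"
    and "f = (\<lambda>x. u x * indicator \<Omega> x)"
    and "\<theta>0 \<in> {-pi..pi}"
    and "tangent_points \<Omega> s0 \<theta>0 \<noteq> {}"
    and "(\<exists>p q. p \<noteq> q \<and> tangent_points \<Omega> s0 \<theta>0 = closed_segment p q) \<or>
         (\<exists>p \<kappa>. tangent_points \<Omega> s0 \<theta>0 = {p} \<and> has_curvature_at (frontier \<Omega>) p \<kappa> \<and> \<kappa> \<noteq> 0)"
    and "smoothing_kernel k"
    and "lam > 1" and "in_H lam \<infinity> (distribution_of (\<lambda>x. complex_of_real (k x)))"
  shows "\<not> in_H_near 1 2
           (distribution_of (\<lambda>s. complex_of_real (nonlinear_transform c0 w k a b \<psi> f s \<theta>0))) s0"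
proof -
  note ab = assms(1,2) and c0 = assms(4) and w = assms(5,6) and dom = assms(7,8) and u = assms(9,10)
    and f = assms(11) and ne = assms(13) and T = assms(14) and k = assms(15) and lam = assms(16,17)
  have "compact \<Omega>" "\<Omega> \<noteq> {}" using dom(1) by (auto simp: compact_smooth_domain_def)
  have [measurable]: "\<Omega> \<in> sets borel" using \<open>compact \<Omega>\<close> by (rule borel_compact)
  have cont: "isCont h x" if "smooth_on UNIV h" for h :: "real^2 \<Rightarrow> real" and x
    using smooth_on_differentiable[OF that] by (intro differentiable_imp_continuous_within) auto
  have cw: "continuous_on S w" and cu: "continuous_on S u" for S
    using cont w(1) u(1) by (auto intro: continuous_at_imp_continuous_on)
  have [measurable]: "w \<in> borel_measurable borel" "u \<in> borel_measurable borel"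
    by (auto intro: borel_measurable_continuous_onI cw cu)
  have [measurable]: "f \<in> borel_measurable borel" unfolding f by measurable
  have bnd: "\<exists>K. \<forall>y\<in>\<Omega>. \<bar>h y\<bar> \<le> K" if "continuous_on \<Omega> h" for h :: "real^2 \<Rightarrow> real"
    using compact_imp_bounded[OF compact_continuous_image[OF that \<open>compact \<Omega>\<close>]] by (simp add: bounded_iff)
  obtain Mu where Mu: "\<And>y. y \<in> \<Omega> \<Longrightarrow> \<bar>u y\<bar> \<le> Mu" using bnd[OF cu] by blast
  obtain Mw where Mw: "\<And>y. y \<in> \<Omega> \<Longrightarrow> \<bar>w y\<bar> \<le> Mw" using bnd[OF cw] by blast
  have "Mu \<ge> 0" "Mw \<ge> 0" using Mu Mw \<open>\<Omega> \<noteq> {}\<close> by (meson abs_ge_zero all_not_in_conv order_trans)+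
  define W where "W y = w y * u y" for y
  have [measurable]: "W \<in> borel_measurable borel" unfolding W_def by measurable
  obtain y0 where y0: "y0 \<in> \<Omega>" "\<And>y. y \<in> \<Omega> \<Longrightarrow> W y0 \<le> W y"
    using continuous_attains_inf[OF \<open>compact \<Omega>\<close> \<open>\<Omega> \<noteq> {}\<close>, of W] cw cu unfolding W_def
    by (metis continuous_on_mult)
  have W0: "W y0 > 0" using w(2)[of y0] u(2) y0(1) dom(2) by (auto simp: W_def)
  have WM: "W y \<le> Mw * Mu" if "y \<in> \<Omega>" for y
    using mult_mono[OF Mw[OF that] Mu[OF that]] \<open>Mw \<ge> 0\<close> abs_ge_self[of "W y"] by (simp add: W_def abs_mult)
  have f0: "0 \<le> f x" "f x \<le> Mu" and fout: "norm x \<ge> 1 \<Longrightarrow> f x = 0" for x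
  proof -
    show "0 \<le> f x" using u(2)[of x] by (simp add: f)
    show "f x \<le> Mu" using Mu[of x] \<open>Mu \<ge> 0\<close> by (auto simp: f split: split_indicator)
    show "f x = 0" if "norm x \<ge> 1" using that dom(2) by (auto simp: f split: split_indicator)
  qed
  have fcont: "isCont f x" if "x \<notin> frontier \<Omega>" for x
    unfolding f by (rule isCont_indicator_mult[OF cont[OF u(1)] that])
  have k0: "\<And>x. k x \<ge> 0" "integrable lebesgue k" "(\<integral>x. k x \<partial>lebesgue) = 1" "bounded {x. k x \<noteq> 0}"
    using k by (auto simp: smoothing_kernel_def)
  \<comment> \<open>The kernel is only Lebesgue measurable; all convolution estimates use a Borel
    representative.\<close>
  obtain k' where k' [measurable]: "k' \<in> borel_measurable borel" and kae: "AE x in lborel. k x = k' x"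
    using completion_ex_borel_measurable_real[OF borel_measurable_integrable[OF k0(2)]] by auto
  have ik': "integrable lborel k'"
  proof -
    have m: "k' \<in> borel_measurable lborel" by simp
    have "integrable lebesgue k'"
      using integrable_cong_AE[OF borel_measurable_integrable[OF k0(2)] measurable_completion[OF m] AE_completion[OF kae]] k0(2) by simp
    then show ?thesis using integrable_completion[OF m] by simp
  qed
  have k'1: "(\<integral>x. k' x \<partial>lborel) = 1"
    using integral_lebesgue_AE_borel[OF k' kae] k0(3) by simp
  have k'0: "AE x in lborel. k' x \<ge> 0" using kae by eventually_elim (metis k0(1))
  obtain r0 where r0: "\<And>x. k x \<noteq> 0 \<Longrightarrow> norm x \<le> r0"
    using k0(4) unfolding bounded_iff by auto
  define r where "r = max r0 0"
  have r: "\<And>x. k x \<noteq> 0 \<Longrightarrow> norm x \<le> r" "r \<ge> 0" using r0 by (auto simp: r_def le_max_iff_disj)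
  \<comment> \<open>For \<open>norm x < 1\<close> and \<open>k (x - y) \<noteq> 0\<close> one has
    \<open>norm y \<le> r + 1 = R - 1\<close>, so truncation at \<open>R\<close> does not affect the
    smoothed transform on the unit ball.\<close>
  define R where "R = r + 2"
  have "R \<ge> 0" using r by (simp add: R_def)
  define d1 where "d1 = direction (\<theta>0 + 2 * \<psi> - pi / 2)"
  define d2 where "d2 = direction (\<theta>0 - pi / 2)"
  have nd: "norm d1 = 1" "norm d2 = 1" by (simp_all add: d1_def d2_def)
  \<comment> \<open>The V-line transform with both rays truncated: bounded, of compact support and
    continuous almost everywhere, as the smoothing estimate requires.\<close>
  define V where "V y = a * trunc_ray f R d1 y + b * trunc_ray f R d2 y" for y
  have [measurable]: "V \<in> borel_measurable borel" unfolding V_def by measurable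
  define BV where "BV = a * (Mu * R) + b * (Mu * R)"
  have V: "0 \<le> V y" "V y \<le> BV" for y
    using trunc_ray_bounds[of f Mu R d1 y] trunc_ray_bounds[of f Mu R d2 y] f0 \<open>R \<ge> 0\<close> ab
    by (auto simp: V_def BV_def intro!: add_nonneg_nonneg add_mono mult_left_mono)
  have "BV \<ge> 0" using V[of 0] by linarith
  have Vabs: "\<bar>V y\<bar> \<le> BV" for y using V[of y] by simp
  have Vout: "V y = 0" if "norm y \<ge> R + 1" for y
    using that nd fout by (simp add: V_def trunc_ray_eq_0)
  have iV: "integrable lborel V"
  proof (rule Bochner_Integration.integrable_bound)
    show "integrable lborel (\<lambda>y::real^2. BV * indicator (cball 0 (R + 1)) y)"
      using emeasure_bounded_finite[of "cball (0::real^2) (R + 1)"]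
      by (intro integrable_mult_right integrable_real_indicator) auto
    show "AE y in lborel. norm (V y) \<le> norm (BV * indicator (cball 0 (R + 1)) y)"
      using Vabs Vout \<open>BV \<ge> 0\<close> by (intro AE_I2) (auto split: split_indicator)
  qed simp
  have Vcont: "AE y in lborel. isCont V y"
  proof -
    have "AE y in lborel. isCont (trunc_ray f R v) y" for v
      using f0 fcont \<open>R \<ge> 0\<close> by (intro trunc_ray_AE_isCont[OF dom(1), where B=Mu]) auto
    from this[of d1] this[of d2] show ?thesis
      unfolding V_def by eventually_elim (intro continuous_intros)
  qed
  have Veq: "vline_transform a b \<psi> f y \<theta>0 = V y" if "norm y \<le> R - 1" for y
    using that nd fout trunc_ray_eq_ray_integral[of f d1 y R] trunc_ray_eq_ray_integral[of f d2 y R]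
    by (simp add: vline_transform_def V_def d1_def d2_def)
  define g where "g z = (\<integral>x. k' x * V (z - x) \<partial>lborel)" for z
  have [measurable]: "g \<in> borel_measurable borel" unfolding g_def by measurable
  have g0: "0 \<le> g z" for z
    unfolding g_def using k'0 V by (intro integral_nonneg_AE) (auto elim!: eventually_mono)
  have gB: "g z \<le> BV" for z
  proof -
    have "g z \<le> (\<integral>x. k' x * BV \<partial>lborel)"
      unfolding g_def
    proof (rule integral_mono_AE)
      show "integrable lborel (\<lambda>x. k' x * V (z - x))"
        by (rule Bochner_Integration.integrable_bound[of lborel "\<lambda>x. k' x * BV"])
          (use ik' Vabs \<open>BV \<ge> 0\<close> in \<open>auto simp: abs_mult intro!: AE_I2 mult_left_mono\<close>)
      show "AE x in lborel. k' x * V (z - x) \<le> k' x * BV"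
        using k'0 by eventually_elim (intro mult_left_mono V)
    qed (use ik' in simp)
    then show ?thesis using k'1 by simp
  qed
  have smooth_eq: "smoothed_vline_transform k a b \<psi> f x \<theta>0 = g x" if "norm x < 1" for x
  proof -
    have "k (x - y) * vline_transform a b \<psi> f y \<theta>0 = k (x - y) * V y" for y
    proof (cases "k (x - y) = 0")
      case False
      have "norm y \<le> norm x + norm (x - y)" using norm_triangle_ineq4[of x "x - y"] by simp
      then have "norm y \<le> R - 1" using r(1)[OF False] that by (simp add: R_def)
      then show ?thesis by (simp add: Veq)
    qed simp
    then have "smoothed_vline_transform k a b \<psi> f x \<theta>0 = (\<integral>y. k (x - y) * V y \<partial>lebesgue)"
      by (simp only: smoothed_vline_transform_def)
    also have "\<dots> = (\<integral>y. k' (x - y) * V y \<partial>lborel)"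
      using AE_lborel_shift[OF kae, of x] by (intro integral_lebesgue_AE_borel) (auto elim!: eventually_mono)
    also have "\<dots> = g x"
      unfolding g_def by (subst integral_lborel_reflect[of "\<lambda>y. k' (x - y) * V y" x]) auto
    finally show ?thesis .
  qed
  define H where "H s t = W (line_point \<theta>0 s t) * indicator \<Omega> (line_point \<theta>0 s t) * exp (- g (line_point \<theta>0 s t))" for s t
  define Rf where "Rf s = c0 * (\<integral>t. H s t \<partial>lborel)" for s
  have Rf: "nonlinear_transform c0 w k a b \<psi> f s \<theta>0 = Rf s" for s
  proof -
    have "w x * f x * exp (- smoothed_vline_transform k a b \<psi> f x \<theta>0) = W x * indicator \<Omega> x * exp (- g x)" for x
      using smooth_eq[of x] dom(2) by (auto simp: f W_def split: split_indicator)
    then have "nonlinear_transform c0 w k a b \<psi> f s \<theta>0 = c0 * (\<integral>t. H s t \<partial>lebesgue)"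
      by (simp add: nonlinear_transform_def line_integral_def H_def line_point_def)
    also have "(\<integral>t. H s t \<partial>lebesgue) = (\<integral>t. H s t \<partial>lborel)"
      by (rule integral_completion) (simp add: H_def)
    finally show ?thesis by (simp add: Rf_def)
  qed
  have [measurable]: "Rf \<in> borel_measurable borel" unfolding Rf_def H_def by measurable
  have RfK: "\<bar>Rf s\<bar> \<le> c0 * (Mw * Mu * 2)" for s
  proof -
    have i: "integrable lborel (\<lambda>t. Mw * Mu * indicator {-1..1::real} t)" by simp
    have "\<bar>H s t\<bar> \<le> Mw * Mu * indicator {-1..1} t" for t
    proof (cases "line_point \<theta>0 s t \<in> \<Omega>")
      case True
      have "norm (line_point \<theta>0 s t) < 1" using True dom(2) by auto
      then have "\<bar>t\<bar> \<le> 1" using norm_line_point_ge(1)[of t \<theta>0 s] by linarith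
      moreover have "\<bar>W (line_point \<theta>0 s t)\<bar> * exp (- g (line_point \<theta>0 s t)) \<le> (Mw * Mu) * 1"
        using True Mw[OF True] Mu[OF True] \<open>Mw \<ge> 0\<close> \<open>Mu \<ge> 0\<close> g0 unfolding W_def abs_mult
        by (intro mult_mono) auto
      ultimately show ?thesis using True by (simp add: H_def abs_mult abs_le_iff)
    qed (simp add: H_def \<open>Mw \<ge> 0\<close> \<open>Mu \<ge> 0\<close>)
    note le = this
    have "H s \<in> borel_measurable borel" unfolding H_def by measurable
    then have "integrable lborel (H s)"
      using le by (intro Bochner_Integration.integrable_bound[OF i]) (auto intro!: AE_I2 order_trans[OF le abs_ge_self])
    with le have "norm (\<integral>t. H s t \<partial>lborel) \<le> (\<integral>t. Mw * Mu * indicator {-1..1::real} t \<partial>lborel)"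
      using i by (intro Bochner_Integration.integral_norm_bound_integral) auto
    then show ?thesis using c0 by (simp add: Rf_def abs_mult)
  qed
  \<comment> \<open>A segment and a single point are both connected, which yields one sign for all
    tangent points.\<close>
  have "connected (tangent_points \<Omega> s0 \<theta>0)"
    using T by (auto intro: connected_segment)
  then obtain \<sigma> C \<kappa> x1 t0 where geo: "\<bar>\<sigma>\<bar> = (1::real)" "C \<ge> 0" "\<kappa> > 0" "x1 > 0"
    "\<And>x t. 0 < x \<Longrightarrow> x < x1 \<Longrightarrow> \<bar>t - t0\<bar> \<le> \<kappa> * sqrt x \<Longrightarrow>
      \<sigma> * (indicator \<Omega> (line_point \<theta>0 (s0 + x) t) - indicator \<Omega> (line_point \<theta>0 (s0 - x) t)) = 1"
    "\<And>x. 0 < x \<Longrightarrow> x < x1 \<Longrightarrow> \<exists>N\<in>sets borel. emeasure lborel N \<le> ennreal (C * x) \<and>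
      (\<forall>t. \<sigma> * (indicator \<Omega> (line_point \<theta>0 (s0 + x) t) - indicator \<Omega> (line_point \<theta>0 (s0 - x) t)) < 0 \<longrightarrow> t \<in> N)"
    by (rule tangency_geometry[OF dom ne]) (rule that)
  obtain Lw where Lw: "Lw \<ge> 0" "\<And>s0 x t. x > 0 \<Longrightarrow> norm (line_point \<theta>0 (s0 + x) t) < 1 \<Longrightarrow> norm (line_point \<theta>0 (s0 - x) t) < 1 \<Longrightarrow>
    \<bar>w (line_point \<theta>0 (s0 + x) t) - w (line_point \<theta>0 (s0 - x) t)\<bar> \<le> Lw * x"
    by (rule smooth_on_lipschitz_along_line[OF w(1)]) (rule that)
  obtain Lu where Lu: "Lu \<ge> 0" "\<And>s0 x t. x > 0 \<Longrightarrow> norm (line_point \<theta>0 (s0 + x) t) < 1 \<Longrightarrow> norm (line_point \<theta>0 (s0 - x) t) < 1 \<Longrightarrow>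
    \<bar>u (line_point \<theta>0 (s0 + x) t) - u (line_point \<theta>0 (s0 - x) t)\<bar> \<le> Lu * x"
    by (rule smooth_on_lipschitz_along_line[OF u(1)]) (rule that)
  have "\<exists>c>0. \<exists>x3>0. \<forall>x. 0 < x \<and> x < x3 \<longrightarrow> \<sigma> * ((\<integral>t. H (s0 + x) t \<partial>lborel) - (\<integral>t. H (s0 - x) t \<partial>lborel)) \<ge> c * sqrt x"
    unfolding H_def
  \<comment> \<open>The Lipschitz constant is that of the product \<open>w * u\<close>; the minimum
    \<open>W y0\<close> over the compact domain is positive because \<open>w\<close> and
    \<open>u\<close> are.\<close>
  proof (rule line_integral_jump[where ?t0.0=t0 and k=\<kappa> and ?x1.0=x1 and C=C and Wm="W y0" and M="Mw * Mu" and L="Lw * Mu + Mw * Lu" and G=BV])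
    show "Lw * Mu + Mw * Lu \<ge> 0" using Lw Lu \<open>Mu \<ge> 0\<close> \<open>Mw \<ge> 0\<close> by simp
    show "\<bar>W (line_point \<theta>0 (s0 + x) t) - W (line_point \<theta>0 (s0 - x) t)\<bar> \<le> (Lw * Mu + Mw * Lu) * x"
      if "x > 0" and in\<Omega>: "line_point \<theta>0 (s0 + x) t \<in> \<Omega>" "line_point \<theta>0 (s0 - x) t \<in> \<Omega>" for x t
    proof -
      let ?p = "line_point \<theta>0 (s0 + x) t" and ?q = "line_point \<theta>0 (s0 - x) t"
      have n: "norm ?p < 1" "norm ?q < 1" using in\<Omega> dom(2) by auto
      have "\<bar>W ?p - W ?q\<bar> = \<bar>(w ?p - w ?q) * u ?p + w ?q * (u ?p - u ?q)\<bar>"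
        by (simp add: W_def algebra_simps)
      also have "\<dots> \<le> \<bar>w ?p - w ?q\<bar> * \<bar>u ?p\<bar> + \<bar>w ?q\<bar> * \<bar>u ?p - u ?q\<bar>"
        by (rule order_trans[OF abs_triangle_ineq]) (simp add: abs_mult)
      also have "\<dots> \<le> (Lw * x) * Mu + Mw * (Lu * x)"
        using Lw(2)[OF that(1) n] Lu(2)[OF that(1) n] Mu[OF in\<Omega>(1)] Mw[OF in\<Omega>(2)] Lw(1) \<open>Mw \<ge> 0\<close> that(1)
        by (intro add_mono mult_mono) auto
      finally show ?thesis by (simp add: algebra_simps)
    qed
    show "\<exists>x2>0. \<forall>x. 0 < x \<and> x < x2 \<longrightarrow>
      (\<integral>\<^sup>+t. ennreal (indicator {-1..1} t * \<bar>g (line_point \<theta>0 (s0 + x) t) - g (line_point \<theta>0 (s0 - x) t)\<bar>) \<partial>lborel) \<le> ennreal (\<epsilon> * sqrt x)"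
      if "\<epsilon> > 0" for \<epsilon>
    proof -
      have "\<exists>x2>0. \<forall>x s. 0 < x \<and> x < x2 \<longrightarrow>
        (\<integral>\<^sup>+t. ennreal (indicator {-1..1} t * \<bar>g (line_point \<theta>0 (s + x) t) - g (line_point \<theta>0 (s - x) t)\<bar>) \<partial>lborel) \<le> ennreal (\<epsilon> * sqrt x)"
        unfolding g_def line_point_def
        by (rule smoothing_gain[OF lam(2,1) ik' kae direction_pythagoras[where \<theta>=\<theta>0] iV Vabs Vcont that])
      then show ?thesis by blast
    qed
  qed (use geo dom(2) W0 y0(2) WM g0 gB in simp_all)
  then obtain c x3 where cx: "c > 0" "x3 > 0" "\<And>x. 0 < x \<Longrightarrow> x < x3 \<Longrightarrow>
    \<sigma> * ((\<integral>t. H (s0 + x) t \<partial>lborel) - (\<integral>t. H (s0 - x) t \<partial>lborel)) \<ge> c * sqrt x"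
    by blast
  have "\<not> in_H_near 1 2 (distribution_of (\<lambda>s. complex_of_real (Rf s))) s0"
  proof (rule not_in_H1_near[OF _ RfK geo(1) _ cx(2)])
    show "0 < c0 * c" using c0 cx(1) by simp
    show "c0 * c * sqrt x \<le> \<sigma> * (Rf (s0 + x) - Rf (s0 - x))" if "0 < x" "x < x3" for x
      using mult_left_mono[OF cx(3)[OF that], of c0] c0 by (simp add: Rf_def algebra_simps)
  qed simp
  then show ?thesis unfolding Rf .
qed

end
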